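(* Let $u^0,v^0,w^0:\mathbb{R}\to\mathbb{R}$ be infinitely differentiable functions, each of which is either compactly supported or satisfies a bound of the form $|f(x)|<Ce^{-\kappa x^2}$ with some constants $C,\kappa>0$. Let $T>0$, $H=\{(x,t):|x|<\infty,\ 0\le t\le T\}$, and for small $\varepsilon>0$ let $(u,v,w)(x,t,\varepsilon)$ be the solution on $H$ of $$\begin{cases}\varepsilon^2(u_t+k_1u_x)=-au+bv+\varepsilon^2c_1w,\\ \varepsilon^2(v_t+k_2v_x)=au-bv+\varepsilon^2c_2w,\\ w_t+k_3w_x=a_3u+b_3v+c_3w,\end{cases}$$ with $u(x,0,\varepsilon)=u^0(x)$, $v(x,0,\varepsilon)=v^0(x)$, $w(x,0,\varepsilon)=w^0(x)$. Let $N$ be any natural number. Then the solution can be represented as $$\begin{pmatrix} u(x,t,\varepsilon) \\ v(x,t,\varepsilon) \\ w(x,t,\varepsilon) \end{pmatrix}=\sum_{i=0}^{N}\varepsilon^i\left(\begin{pmatrix} \bar u_i(x,t) \\ \bar v_i(x,t) \\ \bar w_i(x,t) \end{pmatrix}+\begin{pmatrix} \pi_iu(x,\tau) \\ \pi_iv(x,\tau) \\ \pi_iw(x,\tau) \end{pmatrix}\right)+\begin{pmatrix} R_Nu(x,t,\varepsilon) \\ R_Nv(x,t,\varepsilon) \\ R_Nw(x,t,\varepsilon) \end{pmatrix},\qquad \tau=\frac{t}{\varepsilon^2},$$ where $\bar u_i,\bar v_i,\bar w_i$ are the regular terms and $\pi_iu,\pi_iv,\pi_iw$ the boundary functions of the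 asymptotic expansion (as defined in the context), and the residual term $(R_Nu,R_Nv,R_Nw)$ is the solution of the problem $$\begin{cases}\varepsilon^2\big((R_Nu)_t+k_1(R_Nu)_x\big)=-a\,R_Nu+b\,R_Nv+\varepsilon^2c_1R_Nw+O(\varepsilon^{N+1}),\\ \varepsilon^2\big((R_Nv)_t+k_2(R_Nv)_x\big)=a\,R_Nu-b\,R_Nv+\varepsilon^2c_2R_Nw+O(\varepsilon^{N+1}),\\ (R_Nw)_t+k_3(R_Nw)_x=a_3R_Nu+b_3R_Nv+c_3R_Nw+O(\varepsilon^{N+1}),\end{cases}$$ with initial conditions $R_Nu(x,0)=0$, $R_Nv(x,0)=0$, $R_Nw(x,0)=0$.
   Context: Here $a,b,a_3,b_3,c_1,c_2,c_3,k_1,k_2,k_3$ are real constants with $a>0$, $b>0$, and $\varepsilon$ with $0<\varepsilon\ll1$ is a small parameter. Subscripts $t,x,\tau$ denote partial derivatives. $O(\varepsilon^{N+1})$ denotes a function of $(x,t,\varepsilon)$ bounded in absolute value by $C\varepsilon^{N+1}$ for all sufficiently small $\varepsilon>0$ and all $(x,t)\in H$, with $C$ independent of $x,t,\varepsilon$ (but possibly depending on $N$). The terms of the expansion are obtained by formally substituting the series in powers of $\varepsilon$ into the system and equating equal powers of $\varepsilon$, separately for the functions of $(x,t)$ and the functions of $(x,\tau)$. Explicitly, all quantities with negative index being zero, for every $i\ge0$: (Regular terms) $\bar u_i,\bar v_i,\bar w_i$ are functions on $H$ with $$\begin{cases}\bar u_{i-2,t}+k_1\bar u_{i-2,x}=-a\bar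 u_i+b\bar v_i+c_1\bar w_{i-2},\\ \bar v_{i-2,t}+k_2\bar v_{i-2,x}=a\bar u_i-b\bar v_i+c_2\bar w_{i-2},\\ \bar w_{i,t}+k_3\bar w_{i,x}=a_3\bar u_i+b_3\bar v_i+c_3\bar w_i.\end{cases}$$ (Boundary functions) $\pi_iu,\pi_iv,\pi_iw$ are functions of $x\in\mathbb{R}$, $\tau\ge0$ with $$\begin{cases}(\pi_iu)_\tau+k_1(\pi_{i-2}u)_x=-a\,\pi_iu+b\,\pi_iv+c_1\pi_{i-2}w,\\ (\pi_iv)_\tau+k_2(\pi_{i-2}v)_x=a\,\pi_iu-b\,\pi_iv+c_2\pi_{i-2}w,\\ (\pi_iw)_\tau+k_3(\pi_{i-2}w)_x=a_3\pi_{i-2}u+b_3\pi_{i-2}v+c_3\pi_{i-2}w,\end{cases}$$ and $\pi_iu,\pi_iv,\pi_iw\to0$ as $\tau\to+\infty$. (Initial conditions) $\bar u_0(x,0)+\pi_0u(x,0)=u^0(x)$, $\bar v_0(x,0)+\pi_0v(x,0)=v^0(x)$, $\bar w_0(x,0)+\pi_0w(x,0)=w^0(x)$, and for $i\ge1$: $\bar u_i(x,0)+\pi_iu(x,0)=0$, $\bar v_i(x,0)+\pi_iv(x,0)=0$, $\bar w_i(x,0)+\pi_iw(x,0)=0$. In particular, for $i=0$: $\bar v_0=\frac{a}{b}\bar u_0$, where $(\bar u_0,\bar w_0)$ solves $$\begin{cases}\bar u_{0,t}+V\bar u_{0,x}=C_0\bar w_0,\\ \bar w_{0,t}+k_3\bar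 w_{0,x}=c\,\bar u_0+c_3\bar w_0,\end{cases}\qquad V=\frac{bk_1+ak_2}{a+b},\quad C_0=\frac{b(c_1+c_2)}{a+b},\quad c=\frac{a_3b+ab_3}{b},$$ with $\bar u_0(x,0)=\frac{b}{a+b}\big(u^0(x)+v^0(x)\big)$, $\bar w_0(x,0)=w^0(x)$; and $\pi_0u=\psi(x)e^{-(a+b)\tau}$, $\pi_0v=-\psi(x)e^{-(a+b)\tau}$, $\pi_0w=0$ with $\psi(x)=\frac{a\,u^0(x)-b\,v^0(x)}{a+b}$.
   Formalization: The third residual equation has, besides O(ε^{N+1}), an initial-layer term ε^{-2}e^{-κt/ε²}·O(ε^{N+1}) with some κ>0, since the claim fails at t=0 without it; data satisfying the Gaussian bound are also assumed to have all derivatives bounded. *)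

theory Defs
  imports "HOL-Analysis.Analysis"
begin

text \<open>Functions of a space variable \<open>x\<close> (ranging over all reals) and a time variable \<open>t\<close> are
  curried, \<open>f x t\<close>. Times range over a closed interval \<open>I\<close>: \<open>{0..T}\<close> for functions on the strip
  \<open>H\<close>, and \<open>{0..}\<close> for functions of \<open>(x, \<tau>)\<close>. Time derivatives are taken within \<open>I\<close>, hence
  one-sided at its end points.\<close>

definition dx :: "(real \<Rightarrow> real \<Rightarrow> real) \<Rightarrow> real \<Rightarrow> real \<Rightarrow> real" where
  "dx f x t = deriv (\<lambda>y. f y t) x"

definition dt :: "real set \<Rightarrow> (real \<Rightarrow> real \<Rightarrow> real) \<Rightarrow> real \<Rightarrow> real \<Rightarrow> real" where
  "dt I f x t = vector_derivative (f x) (at t within I)"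

definition C1 :: "real set \<Rightarrow> (real \<Rightarrow> real \<Rightarrow> real) \<Rightarrow> bool" where
  "C1 I f \<longleftrightarrow>
     (\<forall>x. \<forall>t\<in>I. (\<lambda>y. f y t) differentiable (at x) \<and> f x differentiable (at t within I)) \<and>
     continuous_on (UNIV \<times> I) (\<lambda>(x, t). f x t) \<and>
     continuous_on (UNIV \<times> I) (\<lambda>(x, t). dx f x t) \<and>
     continuous_on (UNIV \<times> I) (\<lambda>(x, t). dt I f x t)"

definition infinitely_differentiable :: "(real \<Rightarrow> real) \<Rightarrow> bool" where
  "infinitely_differentiable f \<longleftrightarrow> (\<forall>n x. (deriv ^^ n) f differentiable (at x))"

definition compactly_supported :: "(real \<Rightarrow> real) \<Rightarrow> bool" where
  "compactly_supported f \<longleftrightarrow> compact (closure {x. f x \<noteq> 0})"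

definition gaussian_bounded :: "(real \<Rightarrow> real) \<Rightarrow> bool" where
  "gaussian_bounded f \<longleftrightarrow> (\<exists>C>0. \<exists>\<kappa>>0. \<forall>x. \<bar>f x\<bar> < C * exp (- \<kappa> * x\<^sup>2))"

text \<open>Boundedness of the derivatives is required besides the Gaussian bound: it does not follow
  from it (consider \<open>exp (- x\<^sup>2) * sin (exp (x ^ 4))\<close>), and the uniform estimates on the residual
  fail without it. For compactly supported \<open>f\<close> it is automatic.\<close>

definition admissible_datum :: "(real \<Rightarrow> real) \<Rightarrow> bool" where
  "admissible_datum f \<longleftrightarrow> infinitely_differentiable f \<and>
     (compactly_supported f \<or> gaussian_bounded f \<and> (\<forall>n. bounded (range ((deriv ^^ n) f))))"

text \<open>Classical solution, for one value of \<open>\<epsilon>\<close>, of the Cauchy problem with additional right-hand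
  sides \<open>f\<close>, \<open>g\<close>, \<open>h\<close> in the three equations (which are zero in the original problem).\<close>

definition cauchy_solution ::
  "real \<Rightarrow> real \<Rightarrow> real \<Rightarrow> real \<Rightarrow> real \<Rightarrow> real \<Rightarrow> real \<Rightarrow> real \<Rightarrow> real \<Rightarrow> real \<Rightarrow> real \<Rightarrow> real \<Rightarrow>
   (real \<Rightarrow> real \<Rightarrow> real) \<Rightarrow> (real \<Rightarrow> real \<Rightarrow> real) \<Rightarrow> (real \<Rightarrow> real \<Rightarrow> real) \<Rightarrow>
   (real \<Rightarrow> real) \<Rightarrow> (real \<Rightarrow> real) \<Rightarrow> (real \<Rightarrow> real) \<Rightarrow>
   (real \<Rightarrow> real \<Rightarrow> real) \<Rightarrow> (real \<Rightarrow> real \<Rightarrow> real) \<Rightarrow> (real \<Rightarrow> real \<Rightarrow> real) \<Rightarrow> bool" where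
  "cauchy_solution a b a3 b3 c1 c2 c3 k1 k2 k3 T \<epsilon> f g h u0 v0 w0 u v w \<longleftrightarrow>
     C1 {0..T} u \<and> C1 {0..T} v \<and> C1 {0..T} w \<and>
     (\<forall>x. \<forall>t\<in>{0..T}.
        \<epsilon>\<^sup>2 * (dt {0..T} u x t + k1 * dx u x t)
          = - a * u x t + b * v x t + \<epsilon>\<^sup>2 * c1 * w x t + f x t \<and>
        \<epsilon>\<^sup>2 * (dt {0..T} v x t + k2 * dx v x t)
          = a * u x t - b * v x t + \<epsilon>\<^sup>2 * c2 * w x t + g x t \<and>
        dt {0..T} w x t + k3 * dx w x t
          = a3 * u x t + b3 * v x t + c3 * w x t + h x t) \<and>
     (\<forall>x. u x 0 = u0 x \<and> v x 0 = v0 x \<and> w x 0 = w0 x)"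

text \<open>\<open>back2 F i\<close> is the term with index \<open>i - 2\<close>, and zero if this index is negative.\<close>

definition back2 :: "(nat \<Rightarrow> real \<Rightarrow> real \<Rightarrow> real) \<Rightarrow> nat \<Rightarrow> real \<Rightarrow> real \<Rightarrow> real" where
  "back2 F i = (if i < 2 then (\<lambda>x t. 0) else F (i - 2))"

definition regular_terms ::
  "real \<Rightarrow> real \<Rightarrow> real \<Rightarrow> real \<Rightarrow> real \<Rightarrow> real \<Rightarrow> real \<Rightarrow> real \<Rightarrow> real \<Rightarrow> real \<Rightarrow> real \<Rightarrow>
   (nat \<Rightarrow> real \<Rightarrow> real \<Rightarrow> real) \<Rightarrow> (nat \<Rightarrow> real \<Rightarrow> real \<Rightarrow> real) \<Rightarrow>
   (nat \<Rightarrow> real \<Rightarrow> real \<Rightarrow> real) \<Rightarrow> bool" where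
  "regular_terms a b a3 b3 c1 c2 c3 k1 k2 k3 T U V W \<longleftrightarrow> (\<forall>i.
     C1 {0..T} (U i) \<and> C1 {0..T} (V i) \<and> C1 {0..T} (W i) \<and>
     (\<forall>x. \<forall>t\<in>{0..T}.
        dt {0..T} (back2 U i) x t + k1 * dx (back2 U i) x t
          = - a * U i x t + b * V i x t + c1 * back2 W i x t \<and>
        dt {0..T} (back2 V i) x t + k2 * dx (back2 V i) x t
          = a * U i x t - b * V i x t + c2 * back2 W i x t \<and>
        dt {0..T} (W i) x t + k3 * dx (W i) x t
          = a3 * U i x t + b3 * V i x t + c3 * W i x t))"

definition boundary_functions ::
  "real \<Rightarrow> real \<Rightarrow> real \<Rightarrow> real \<Rightarrow> real \<Rightarrow> real \<Rightarrow> real \<Rightarrow> real \<Rightarrow> real \<Rightarrow> real \<Rightarrow>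
   (nat \<Rightarrow> real \<Rightarrow> real \<Rightarrow> real) \<Rightarrow> (nat \<Rightarrow> real \<Rightarrow> real \<Rightarrow> real) \<Rightarrow>
   (nat \<Rightarrow> real \<Rightarrow> real \<Rightarrow> real) \<Rightarrow> bool" where
  "boundary_functions a b a3 b3 c1 c2 c3 k1 k2 k3 P Q S \<longleftrightarrow> (\<forall>i.
     C1 {0..} (P i) \<and> C1 {0..} (Q i) \<and> C1 {0..} (S i) \<and>
     (\<forall>x. \<forall>\<tau>\<in>{0..}.
        dt {0..} (P i) x \<tau> + k1 * dx (back2 P i) x \<tau>
          = - a * P i x \<tau> + b * Q i x \<tau> + c1 * back2 S i x \<tau> \<and>
        dt {0..} (Q i) x \<tau> + k2 * dx (back2 Q i) x \<tau>
          = a * P i x \<tau> - b * Q i x \<tau> + c2 * back2 S i x \<tau> \<and>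
        dt {0..} (S i) x \<tau> + k3 * dx (back2 S i) x \<tau>
          = a3 * back2 P i x \<tau> + b3 * back2 Q i x \<tau> + c3 * back2 S i x \<tau>) \<and>
     (\<forall>x. (P i x \<longlongrightarrow> 0) at_top \<and> (Q i x \<longlongrightarrow> 0) at_top \<and> (S i x \<longlongrightarrow> 0) at_top))"

definition asymptotic_expansion ::
  "real \<Rightarrow> real \<Rightarrow> real \<Rightarrow> real \<Rightarrow> real \<Rightarrow> real \<Rightarrow> real \<Rightarrow> real \<Rightarrow> real \<Rightarrow> real \<Rightarrow> real \<Rightarrow>
   (real \<Rightarrow> real) \<Rightarrow> (real \<Rightarrow> real) \<Rightarrow> (real \<Rightarrow> real) \<Rightarrow>
   (nat \<Rightarrow> real \<Rightarrow> real \<Rightarrow> real) \<Rightarrow> (nat \<Rightarrow> real \<Rightarrow> real \<Rightarrow> real) \<Rightarrow>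
   (nat \<Rightarrow> real \<Rightarrow> real \<Rightarrow> real) \<Rightarrow> (nat \<Rightarrow> real \<Rightarrow> real \<Rightarrow> real) \<Rightarrow>
   (nat \<Rightarrow> real \<Rightarrow> real \<Rightarrow> real) \<Rightarrow> (nat \<Rightarrow> real \<Rightarrow> real \<Rightarrow> real) \<Rightarrow> bool" where
  "asymptotic_expansion a b a3 b3 c1 c2 c3 k1 k2 k3 T u0 v0 w0 U V W P Q S \<longleftrightarrow>
     regular_terms a b a3 b3 c1 c2 c3 k1 k2 k3 T U V W \<and>
     boundary_functions a b a3 b3 c1 c2 c3 k1 k2 k3 P Q S \<and>
     (\<forall>i x. U i x 0 + P i x 0 = (if i = 0 then u0 x else 0) \<and>
            V i x 0 + Q i x 0 = (if i = 0 then v0 x else 0) \<and>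
            W i x 0 + S i x 0 = (if i = 0 then w0 x else 0))"

text \<open>\<open>r = O(\<epsilon>\<^sup>m)\<close>, uniformly on the strip.\<close>

definition uniform_O :: "real \<Rightarrow> nat \<Rightarrow> (real \<Rightarrow> real \<Rightarrow> real \<Rightarrow> real) \<Rightarrow> bool" where
  "uniform_O T m r \<longleftrightarrow>
     (\<exists>C. \<forall>\<^sub>F \<epsilon> in at_right 0. \<forall>x. \<forall>t\<in>{0..T}. \<bar>r x t \<epsilon>\<bar> \<le> C * \<epsilon> ^ m)"

text \<open>The residual problem. The partial sums of the expansion satisfy the third equation only up to
  \<open>\<epsilon> ^ (N - 1) * G (N - 1) + \<epsilon> ^ N * G N\<close>, where \<open>G i\<close>, a function of \<open>x\<close> and
  \<open>\<tau> = t / \<epsilon>\<^sup>2\<close>, is the right-hand side of the equation for the \<open>\<tau>\<close>-derivative of \<open>S (i + 2)\<close>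
  in \<^const>\<open>boundary_functions\<close> (and zero for negative \<open>i\<close>). It decays exponentially in \<open>\<tau>\<close> but
  is not small at \<open>t = 0\<close>, hence the extra initial-layer term besides \<open>O(\<epsilon> ^ (N + 1))\<close>; this term, too,
  has a time integral of order \<open>\<epsilon> ^ (N + 1)\<close>.\<close>

definition residual_problem ::
  "real \<Rightarrow> real \<Rightarrow> real \<Rightarrow> real \<Rightarrow> real \<Rightarrow> real \<Rightarrow> real \<Rightarrow> real \<Rightarrow> real \<Rightarrow> real \<Rightarrow> real \<Rightarrow> nat \<Rightarrow>
   (real \<Rightarrow> real \<Rightarrow> real \<Rightarrow> real) \<Rightarrow> (real \<Rightarrow> real \<Rightarrow> real \<Rightarrow> real) \<Rightarrow>
   (real \<Rightarrow> real \<Rightarrow> real \<Rightarrow> real) \<Rightarrow> bool" where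
  "residual_problem a b a3 b3 c1 c2 c3 k1 k2 k3 T N Ru Rv Rw \<longleftrightarrow>
     (\<exists>\<kappa>>0. \<exists>r1 r2 r3 q.
        uniform_O T (N + 1) r1 \<and> uniform_O T (N + 1) r2 \<and>
        uniform_O T (N + 1) r3 \<and> uniform_O T (N + 1) q \<and>
        (\<forall>\<^sub>F \<epsilon> in at_right 0.
           cauchy_solution a b a3 b3 c1 c2 c3 k1 k2 k3 T \<epsilon>
             (\<lambda>x t. r1 x t \<epsilon>) (\<lambda>x t. r2 x t \<epsilon>)
             (\<lambda>x t. r3 x t \<epsilon> + exp (- \<kappa> * (t / \<epsilon>\<^sup>2)) / \<epsilon>\<^sup>2 * q x t \<epsilon>)
             (\<lambda>x. 0) (\<lambda>x. 0) (\<lambda>x. 0)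
             (\<lambda>x t. Ru x t \<epsilon>) (\<lambda>x t. Rv x t \<epsilon>) (\<lambda>x t. Rw x t \<epsilon>)))"

end

theory Submission
  imports Defs
begin

text \<open>
  Why the theorem holds.

  In each order \<open>i\<close> the two fast equations for the regular terms have a coefficient matrix of rank
  one. They prescribe \<open>b V\<^sub>i - a U\<^sub>i\<close> through the level \<open>i - 2\<close>; the remaining condition, that
  level \<open>i + 2\<close> be solvable, is obtained by adding its two fast equations, and together with the
  equation for \<open>W\<^sub>i\<close> it is a \<open>2 \<times> 2\<close> system of transport equations with speeds
  \<open>(b k1 + a k2) / (a + b)\<close> and \<open>k3\<close>. In the layer variables, the sum \<open>P\<^sub>i + Q\<^sub>i\<close> and \<open>S\<^sub>i\<close> are the
  antiderivatives of known functions that decay at infinity, and \<open>a P\<^sub>i - b Q\<^sub>i\<close> relaxes at rate \<open>a + b\<close>. The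
  initial conditions link the two families without circularity: \<open>P\<^sub>i + Q\<^sub>i\<close> and \<open>S\<^sub>i\<close> are known
  without initial data and give the initial values of \<open>U\<^sub>i + V\<^sub>i\<close> and \<open>W\<^sub>i\<close>, hence the regular terms,
  whose initial values give that of \<open>a P\<^sub>i - b Q\<^sub>i\<close>. This is \<open>next_level_exists\<close>, and recursion
  gives \<open>expansion_exists\<close>.

  The recursion consumes derivatives, so it needs classes of functions that are closed under all
  steps and consist of functions that are bounded with all their derivatives. For the regular
  terms this class is \<open>strip_smooth\<close>; the transport systems are solved in it by a Picard series, whose
  terms may be differentiated because the iteration commutes with \<open>x\<close>-derivatives
  (\<open>hyperbolic_existence\<close>). For the layer terms it is \<open>layer\<close>, the polynomials in \<open>\<tau>\<close>
  with bounded smooth coefficients in \<open>x\<close>, times \<open>exp (- (a + b) \<tau>)\<close>.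

  The theorem is about every expansion, whereas an expansion as such consists of \<open>C\<^sup>1\<close> functions
  without any growth condition in \<open>x\<close>. Finite speed of propagation (\<open>hyperbolic_uniqueness\<close>)
  makes the expansion unique (\<open>expansion_unique\<close>), so every expansion has the bounds of the
  constructed one.

  Finally, when the partial sum up to \<open>N\<close> is inserted into the system, level \<open>i\<close> contributes
  \<open>\<epsilon>\<^sup>2 E\<^sub>i - E\<^sub>i\<^sub>-\<^sub>2\<close> times \<open>\<epsilon> ^ i\<close>, where \<open>E\<^sub>i\<close> is the part of the equations that is of lower
  order; the sum telescopes and only the last two levels remain (\<open>telescope\<close>, \<open>residual_cauchy\<close>).
  In the third equation the layer terms are differentiated with respect to \<open>t = \<epsilon>\<^sup>2 \<tau>\<close>, which costs a factor
  \<open>1 / \<epsilon>\<^sup>2\<close>; this is the initial-layer term of the residual problem.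
\<close>

section \<open>Partial derivatives on a strip\<close>

text \<open>Working with explicit partial derivatives, rather than with \<^const>\<open>dx\<close> and \<^const>\<open>dt\<close>, keeps
  the values outside of \<open>I\<close>, which are arbitrary, out of the arguments.\<close>

definition partials ::
  "real set \<Rightarrow> (real \<Rightarrow> real \<Rightarrow> real) \<Rightarrow> (real \<Rightarrow> real \<Rightarrow> real) \<Rightarrow> (real \<Rightarrow> real \<Rightarrow> real) \<Rightarrow> bool" where
  "partials I f fx ft \<longleftrightarrow> (\<forall>x. \<forall>t\<in>I.
     ((\<lambda>y. f y t) has_real_derivative fx x t) (at x) \<and>
     (f x has_real_derivative ft x t) (at t within I))"

abbreviation cont :: "real set \<Rightarrow> (real \<Rightarrow> real \<Rightarrow> real) \<Rightarrow> bool" where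
  "cont I f \<equiv> continuous_on (UNIV \<times> I) (\<lambda>(x, t). f x t)"

text \<open>The condition under which derivatives within \<open>I\<close> are unique.\<close>

abbreviation perfect :: "real set \<Rightarrow> bool" where
  "perfect I \<equiv> (\<forall>t\<in>I. at t within I \<noteq> bot)"

lemma perfect_Icc: "0 < T \<Longrightarrow> perfect {0..T}"
  by (metis islimpt_Icc trivial_limit_within)

lemma perfect_Ici: "perfect {0..}"
proof
  fix t :: real assume "t \<in> {0..}"
  then have "t islimpt {t..t+1}" using islimpt_Icc[of t "t+1" t] by simp
  then have "t islimpt {0..}" by (rule islimpt_subset) (use \<open>t \<in> {0..}\<close> in auto)
  then show "at t within {0..} \<noteq> bot" by (simp add: trivial_limit_within)
qed

lemma partials_dx: "partials I f fx ft \<Longrightarrow> t \<in> I \<Longrightarrow> dx f x t = fx x t"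
  unfolding partials_def dx_def by (blast intro: DERIV_imp_deriv)

lemma partials_dt: "perfect I \<Longrightarrow> partials I f fx ft \<Longrightarrow> t \<in> I \<Longrightarrow> dt I f x t = ft x t"
  unfolding partials_def dt_def has_real_derivative_iff_has_vector_derivative
  by (blast intro: vector_derivative_within)

lemma partials_cong:
  assumes "partials I f fx ft" and "\<And>x t. t \<in> I \<Longrightarrow> g x t = f x t"
    and "\<And>x t. t \<in> I \<Longrightarrow> gx x t = fx x t" and "\<And>x t. t \<in> I \<Longrightarrow> gt x t = ft x t"
  shows "partials I g gx gt"
  unfolding partials_def
proof (intro allI ballI conjI)
  fix x t assume t: "t \<in> I"
  show "((\<lambda>y. g y t) has_real_derivative gx x t) (at x)"
    using assms t unfolding partials_def by simp
  show "(g x has_real_derivative gt x t) (at t within I)"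
    using assms(1) t unfolding partials_def assms(4)[OF t] has_field_derivative_def
    by (metis assms(2) has_derivative_transform)
qed

lemma C1D:
  assumes "C1 I f"
  shows "partials I f (dx f) (dt I f)" "cont I f" "cont I (dx f)" "cont I (dt I f)"
proof -
  show "partials I f (dx f) (dt I f)"
    using assms unfolding partials_def C1_def dx_def dt_def
      has_real_derivative_iff_has_vector_derivative[symmetric] 
    apply (intro allI ballI conjI)
    subgoal by (metis DERIV_deriv_iff_real_differentiable)
    subgoal using vector_derivative_works has_real_derivative_iff_has_vector_derivative by blast
    done
qed (use assms in \<open>auto simp: C1_def\<close>)

lemma C1I:
  assumes "perfect I" "partials I f fx ft" "cont I f" "cont I fx" "cont I ft"
  shows "C1 I f"
  unfolding C1_def
proof (intro conjI allI ballI)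
  fix x t assume t: "t \<in> I"
  show "(\<lambda>y. f y t) differentiable (at x)"
    using assms(2) t real_differentiable_def unfolding partials_def by blast
  show "f x differentiable (at t within I)"
    using assms(2) t real_differentiable_def unfolding partials_def by blast
next
  show "cont I f" by fact
  show "cont I (dx f)"
    using assms(4) by (rule continuous_on_eq) (use partials_dx[OF assms(2)] in auto)
  show "cont I (dt I f)"
    using assms(5) by (rule continuous_on_eq) (use partials_dt[OF assms(1,2)] in auto)
qed

lemma partials_lin:
  assumes "partials I f fx ft" "partials I g gx gt"
  shows "partials I (\<lambda>x t. c * f x t + d * g x t)
    (\<lambda>x t. c * fx x t + d * gx x t) (\<lambda>x t. c * ft x t + d * gt x t)"
  using assms unfolding partials_def by (auto intro!: derivative_eq_intros)

lemma cont_lin: "cont I f \<Longrightarrow> cont I g \<Longrightarrow> cont I (\<lambda>x t. c * f x t + d * g x t)"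
  unfolding case_prod_beta by (intro continuous_intros)

lemma C1_lin:
  assumes "perfect I" "C1 I f" "C1 I g"
  shows "C1 I (\<lambda>x t. c * f x t + d * g x t)"
  using C1D[OF assms(2)] C1D[OF assms(3)] by (intro C1I[OF assms(1) partials_lin] cont_lin)

lemma cont_comp:
  assumes "cont I f" "continuous_on A p" "continuous_on A q" "q ` A \<subseteq> I"
  shows "continuous_on A (\<lambda>z. f (p z) (q z))"
proof -
  have "continuous_on A (\<lambda>z. (p z, q z))" using assms by (intro continuous_intros)
  from continuous_on_compose2[OF assms(1) this] show ?thesis using assms(4) by auto
qed

text \<open>Continuity of one of the two partial derivatives is enough for total differentiability. It is
  imposed on the time derivative, which for the integrals below is explicit.\<close>

lemma total_derivative:
  fixes g :: "real \<Rightarrow> real \<Rightarrow> real"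
  assumes "((\<lambda>y. g y t) has_real_derivative gx) (at x)"
    and gt: "\<And>y s. s \<in> I \<Longrightarrow> (g y has_real_derivative gt y s) (at s within I)"
    and "cont I gt" "t \<in> I" "convex I"
  shows "((\<lambda>(y, s). g y s) has_derivative (\<lambda>(h, l). gx * h + gt x t * l)) (at (x, t) within UNIV \<times> I)"
proof -
  have "((\<lambda>(y, s). g y s) has_derivative (\<lambda>(h, l). gx * h + blinfun_apply (blinfun_mult_right (gt x t)) l))
      (at (x, t) within UNIV \<times> I)"
  proof (rule has_derivative_partialsI)
    show "((\<lambda>x. g x t) has_derivative (*) gx) (at x within UNIV)"
      using assms(1) by (simp add: has_field_derivative_def)
    show "((\<lambda>y. g z y) has_derivative blinfun_apply (blinfun_mult_right (gt z y))) (at y within I)"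
      if "y \<in> I" for y z
      using gt[OF that] by (simp add: has_field_derivative_def)
    have "continuous_on (UNIV \<times> I) (\<lambda>(x, y). blinfun_mult_right (gt x y))"
      using bounded_linear.continuous_on[OF bounded_linear_blinfun_mult_right assms(3)]
      by (simp add: case_prod_beta)
    from this[unfolded continuous_on_eq_continuous_within, rule_format, of "(x, t)"]
    show "continuous (at (x, t) within UNIV \<times> I) (\<lambda>(x, y). blinfun_mult_right (gt x y))"
      using \<open>t \<in> I\<close> by simp
  qed fact+
  then show ?thesis by simp
qed

lemma derivative_along_line:
  fixes g :: "real \<Rightarrow> real \<Rightarrow> real"
  assumes "((\<lambda>y. g y t) has_real_derivative gx) (at (p + q * t))"
    and gt: "\<And>y s. s \<in> I \<Longrightarrow> (g y has_real_derivative gt y s) (at s within I)"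
    and "cont I gt" "t \<in> I" "convex I"
  shows "((\<lambda>s. g (p + q * s) s) has_real_derivative gx * q + gt (p + q * t) t) (at t within I)"
proof -
  have 1: "((\<lambda>s. (p + q * s, s)) has_derivative (\<lambda>h. (q * h, h))) (at t within I)"
    by (auto intro!: derivative_eq_intros)
  have "((\<lambda>(y, s). g y s) has_derivative (\<lambda>(h, l). gx * h + gt (p + q * t) t * l))
     (at (p + q * t, t) within (\<lambda>s. (p + q * s, s)) ` I)"
    by (rule has_derivative_subset[OF total_derivative[OF assms]]) auto
  from has_derivative_in_compose[OF 1 this]
  have "((\<lambda>s. g (p + q * s) s) has_derivative (\<lambda>h. gx * (q * h) + gt (p + q * t) t * h)) (at t within I)"
    by simp
  then show ?thesis
    unfolding has_field_derivative_def by (rule has_derivative_eq_rhs) (auto simp: algebra_simps)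
qed

section \<open>Integration along characteristics\<close>

text \<open>The solution of \<open>u\<^sub>t + k u\<^sub>x = f\<close> with zero initial values.\<close>

definition char_integral :: "real \<Rightarrow> (real \<Rightarrow> real \<Rightarrow> real) \<Rightarrow> real \<Rightarrow> real \<Rightarrow> real" where
  "char_integral k f x t = integral {0..t} (\<lambda>s. f (x - k * (t - s)) s)"

lemma char_integrand_cont:
  assumes "cont {0..T} f" "t \<le> T"
  shows "continuous_on {0..t} (\<lambda>s. f (x - k * (t - s)) s)"
  by (rule cont_comp[OF assms(1)]) (use assms(2) in \<open>auto intro!: continuous_intros\<close>)

text \<open>Over a fixed interval of integration, joint continuity is an instance of the continuity of
  integrals with parameters.\<close>

lemma char_integral_unit:
  assumes "0 \<le> t"
  shows "char_integral k f x t = integral (cbox 0 1) (\<lambda>r. t * f (x - k * (t - t * r)) (t * r))"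
proof (cases "t = 0")
  case False
  then have t: "t > 0" using assms by simp
  have im: "(\<lambda>x. x / t) ` {0..t} = {0..1}"
    using t by (simp add: image_divide_atLeastAtMost)
  have "integral {0..1} (\<lambda>r. f (x - k * (t - t * r)) (t * r))
      = (1 / t) * integral {0..t} (\<lambda>s. f (x - k * (t - s)) s)"
    using integral_stretch_real[OF False, of 0 t "\<lambda>s. f (x - k * (t - s)) s"] t
    by (simp add: im)
  then show ?thesis using t by (simp add: char_integral_def)
qed (simp add: char_integral_def)

lemma char_integral_cont:
  assumes f: "cont {0..T} f"
  shows "cont {0..T} (char_integral k f)"
proof -
  let ?U = "(UNIV :: real set) \<times> {0..T}"
  let ?h = "\<lambda>z r. snd z * f (fst z - k * (snd z - snd z * r)) (snd z * r)"
  have "continuous_on (?U \<times> cbox 0 1) (\<lambda>w. f (fst (fst w) - k * (snd (fst w) - snd (fst w) * snd w)) (snd (fst w) * snd w))"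
  proof (rule cont_comp[OF f])
    have "s * r \<in> {0..T}" if "s \<in> {0..T}" "r \<in> {0..1}" for s r :: real
      using that mult_left_le[of r s] by auto
    then show "(\<lambda>w. snd (fst w) * snd w) ` (?U \<times> cbox 0 1) \<subseteq> {0..T}" by auto
  qed (intro continuous_intros)+
  then have "continuous_on (?U \<times> cbox 0 1) (\<lambda>(z, r). ?h z r)"
    unfolding case_prod_beta by (intro continuous_intros)
  from integral_continuous_on_param[OF this] show ?thesis
    by (rule continuous_on_eq) (auto simp: char_integral_unit)
qed

lemma shifted_integral_deriv:
  assumes f: "cont {0..T} f" and fx: "cont {0..T} fx"
    and d: "\<And>x t. t \<in> {0..T} \<Longrightarrow> ((\<lambda>y. f y t) has_real_derivative fx x t) (at x)"
    and "t \<le> T"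
  shows "((\<lambda>y. integral {0..t} (\<lambda>s. f (y + q * s) s)) has_real_derivative
          integral {0..t} (\<lambda>s. fx (x + q * s) s)) (at x)"
proof -
  have "((\<lambda>y. integral (cbox 0 t) (\<lambda>s. f (y + q * s) s)) has_real_derivative
          integral (cbox 0 t) (\<lambda>s. fx (x + q * s) s)) (at x within UNIV)"
  proof (rule leibniz_rule_field_derivative)
    fix x s assume s: "s \<in> cbox 0 t"
    then have "((\<lambda>y. f y s) has_real_derivative fx (x + q * s) s) (at (x + q * s))"
      using d \<open>t \<le> T\<close> by auto
    then show "((\<lambda>x. f (x + q * s) s) has_real_derivative fx (x + q * s) s) (at x within UNIV)"
      by (auto simp: DERIV_shift)
  next
    fix x
    have "continuous_on {0..t} (\<lambda>s. f (x + q * s) s)"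
      by (rule cont_comp[OF f]) (use \<open>t \<le> T\<close> in \<open>auto intro!: continuous_intros\<close>)
    then show "(\<lambda>s. f (x + q * s) s) integrable_on cbox 0 t"
      by (simp add: integrable_continuous_real)
  next
    have "continuous_on (UNIV \<times> cbox 0 t) (\<lambda>z. fx (fst z + q * snd z) (snd z))"
      by (rule cont_comp[OF fx]) (use \<open>t \<le> T\<close> in \<open>auto intro!: continuous_intros\<close>)
    then show "continuous_on (UNIV \<times> cbox 0 t) (\<lambda>(x, s). fx (x + q * s) s)"
      by (simp add: case_prod_beta)
  qed auto
  then show ?thesis by simp
qed

lemma char_integral_shift: "char_integral k f x t = integral {0..t} (\<lambda>s. f ((x - k * t) + k * s) s)"
  by (simp add: char_integral_def algebra_simps)

text \<open>In the coordinate \<open>y = x - k t\<close> that moves with the characteristics, \<open>t\<close> occurs in the integral only as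
  its upper limit; the chain rule along the line \<open>y = x - k t\<close> then gives the transport equation.\<close>

lemma char_integral_partials:
  assumes f: "cont {0..T} f" and fx: "cont {0..T} fx"
    and d: "\<And>x t. t \<in> {0..T} \<Longrightarrow> ((\<lambda>y. f y t) has_real_derivative fx x t) (at x)"
  shows "partials {0..T} (char_integral k f) (char_integral k fx) (\<lambda>x t. f x t - k * char_integral k fx x t)"
  unfolding partials_def
proof (intro allI ballI conjI)
  fix x t assume t: "t \<in> {0..T}"
  note L = shifted_integral_deriv[OF f fx d, of t]
  show "((\<lambda>y. char_integral k f y t) has_real_derivative char_integral k fx x t) (at x)"
    using L[of k "x - k * t"] t unfolding char_integral_shift
    by (simp add: DERIV_shift[of _ _ x "- (k * t)", simplified])
  define g where "g y t = integral {0..t} (\<lambda>s. f (y + k * s) s)" for y t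
  have "((\<lambda>s. g (x + (- k) * s) s) has_real_derivative
      integral {0..t} (\<lambda>s. fx (x + (- k) * t + k * s) s) * (- k) + f (x + (- k) * t + k * t) t)
     (at t within {0..T})"
  proof (rule derivative_along_line)
    show "((\<lambda>y. g y t) has_real_derivative
        integral {0..t} (\<lambda>s. fx (x + (- k) * t + k * s) s)) (at (x + (- k) * t))"
      unfolding g_def using L t by auto
    fix y s assume s: "s \<in> {0..T}"
    have "continuous_on {0..T} (\<lambda>s. f (y + k * s) s)"
      by (rule cont_comp[OF f]) (auto intro!: continuous_intros)
    from integral_has_real_derivative[OF this s]
    show "(g y has_real_derivative f (y + k * s) s) (at s within {0..T})"
      by (simp add: g_def[abs_def])
  next
    have "continuous_on (UNIV \<times> {0..T}) (\<lambda>z. f (fst z + k * snd z) (snd z))"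
      by (rule cont_comp[OF f]) (auto intro!: continuous_intros)
    then show "cont {0..T} (\<lambda>y s. f (y + k * s) s)" by (simp add: case_prod_beta)
  qed (use t in auto)
  then show "(char_integral k f x has_real_derivative f x t - k * char_integral k fx x t) (at t within {0..T})"
    unfolding char_integral_shift[abs_def] g_def by (simp add: algebra_simps)
qed

text \<open>In the norm weighted by \<open>exp (- l t)\<close> the integral gains a factor \<open>1 / l\<close>. With \<open>l\<close> twice the
  size of the coupling matrix, the Picard iteration contracts by \<open>1 / 2\<close> on a time interval of any length.\<close>

lemma char_integral_bound:
  assumes f: "cont {0..T} f" and t: "t \<in> {0..T}" and l: "l > 0" and "B \<ge> 0"
    and b: "\<And>x s. s \<in> {0..T} \<Longrightarrow> \<bar>f x s\<bar> \<le> B * exp (l * s)"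
  shows "\<bar>char_integral k f x t\<bar> \<le> B / l * exp (l * t)"
proof -
  have I: "((\<lambda>s. B * exp (l * s)) has_integral B / l * exp (l * t) - B / l * exp (l * 0)) {0..t}"
    using t l by (intro fundamental_theorem_of_calculus)
      (auto intro!: derivative_eq_intros simp: has_real_derivative_iff_has_vector_derivative[symmetric])
  have "\<bar>char_integral k f x t\<bar> \<le> integral {0..t} (\<lambda>s. B * exp (l * s))"
    unfolding char_integral_def real_norm_def[symmetric]
    by (rule integral_norm_bound_integral)
       (use char_integrand_cont[OF f] t I b in \<open>auto intro!: integrable_continuous_real continuous_intros\<close>)
  also have "\<dots> = B / l * exp (l * t) - B / l" using integral_unique[OF I] by simp
  also have "\<dots> \<le> B / l * exp (l * t)" using l \<open>B \<ge> 0\<close> by simp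
  finally show ?thesis .
qed

section \<open>Transport systems: existence\<close>

text \<open>The system is \<open>(U\<^sub>j)\<^sub>t + k\<^sub>j (U\<^sub>j)\<^sub>x = \<Sum>\<^sub>l M\<^sub>j\<^sub>l U\<^sub>l + F\<^sub>j\<close> with zero initial values; the \<open>n\<close>-th term
  passes through the coupling matrix \<open>n\<close> times.\<close>

fun picard :: "('j::finite \<Rightarrow> real) \<Rightarrow> ('j \<Rightarrow> 'j \<Rightarrow> real) \<Rightarrow> ('j \<Rightarrow> real \<Rightarrow> real \<Rightarrow> real) \<Rightarrow>
    nat \<Rightarrow> 'j \<Rightarrow> real \<Rightarrow> real \<Rightarrow> real" where
  "picard k M F 0 j = char_integral (k j) (F j)"
| "picard k M F (Suc n) j = char_integral (k j) (\<lambda>x t. \<Sum>l\<in>UNIV. M j l * picard k M F n l x t)"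

definition picard_sum :: "('j::finite \<Rightarrow> real) \<Rightarrow> ('j \<Rightarrow> 'j \<Rightarrow> real) \<Rightarrow> ('j \<Rightarrow> real \<Rightarrow> real \<Rightarrow> real) \<Rightarrow>
    'j \<Rightarrow> real \<Rightarrow> real \<Rightarrow> real" where
  "picard_sum k M F j x t = (\<Sum>n. picard k M F n j x t)"

text \<open>The factor 2 is the reciprocal of the contraction constant; the summand 1 keeps the rate positive
  without coupling.\<close>

definition rate :: "('j::finite \<Rightarrow> 'j \<Rightarrow> real) \<Rightarrow> real" where
  "rate M = 2 * (\<Sum>j\<in>UNIV. \<Sum>l\<in>UNIV. \<bar>M j l\<bar>) + 1"

lemma rate_ge_1: "rate M \<ge> 1"
  unfolding rate_def by (simp add: sum_nonneg)

lemma row_sum_bound: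
  assumes "\<And>l. \<bar>y l\<bar> \<le> B"
  shows "\<bar>\<Sum>l\<in>UNIV. M j l * y l\<bar> \<le> rate M / 2 * B"
proof -
  have B: "0 \<le> B" using assms[of undefined] by linarith
  have "\<bar>\<Sum>l\<in>UNIV. M j l * y l\<bar> \<le> (\<Sum>l\<in>UNIV. \<bar>M j l\<bar> * B)"
    by (rule order_trans[OF sum_abs]) (auto intro!: sum_mono mult_left_mono assms simp: abs_mult)
  also have "\<dots> = (\<Sum>l\<in>UNIV. \<bar>M j l\<bar>) * B" by (simp add: sum_distrib_right)
  also have "\<dots> \<le> (\<Sum>j\<in>UNIV. \<Sum>l\<in>UNIV. \<bar>M j l\<bar>) * B"
    by (rule mult_right_mono[OF member_le_sum B]) (auto intro: sum_nonneg)
  also have "\<dots> \<le> rate M / 2 * B" unfolding rate_def using B by (intro mult_right_mono) auto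
  finally show ?thesis .
qed

lemma cont_row: "(\<And>l. cont I (f l)) \<Longrightarrow> cont I (\<lambda>x t. \<Sum>l\<in>UNIV. c l * f l x t)"
  unfolding case_prod_beta by (intro continuous_intros)

abbreviation conts :: "real \<Rightarrow> ('j \<Rightarrow> real \<Rightarrow> real \<Rightarrow> real) \<Rightarrow> bool" where
  "conts T F \<equiv> \<forall>j. cont {0..T} (F j)"

abbreviation bounded_by :: "real \<Rightarrow> ('j \<Rightarrow> real \<Rightarrow> real \<Rightarrow> real) \<Rightarrow> real \<Rightarrow> bool" where
  "bounded_by T F B \<equiv> \<forall>j x. \<forall>s\<in>{0..T}. \<bar>F j x s\<bar> \<le> B"

abbreviation x_derivs :: "real \<Rightarrow> ('j \<Rightarrow> real \<Rightarrow> real \<Rightarrow> real) \<Rightarrow> ('j \<Rightarrow> real \<Rightarrow> real \<Rightarrow> real) \<Rightarrow> bool" where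
  "x_derivs T F F' \<equiv> \<forall>j x. \<forall>t\<in>{0..T}. ((\<lambda>y. F j y t) has_real_derivative F' j x t) (at x)"

context
  fixes k :: "'j::finite \<Rightarrow> real" and M :: "'j \<Rightarrow> 'j \<Rightarrow> real" and T :: real
begin

lemma picard_cont: "conts T F \<Longrightarrow> cont {0..T} (picard k M F n j)"
  by (induction n arbitrary: j) (auto intro!: char_integral_cont cont_row)

lemma picard_bound:
  assumes F: "conts T F" and B: "bounded_by T F B" and "t \<in> {0..T}"
  shows "\<bar>picard k M F n j x t\<bar> \<le> B * (1/2) ^ n * exp (rate M * t)"
  using \<open>t \<in> {0..T}\<close>
proof (induction n arbitrary: j x t)
  note r = rate_ge_1[of M]
  have B0: "B \<ge> 0" using B \<open>t \<in> {0..T}\<close> abs_ge_zero order_trans by blast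
  case 0
  have "\<bar>F j x s\<bar> \<le> B * exp (rate M * s)" if s: "s \<in> {0..T}" for x s
  proof -
    have "B * 1 \<le> B * exp (rate M * s)" using s r B0 by (intro mult_left_mono) auto
    then show ?thesis using B[rule_format, OF s, of j x] by linarith
  qed
  then have "\<bar>char_integral (k j) (F j) x t\<bar> \<le> B / rate M * exp (rate M * t)"
    using char_integral_bound[OF F[rule_format] 0, of "rate M" B] r B0 by auto
  also have "\<dots> \<le> B * exp (rate M * t)"
    using B0 r by (intro mult_right_mono) (auto simp: divide_simps mult_le_cancel_left1)
  finally show ?case by simp
next
  note r = rate_ge_1[of M]
  have B0: "B \<ge> 0" using B \<open>t \<in> {0..T}\<close> abs_ge_zero order_trans by blast
  case (Suc n)
  have "\<bar>picard k M F (Suc n) j x t\<bar> \<le> (rate M / 2 * (B * (1/2) ^ n)) / rate M * exp (rate M * t)"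
    unfolding picard.simps
  proof (rule char_integral_bound[OF cont_row Suc.prems])
    fix x s assume "s \<in> {0..T}"
    from row_sum_bound[of "\<lambda>l. picard k M F n l x s", OF Suc.IH[OF this]]
    show "\<bar>\<Sum>l\<in>UNIV. M j l * picard k M F n l x s\<bar> \<le> rate M / 2 * (B * (1/2) ^ n) * exp (rate M * s)"
      by (simp add: mult.assoc)
  qed (use r B0 picard_cont[OF F] in auto)
  then show ?case using r by simp
qed

text \<open>Coefficients are constant, hence the \<open>x\<close>-derivative of a Picard term is the Picard term for the
  derivative of the source. This is what makes the solution as smooth as the source.\<close>

lemma picard_partials:
  assumes F: "conts T F" and F': "conts T F'"
    and d: "x_derivs T F F'"
  shows "partials {0..T} (picard k M F n j) (picard k M F' n j)
    (\<lambda>x t. (case n of 0 \<Rightarrow> F j x t | Suc m \<Rightarrow> \<Sum>l\<in>UNIV. M j l * picard k M F m l x t)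
       - k j * picard k M F' n j x t)"
proof (induction n arbitrary: j)
  case 0
  then show ?case using char_integral_partials[OF F[rule_format] F'[rule_format]] d by simp
next
  case (Suc n)
  have "((\<lambda>y. \<Sum>l\<in>UNIV. M j l * picard k M F n l y t) has_real_derivative
     (\<Sum>l\<in>UNIV. M j l * picard k M F' n l x t)) (at x)" if "t \<in> {0..T}" for x t
    by (intro DERIV_sum DERIV_cmult) (use Suc that in \<open>auto simp: partials_def\<close>)
  from char_integral_partials[OF cont_row cont_row this]
  show ?case using picard_cont[OF F] picard_cont[OF F'] by simp
qed

context
  fixes F :: "'j \<Rightarrow> real \<Rightarrow> real \<Rightarrow> real" and B
  assumes F: "conts T F" and B: "bounded_by T F B"
begin

lemma picard_geometric:
  assumes "t \<in> {0..T}"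
  shows "norm (picard k M F n j x t) \<le> \<bar>B\<bar> * exp (rate M * T) * (1/2) ^ n"
proof -
  have "norm (picard k M F n j x t) \<le> B * (1/2) ^ n * exp (rate M * t)"
    using picard_bound[OF F B assms] by simp
  also have "\<dots> \<le> \<bar>B\<bar> * (1/2) ^ n * exp (rate M * T)"
    using assms rate_ge_1[of M] by (intro mult_mono) auto
  finally show ?thesis by (simp add: mult_ac)
qed

lemma geometric_majorant: "summable (\<lambda>n. C * (1/2) ^ n :: real)"
  by (intro summable_mult summable_geometric) simp

lemma picard_terms_sum:
  assumes "t \<in> {0..T}"
  shows "(\<lambda>n. picard k M F n j x t) sums picard_sum k M F j x t"
  unfolding picard_sum_def
  by (rule summable_sums, rule summable_comparison_test'[OF geometric_majorant])
     (use picard_geometric[OF assms] in auto)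

lemma picard_sum_bound:
  assumes "t \<in> {0..T}"
  shows "\<bar>picard_sum k M F j x t\<bar> \<le> 2 * (\<bar>B\<bar> * exp (rate M * T))"
proof -
  have "(\<lambda>n. \<bar>B\<bar> * exp (rate M * T) * (1/2) ^ n) sums (\<bar>B\<bar> * exp (rate M * T) * (1 / (1 - 1/2)))"
    by (intro sums_mult geometric_sums) simp
  from norm_suminf_le[OF picard_geometric[OF assms] sums_summable[OF this]] sums_unique[OF this]
  show ?thesis unfolding picard_sum_def by (simp add: mult.commute)
qed

lemma picard_sum_uniform: "uniform_limit (UNIV \<times> {0..T}) (\<lambda>n (x, t). \<Sum>i<n. picard k M F i j x t)
    (\<lambda>(x, t). picard_sum k M F j x t) sequentially"
proof -
  have "uniform_limit (UNIV \<times> {0..T}) (\<lambda>n z. \<Sum>i<n. picard k M F i j (fst z) (snd z))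
    (\<lambda>z. suminf (\<lambda>i. picard k M F i j (fst z) (snd z))) sequentially"
    using picard_geometric
    by (intro Weierstrass_m_test[where M = "\<lambda>n. \<bar>B\<bar> * exp (rate M * T) * (1/2) ^ n", OF _ geometric_majorant]) auto
  then show ?thesis unfolding picard_sum_def case_prod_beta .
qed

lemma picard_sum_cont: "cont {0..T} (picard_sum k M F j)"
proof (rule uniform_limit_theorem[OF _ picard_sum_uniform])
  have "cont {0..T} (\<lambda>x t. \<Sum>i<n. picard k M F i j x t)" for n
    using picard_cont[OF F] unfolding case_prod_beta by (intro continuous_intros)
  then show "\<forall>\<^sub>F n in sequentially. cont {0..T} (\<lambda>x t. \<Sum>i<n. picard k M F i j x t)" by simp
qed simp

lemma picard_sum_initial: "picard_sum k M F j x 0 = 0"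
proof -
  have "picard k M F n j x 0 = 0" for n by (cases n) (simp_all add: char_integral_def)
  then show ?thesis by (simp add: picard_sum_def)
qed

end

text \<open>Both series of termwise derivatives converge uniformly, by the geometric bounds for the sources \<open>F\<close> and
  \<open>F'\<close>. Summing the time derivatives reproduces the differential equation, so no integral has to be
  exchanged with the sum.\<close>

lemma picard_sum_partials:
  assumes F: "conts T F" and F': "conts T F'"
    and B: "bounded_by T F B" and B': "bounded_by T F' B'"
    and d: "x_derivs T F F'"
  shows "partials {0..T} (picard_sum k M F j) (picard_sum k M F' j)
    (\<lambda>x t. F j x t + (\<Sum>l\<in>UNIV. M j l * picard_sum k M F l x t) - k j * picard_sum k M F' j x t)"
  unfolding partials_def
proof (intro allI ballI conjI)
  fix x t assume t: "t \<in> {0..T}"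
  note P = picard_partials[OF F F' d, unfolded partials_def, rule_format]
  note S = picard_terms_sum[OF F B] and S' = picard_terms_sum[OF F' B']
  have *: "uniform_limit UNIV (\<lambda>n y. \<Sum>i<n. picard k M F' i j y t) (\<lambda>y. picard_sum k M F' j y t) sequentially"
    unfolding picard_sum_def
    using picard_geometric[OF F' B' t]
    by (intro Weierstrass_m_test[where M = "\<lambda>n. \<bar>B'\<bar> * exp (rate M * T) * (1/2) ^ n", OF _ geometric_majorant]) auto
  have Px: "\<And>n y. ((\<lambda>y. picard k M F n j y t) has_real_derivative picard k M F' n j y t) (at y within UNIV)"
    using P t by simp
  have "\<exists>g. \<forall>y\<in>UNIV. (\<lambda>n. picard k M F n j y t) sums g y \<and>
      (g has_real_derivative picard_sum k M F' j y t) (at y within UNIV)"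
    by (rule has_field_derivative_series[OF convex_UNIV Px * UNIV_I sums_summable[OF S[OF t]]])
  then obtain g where g: "\<And>y. (\<lambda>n. picard k M F n j y t) sums g y"
    "\<And>y. (g has_real_derivative picard_sum k M F' j y t) (at y)"
    by auto
  then have "g y = picard_sum k M F j y t" for y using S[OF t] sums_unique2 by blast
  then have "g = (\<lambda>y. picard_sum k M F j y t)" by auto
  then show "((\<lambda>y. picard_sum k M F j y t) has_real_derivative picard_sum k M F' j x t) (at x)" using g by simp
  define D where "D n s = (case n of 0 \<Rightarrow> F j x s | Suc m \<Rightarrow> \<Sum>l\<in>UNIV. M j l * picard k M F m l x s)
       - k j * picard k M F' n j x s" for n s
  let ?G = "\<lambda>s. F j x s + (\<Sum>l\<in>UNIV. M j l * picard_sum k M F l x s) - k j * picard_sum k M F' j x s"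
  define C where "C = max (2 * B) (rate M * (\<bar>B\<bar> * exp (rate M * T))) + \<bar>k j\<bar> * (\<bar>B'\<bar> * exp (rate M * T))"
  have D: "norm (D n s) \<le> C * (1/2) ^ n" if s: "s \<in> {0..T}" for n s
  proof -
    have 1: "\<bar>case n of 0 \<Rightarrow> F j x s | Suc m \<Rightarrow> \<Sum>l\<in>UNIV. M j l * picard k M F m l x s\<bar>
      \<le> max (2 * B) (rate M * (\<bar>B\<bar> * exp (rate M * T))) * (1/2) ^ n"
    proof (cases n)
      case 0
      have "0 \<le> B" using B s abs_ge_zero order_trans by blast
      then show ?thesis using B[rule_format, OF s, of j x] 0 by simp
    next
      case (Suc m)
      have "\<bar>\<Sum>l\<in>UNIV. M j l * picard k M F m l x s\<bar> \<le> rate M / 2 * (\<bar>B\<bar> * exp (rate M * T) * (1/2) ^ m)"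
        by (rule row_sum_bound) (use picard_geometric[OF F B s] in auto)
      also have "\<dots> = rate M * (\<bar>B\<bar> * exp (rate M * T)) * (1/2) ^ n" using Suc by simp
      also have "\<dots> \<le> max (2 * B) (rate M * (\<bar>B\<bar> * exp (rate M * T))) * (1/2) ^ n"
        by (intro mult_right_mono) auto
      finally show ?thesis using Suc by simp
    qed
    have 2: "\<bar>k j * picard k M F' n j x s\<bar> \<le> \<bar>k j\<bar> * (\<bar>B'\<bar> * exp (rate M * T)) * (1/2) ^ n"
      using mult_left_mono[OF picard_geometric[OF F' B' s, of n j x], of "\<bar>k j\<bar>"]
      by (simp add: abs_mult mult.assoc)
    show ?thesis
      using order_trans[OF abs_triangle_ineq4 add_mono[OF 1 2]] unfolding C_def D_def by (simp add: distrib_right)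
  qed
  have Dsum: "(\<lambda>n. D n s) sums ?G s" if s: "s \<in> {0..T}" for s
  proof -
    have "(\<lambda>n. \<Sum>l\<in>UNIV. M j l * picard k M F n l x s) sums (\<Sum>l\<in>UNIV. M j l * picard_sum k M F l x s)"
      by (intro sums_sum sums_mult S[OF s])
    from sums_Suc[of "\<lambda>n. case n of 0 \<Rightarrow> F j x s | Suc m \<Rightarrow> \<Sum>l\<in>UNIV. M j l * picard k M F m l x s", simplified, OF this]
    have "(\<lambda>n. case n of 0 \<Rightarrow> F j x s | Suc m \<Rightarrow> \<Sum>l\<in>UNIV. M j l * picard k M F m l x s)
       sums (F j x s + (\<Sum>l\<in>UNIV. M j l * picard_sum k M F l x s))"
      by (simp add: add.commute)
    then show ?thesis unfolding D_def by (intro sums_diff sums_mult S'[OF s])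
  qed
  have "uniform_limit {0..T} (\<lambda>n s. \<Sum>i<n. D i s) (\<lambda>s. suminf (\<lambda>i. D i s)) sequentially"
    using D by (intro Weierstrass_m_test[where M = "\<lambda>n. C * (1/2) ^ n", OF _ geometric_majorant]) auto
  then have **: "uniform_limit {0..T} (\<lambda>n s. \<Sum>i<n. D i s) ?G sequentially"
    by (rule uniform_limit_cong'[THEN iffD1, rotated 2]) (use sums_unique[OF Dsum] in auto)
  have Pt: "\<And>n s. s \<in> {0..T} \<Longrightarrow> (picard k M F n j x has_real_derivative D n s) (at s within {0..T})"
    using P unfolding D_def by blast
  have "\<exists>g. \<forall>s\<in>{0..T}. (\<lambda>n. picard k M F n j x s) sums g s \<and>
      (g has_real_derivative ?G s) (at s within {0..T})"
    by (rule has_field_derivative_series[OF _ Pt ** t sums_summable[OF S[OF t]]]) auto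
  then obtain g where g: "\<And>s. s \<in> {0..T} \<Longrightarrow> (\<lambda>n. picard k M F n j x s) sums g s"
    "\<And>s. s \<in> {0..T} \<Longrightarrow> (g has_real_derivative ?G s) (at s within {0..T})"
    by blast
  have "picard_sum k M F j x s = g s" if "s \<in> {0..T}" for s using S g that sums_unique2 by blast
  then show "(picard_sum k M F j x has_real_derivative ?G t) (at t within {0..T})"
    using g(2)[OF t] t unfolding has_field_derivative_def by (metis (mono_tags, lifting) has_derivative_transform)
qed

end

section \<open>Functions bounded with all derivatives\<close>

text \<open>All derivatives of every order exist and are bounded; the coinductive form provides the derivative
  as another member of the class.\<close>

coinductive bounded_smooth :: "(real \<Rightarrow> real) \<Rightarrow> bool" where
  bounded_smooth: "(\<And>x. (p has_real_derivative p' x) (at x)) \<Longrightarrow> bounded (range p) \<Longrightarrow> bounded_smooth p' \<Longrightarrow> bounded_smooth p"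

coinductive strip_smooth :: "real \<Rightarrow> (real \<Rightarrow> real \<Rightarrow> real) \<Rightarrow> bool" for T where
  strip_smooth: "cont {0..T} f \<Longrightarrow> \<exists>B. \<forall>x. \<forall>t\<in>{0..T}. \<bar>f x t\<bar> \<le> B \<Longrightarrow> partials {0..T} f fx ft \<Longrightarrow>
    strip_smooth T fx \<Longrightarrow> strip_smooth T ft \<Longrightarrow> strip_smooth T f"

lemma bounded_smooth_lin: "bounded_smooth p \<Longrightarrow> bounded_smooth q \<Longrightarrow> bounded_smooth (\<lambda>x. c * p x + d * q x)"
proof (coinduction arbitrary: p q)
  case bounded_smooth
  obtain p' where p: "\<And>x. (p has_real_derivative p' x) (at x)" "bounded (range p)" "bounded_smooth p'"
    using bounded_smooth(1) by cases (rule that)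
  obtain q' where q: "\<And>x. (q has_real_derivative q' x) (at x)" "bounded (range q)" "bounded_smooth q'"
    using bounded_smooth(2) by cases (rule that)
  obtain B C where B: "\<And>x. \<bar>p x\<bar> \<le> B" and C: "\<And>x. \<bar>q x\<bar> \<le> C"
    using p(2) q(2) by (auto simp: bounded_iff)
  have "\<bar>c * p x + d * q x\<bar> \<le> \<bar>c\<bar> * B + \<bar>d\<bar> * C" for x
    by (rule order_trans[OF abs_triangle_ineq]) (auto simp: abs_mult intro!: add_mono mult_left_mono B C)
  then have bd: "bounded (range (\<lambda>x. c * p x + d * q x))" by (auto simp: bounded_iff)
  show ?case
  proof (intro exI conjI)
    show "(\<lambda>x. c * p x + d * q x) = (\<lambda>x. c * p x + d * q x)" ..
    show "\<forall>x. ((\<lambda>x. c * p x + d * q x) has_real_derivative c * p' x + d * q' x) (at x)"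
      using p(1) q(1) by (auto intro!: derivative_eq_intros)
    show "bounded (range (\<lambda>x. c * p x + d * q x))" by fact
    show "(\<exists>p q. (\<lambda>x. c * p' x + d * q' x) = (\<lambda>x. c * p x + d * q x) \<and> bounded_smooth p \<and> bounded_smooth q) \<or>
       bounded_smooth (\<lambda>x. c * p' x + d * q' x)" using p(3) q(3) by blast
  qed
qed

lemma bounded_smooth_zero: "bounded_smooth (\<lambda>x. 0)"
  by (coinduction) (auto intro!: exI[of _ "\<lambda>x. 0"])

lemma bounded_smooth_trace: "strip_smooth T f \<Longrightarrow> 0 \<le> T \<Longrightarrow> bounded_smooth (\<lambda>x. f x 0)"
proof (coinduction arbitrary: f)
  case bounded_smooth
  from bounded_smooth(1) obtain fx ft where f: "\<exists>B. \<forall>x. \<forall>t\<in>{0..T}. \<bar>f x t\<bar> \<le> B"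
    "partials {0..T} f fx ft" "strip_smooth T fx" by cases (rule that)
  have "bounded (range (\<lambda>x. f x 0))" using f(1) \<open>0 \<le> T\<close> by (force simp: bounded_iff)
  moreover have "\<forall>x. ((\<lambda>x. f x 0) has_real_derivative fx x 0) (at x)"
    using f(2) \<open>0 \<le> T\<close> by (auto simp: partials_def)
  ultimately show ?case using f(3) \<open>0 \<le> T\<close>
    by (intro exI[of _ "\<lambda>x. f x 0"] exI[of _ "\<lambda>x. fx x 0"]) auto
qed

text \<open>For compactly supported data the boundedness of the derivatives is automatic, since every
  derivative is supported in the same compact set.\<close>

lemma compactly_supported_bounded:
  assumes "compactly_supported f" "\<And>x. isCont f x"
  shows "bounded (range f)"
proof -
  let ?K = "closure {x. f x \<noteq> 0}"
  have "bounded (f ` ?K)"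
    using assms by (intro compact_imp_bounded compact_continuous_image)
      (auto simp: compactly_supported_def intro: continuous_at_imp_continuous_on)
  moreover have "range f \<subseteq> insert 0 (f ` ?K)" using closure_subset[of "{x. f x \<noteq> 0}"] by auto
  ultimately show ?thesis by (meson bounded_insert bounded_subset)
qed

lemma compactly_supported_deriv:
  assumes "compactly_supported f"
  shows "compactly_supported (deriv f)"
proof -
  have "{x. deriv f x \<noteq> 0} \<subseteq> closure {x. f x \<noteq> 0}"
  proof (rule ccontr)
    assume "\<not> ?thesis"
    then obtain x where x: "deriv f x \<noteq> 0" "x \<in> - closure {x. f x \<noteq> 0}" by auto
    have "(f has_real_derivative 0) (at x)"
      by (rule has_field_derivative_transform_within_open[of "\<lambda>x. 0" _ _ "- closure {x. f x \<noteq> 0}"])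
        (use x(2) closure_subset[of "{x. f x \<noteq> 0}"] in auto)
    then show False using x(1) by (simp add: DERIV_imp_deriv)
  qed
  then have "closure {x. deriv f x \<noteq> 0} \<subseteq> closure {x. f x \<noteq> 0}" by (simp add: closure_minimal)
  then have "compact (closure {x. f x \<noteq> 0} \<inter> closure {x. deriv f x \<noteq> 0})"
      "closure {x. f x \<noteq> 0} \<inter> closure {x. deriv f x \<noteq> 0} = closure {x. deriv f x \<noteq> 0}"
    using assms unfolding compactly_supported_def by (auto intro: compact_Int_closed)
  then show ?thesis unfolding compactly_supported_def by simp
qed

lemma admissible_bounded_smooth:
  assumes "admissible_datum f"
  shows "bounded_smooth f"
proof -
  have d: "\<And>n x. ((deriv ^^ n) f has_real_derivative (deriv ^^ Suc n) f x) (at x)"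
    using assms by (auto simp: admissible_datum_def infinitely_differentiable_def DERIV_deriv_iff_real_differentiable)
  have "bounded (range ((deriv ^^ n) f))" for n
  proof (cases "compactly_supported f")
    case True
    then have "compactly_supported ((deriv ^^ n) f)"
      by (induction n) (auto intro: compactly_supported_deriv)
    then show ?thesis using compactly_supported_bounded d DERIV_isCont by blast
  next
    case False
    then show ?thesis using assms by (auto simp: admissible_datum_def)
  qed
  note b = this
  have "bounded_smooth ((deriv ^^ n) f)" for n
  proof (coinduction arbitrary: n)
    case bounded_smooth
    show ?case using d b by blast
  qed
  from this[of 0] show ?thesis by simp
qed

text \<open>Coinduction up to closure: this set contains \<^const>\<open>strip_smooth\<close>, is closed under the operations
  that are needed, and differentiation does not leave it. Hence it is contained in
  \<^const>\<open>strip_smooth\<close>, which therefore inherits all of these closure properties.\<close>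

inductive smooth_span :: "real \<Rightarrow> ('j::finite \<Rightarrow> real) \<Rightarrow> ('j \<Rightarrow> 'j \<Rightarrow> real) \<Rightarrow> (real \<Rightarrow> real \<Rightarrow> real) \<Rightarrow> bool"
  for T k M where
  smooth_span_base: "strip_smooth T f \<Longrightarrow> smooth_span T k M f"
| smooth_span_const: "bounded_smooth p \<Longrightarrow> smooth_span T k M (\<lambda>x t. p x)"
| smooth_span_lin: "smooth_span T k M f \<Longrightarrow> smooth_span T k M g \<Longrightarrow> smooth_span T k M (\<lambda>x t. c * f x t + d * g x t)"
| smooth_span_picard: "\<forall>j. strip_smooth T (F j) \<Longrightarrow> smooth_span T k M (picard_sum k M F j)"

lemma smooth_span_sum:
  assumes "finite A" "\<And>l. l \<in> A \<Longrightarrow> smooth_span T k M (f l)"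
  shows "smooth_span T k M (\<lambda>x t. \<Sum>l\<in>A. c l * f l x t)"
  using assms
proof (induction A rule: finite_induct)
  case empty
  then show ?case using smooth_span_const[OF bounded_smooth_zero] by simp
next
  case (insert l A)
  have "smooth_span T k M (\<lambda>x t. c l * f l x t + 1 * (\<Sum>l\<in>A. c l * f l x t))"
    by (rule smooth_span_lin) (use insert in auto)
  then show ?case using insert by simp
qed

lemma strip_smooth_family:
  assumes "\<forall>j::'j::finite. strip_smooth T (F j)"
  obtains F' F'' B B' where "conts T F" "conts T F'" "bounded_by T F B" "bounded_by T F' B'"
    "\<forall>j. partials {0..T} (F j) (F' j) (F'' j)" "\<forall>j. strip_smooth T (F' j)" "\<forall>j. strip_smooth T (F'' j)"
proof -
  have bnd: "\<exists>B. bounded_by T G B" if G: "\<forall>j. strip_smooth T (G j)" for G :: "'j \<Rightarrow> _"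
  proof -
    have "\<forall>j. \<exists>B. \<forall>x. \<forall>t\<in>{0..T}. \<bar>G j x t\<bar> \<le> B"
    proof
      fix j from G have "strip_smooth T (G j)" by blast
      then show "\<exists>B. \<forall>x. \<forall>t\<in>{0..T}. \<bar>G j x t\<bar> \<le> B" by cases
    qed
    then obtain C where C: "\<And>j x t. t \<in> {0..T} \<Longrightarrow> \<bar>G j x t\<bar> \<le> C j" by metis
    have "\<bar>G j x t\<bar> \<le> (\<Sum>j\<in>UNIV. \<bar>C j\<bar>)" if "t \<in> {0..T}" for j x t
      using C[OF that, of j x] member_le_sum[of j UNIV "\<lambda>j. \<bar>C j\<bar>"] by auto
    then show ?thesis by blast
  qed
  have "\<forall>j. \<exists>fx ft. cont {0..T} (F j) \<and> partials {0..T} (F j) fx ft \<and> strip_smooth T fx \<and> strip_smooth T ft"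
  proof
    fix j from assms have "strip_smooth T (F j)" by blast
    then show "\<exists>fx ft. cont {0..T} (F j) \<and> partials {0..T} (F j) fx ft \<and> strip_smooth T fx \<and> strip_smooth T ft"
      by cases blast
  qed
  then obtain F' F'' where F: "\<forall>j. cont {0..T} (F j)"
     "\<forall>j. partials {0..T} (F j) (F' j) (F'' j)" "\<forall>j. strip_smooth T (F' j)" "\<forall>j. strip_smooth T (F'' j)"
    by metis
  moreover have "conts T F'" using F(3) by (auto elim: strip_smooth.cases)
  ultimately show ?thesis using that bnd[OF assms] bnd[OF F(3)] by blast
qed

text \<open>The time derivative of a Picard sum is, by the differential equation, a linear combination of the
  source and of Picard sums.\<close>

lemma smooth_span_step:
  assumes "smooth_span T k M f"
  shows "cont {0..T} f \<and> (\<exists>B. \<forall>x. \<forall>t\<in>{0..T}. \<bar>f x t\<bar> \<le> B) \<and>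
    (\<exists>fx ft. partials {0..T} f fx ft \<and> smooth_span T k M fx \<and> smooth_span T k M ft)"
  using assms
proof induction
  case (smooth_span_base f)
  then show ?case by cases (blast intro: smooth_span.smooth_span_base)
next
  case (smooth_span_const p)
  then obtain p' where p: "\<And>x. (p has_real_derivative p' x) (at x)" "bounded (range p)" "bounded_smooth p'"
    by cases (rule that)
  have "continuous_on UNIV p" using p(1) by (meson DERIV_isCont continuous_at_imp_continuous_on)
  then have "cont {0..T} (\<lambda>x t. p x)"
    unfolding case_prod_beta by (rule continuous_on_compose2) (auto intro: continuous_intros)
  moreover have "partials {0..T} (\<lambda>x t. p x) (\<lambda>x t. p' x) (\<lambda>x t. 0)"
    using p(1) by (auto simp: partials_def)
  moreover have "\<exists>B. \<forall>x. \<forall>t\<in>{0..T}. \<bar>p x\<bar> \<le> B" using p(2) by (auto simp: bounded_iff)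
  ultimately show ?case using smooth_span.smooth_span_const[OF p(3)] smooth_span.smooth_span_const[OF bounded_smooth_zero] by blast
next
  case (smooth_span_lin f g c d)
  obtain B C where B: "\<And>x t. t \<in> {0..T} \<Longrightarrow> \<bar>f x t\<bar> \<le> B" and C: "\<And>x t. t \<in> {0..T} \<Longrightarrow> \<bar>g x t\<bar> \<le> C"
    using smooth_span_lin.IH by blast
  have "\<bar>c * f x t + d * g x t\<bar> \<le> \<bar>c\<bar> * B + \<bar>d\<bar> * C" if "t \<in> {0..T}" for x t
    using B[OF that] C[OF that]
    by (intro order_trans[OF abs_triangle_ineq]) (auto simp: abs_mult intro!: add_mono mult_left_mono)
  moreover obtain fx ft gx gt where p: "partials {0..T} f fx ft" "partials {0..T} g gx gt"
    and g: "smooth_span T k M fx" "smooth_span T k M ft" "smooth_span T k M gx" "smooth_span T k M gt" using smooth_span_lin.IH by blast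
  ultimately show ?case
    using cont_lin[of "{0..T}" f g c d] smooth_span_lin.IH partials_lin[OF p, of c d]
      smooth_span.smooth_span_lin[OF g(1,3), of c d] smooth_span.smooth_span_lin[OF g(2,4), of c d] by blast
next
  case (smooth_span_picard F j)
  obtain F' F'' B B' where F: "conts T F" "conts T F'" "bounded_by T F B" "bounded_by T F' B'"
    "\<forall>j. partials {0..T} (F j) (F' j) (F'' j)" "\<forall>j. strip_smooth T (F' j)"
    using strip_smooth_family[OF smooth_span_picard] by metis
  have "x_derivs T F F'" using F(5) by (auto simp: partials_def)
  note P = picard_sum_partials[OF F(1-4) this, of k M j]
  have "smooth_span T k M (\<lambda>x t. 1 * F j x t + 1 * (1 * (\<Sum>l\<in>UNIV. M j l * picard_sum k M F l x t) + (- k j) * picard_sum k M F' j x t))"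
    using smooth_span_picard F(6) by (intro smooth_span.smooth_span_lin smooth_span_sum smooth_span.smooth_span_base smooth_span.smooth_span_picard) auto
  then have "smooth_span T k M (\<lambda>x t. F j x t + (\<Sum>l\<in>UNIV. M j l * picard_sum k M F l x t) - k j * picard_sum k M F' j x t)"
    by (simp add: algebra_simps)
  then show ?case
    using P picard_sum_cont[OF F(1,3)] picard_sum_bound[OF F(1,3)] smooth_span.smooth_span_picard[OF F(6)] by blast
qed

lemma smooth_span_strip_smooth: "smooth_span T k M f \<Longrightarrow> strip_smooth T f"
proof (coinduction arbitrary: f)
  case strip_smooth
  then show ?case using smooth_span_step by blast
qed

lemma strip_smooth_lin: "strip_smooth T f \<Longrightarrow> strip_smooth T g \<Longrightarrow> strip_smooth T (\<lambda>x t. c * f x t + d * g x t)"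
  by (rule smooth_span_strip_smooth[of T "\<lambda>_::bool. 0" "\<lambda>_ _. 0"], rule smooth_span_lin) (auto intro: smooth_span_base)

lemma strip_smooth_const: "bounded_smooth p \<Longrightarrow> strip_smooth T (\<lambda>x t. p x)"
  by (rule smooth_span_strip_smooth[of T "\<lambda>_::bool. 0" "\<lambda>_ _. 0"], rule smooth_span_const)

lemma strip_smooth_sum:
  "finite A \<Longrightarrow> (\<And>l. l \<in> A \<Longrightarrow> strip_smooth T (f l)) \<Longrightarrow> strip_smooth T (\<lambda>x t. \<Sum>l\<in>A. c l * f l x t)"
  by (rule smooth_span_strip_smooth[of T "\<lambda>_::bool. 0" "\<lambda>_ _. 0"], rule smooth_span_sum) (auto intro: smooth_span_base)

lemma strip_smooth_cong:
  assumes "strip_smooth T f" and e: "\<And>x t. t \<in> {0..T} \<Longrightarrow> g x t = f x t"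
  shows "strip_smooth T g"
proof -
  obtain fx ft where f: "cont {0..T} f" "\<exists>B. \<forall>x. \<forall>t\<in>{0..T}. \<bar>f x t\<bar> \<le> B" "partials {0..T} f fx ft"
    "strip_smooth T fx" "strip_smooth T ft"
    using assms(1) by cases (rule that)
  show ?thesis
  proof (rule strip_smooth)
    show "cont {0..T} g" using f(1) by (rule continuous_on_eq) (use e in auto)
    show "\<exists>B. \<forall>x. \<forall>t\<in>{0..T}. \<bar>g x t\<bar> \<le> B" using f(2) e by simp
    show "partials {0..T} g fx ft" using f(3) by (rule partials_cong) (use e in auto)
  qed fact+
qed

lemma strip_smoothD:
  assumes "strip_smooth T f" "0 < T"
  shows "partials {0..T} f (dx f) (dt {0..T} f)" "strip_smooth T (dx f)" "strip_smooth T (dt {0..T} f)"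
    "C1 {0..T} f"
proof -
  obtain fx ft where f: "cont {0..T} f" "partials {0..T} f fx ft" "strip_smooth T fx" "strip_smooth T ft"
    using assms(1) by cases (rule that)
  note p = perfect_Icc[OF \<open>0 < T\<close>]
  note e = partials_dx[OF f(2)] partials_dt[OF p f(2)]
  show "partials {0..T} f (dx f) (dt {0..T} f)"
    using f(2) by (rule partials_cong) (use e in auto)
  show "strip_smooth T (dx f)" using f(3) by (rule strip_smooth_cong) (use e in auto)
  show "strip_smooth T (dt {0..T} f)" using f(4) by (rule strip_smooth_cong) (use e in auto)
  show "C1 {0..T} f" using f by (intro C1I[OF p f(2)]) (auto elim: strip_smooth.cases)
qed

text \<open>Subtracting the initial values, extended constantly in time, reduces the problem to zero initial
  values.\<close>

theorem hyperbolic_existence: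
  fixes k :: "'j::finite \<Rightarrow> real"
  assumes F: "\<forall>j. strip_smooth T (F j)" and p: "\<forall>j. bounded_smooth (p j)" and "0 < T"
  obtains U where "\<And>j. strip_smooth T (U j)" "\<And>j x. U j x 0 = p j x"
    "\<And>j x t. t \<in> {0..T} \<Longrightarrow>
       dt {0..T} (U j) x t + k j * dx (U j) x t = (\<Sum>l\<in>UNIV. M j l * U l x t) + F j x t"
proof -
  have "\<forall>j. \<exists>p'. (\<forall>x. (p j has_real_derivative p' x) (at x)) \<and> bounded_smooth p'"
  proof
    fix j from p have "bounded_smooth (p j)" by blast
    then show "\<exists>p'. (\<forall>x. (p j has_real_derivative p' x) (at x)) \<and> bounded_smooth p'" by cases blast
  qed
  then obtain p' where p': "\<And>j x. (p j has_real_derivative p' j x) (at x)" "\<And>j. bounded_smooth (p' j)"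
    by metis
  define G where "G j x t = 1 * F j x t + 1 * (1 * (\<Sum>l\<in>UNIV. M j l * p l x) + (- k j) * p' j x)" for j x t
  have G: "\<forall>j. strip_smooth T (G j)"
  proof
    fix j
    have "strip_smooth T (\<lambda>x t. \<Sum>l\<in>UNIV. M j l * p l x)"
      by (rule strip_smooth_sum) (use p in \<open>auto intro: strip_smooth_const\<close>)
    then show "strip_smooth T (G j)"
      unfolding G_def using F p'(2) by (intro strip_smooth_lin strip_smooth_const[of "p' j"]) auto
  qed
  obtain G' G'' B B' where G': "conts T G" "conts T G'" "bounded_by T G B" "bounded_by T G' B'"
    "\<forall>j. partials {0..T} (G j) (G' j) (G'' j)"
    using strip_smooth_family[OF G] by metis
  have "x_derivs T G G'" using G'(5) by (auto simp: partials_def)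
  note P = picard_sum_partials[OF G'(1-4) this, of k M]
  define U where "U j x t = 1 * p j x + 1 * picard_sum k M G j x t" for j x t
  have "partials {0..T} (\<lambda>x t. p j x) (\<lambda>x t. p' j x) (\<lambda>x t. 0)" for j
    using p'(1) by (auto simp: partials_def)
  note U' = partials_lin[OF this P, of 1 _ 1]
  show ?thesis
  proof
    show "strip_smooth T (U j)" for j
      unfolding U_def by (rule strip_smooth_lin[OF strip_smooth_const smooth_span_strip_smooth[OF smooth_span_picard[OF G]]]) (use p in auto)
    show "U j x 0 = p j x" for j x by (simp add: U_def picard_sum_initial[OF G'(1,3)])
    fix j x t assume t: "t \<in> {0..T}"
    have "partials {0..T} (U j) (\<lambda>x t. p' j x + picard_sum k M G' j x t)
       (\<lambda>x t. G j x t + (\<Sum>l\<in>UNIV. M j l * picard_sum k M G l x t) - k j * picard_sum k M G' j x t)"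
      using U'[of j] unfolding U_def by simp
    from partials_dx[OF this t, of x] partials_dt[OF perfect_Icc[OF \<open>0 < T\<close>] this t, of x]
    have "dt {0..T} (U j) x t + k j * dx (U j) x t
       = F j x t + ((\<Sum>l\<in>UNIV. M j l * p l x) + (\<Sum>l\<in>UNIV. M j l * picard_sum k M G l x t))"
      by (simp add: G_def algebra_simps)
    also have "(\<Sum>l\<in>UNIV. M j l * p l x) + (\<Sum>l\<in>UNIV. M j l * picard_sum k M G l x t) = (\<Sum>l\<in>UNIV. M j l * U l x t)"
      by (simp add: U_def sum.distrib distrib_left)
    finally show "dt {0..T} (U j) x t + k j * dx (U j) x t = (\<Sum>l\<in>UNIV. M j l * U l x t) + F j x t" by simp
  qed
qed

section \<open>Transport systems: uniqueness\<close>

text \<open>No growth condition in \<open>x\<close> is imposed, so the maximum is taken over the backward cone of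
  dependence of the point \<open>(x0, t0)\<close>, which is compact and contains the backward characteristics of all
  components from each of its points. There the maximum of \<open>exp (- \<lambda> t) \<bar>f\<^sub>j\<bar>\<close>, with \<open>\<lambda>\<close> as large as in
  the existence proof, is at most half of itself.\<close>

theorem hyperbolic_uniqueness:
  fixes k :: "'j::finite \<Rightarrow> real"
  assumes C1: "\<And>j. C1 {0..T} (f j)"
    and eq: "\<And>j x t. t \<in> {0..T} \<Longrightarrow>
       dt {0..T} (f j) x t + k j * dx (f j) x t = (\<Sum>l\<in>UNIV. M j l * f l x t)"
    and init: "\<And>j x. f j x 0 = 0"
    and t0: "t0 \<in> {0..T}"
  shows "f j x0 t0 = 0"
proof -
  define K where "K = (\<Sum>j\<in>UNIV. \<bar>k j\<bar>)"
  have K: "\<bar>k j\<bar> \<le> K" for j unfolding K_def by (rule member_le_sum) auto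
  define cone where "cone = ({x0 - K * t0..x0 + K * t0} \<times> {0..t0}) \<inter> {z. \<bar>fst z - x0\<bar> \<le> K * (t0 - snd z)}"
  have K0: "K \<ge> 0" unfolding K_def by (simp add: sum_nonneg)
  have cone_iff: "(y, s) \<in> cone \<longleftrightarrow> 0 \<le> s \<and> s \<le> t0 \<and> \<bar>y - x0\<bar> \<le> K * (t0 - s)" for y s
  proof -
    have "K * (t0 - s) \<le> K * t0" if "0 \<le> s" using that K0 by (intro mult_left_mono) auto
    then show ?thesis unfolding cone_def by auto
  qed
  have compact: "compact cone"
    unfolding cone_def
    by (intro compact_Int_closed compact_Times compact_Icc closed_Collect_le continuous_intros)
  have apex: "(x0, t0) \<in> cone" using t0 by (simp add: cone_iff)
  define h where "h j z = \<bar>f j (fst z) (snd z)\<bar> * exp (- rate M * snd z)" for j z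
  have "continuous_on cone (h j)" for j
    unfolding h_def using t0
    by (intro continuous_intros cont_comp[OF C1D(2)[OF C1]]) (auto simp: cone_iff)
  then have "\<exists>z\<in>cone. \<forall>w\<in>cone. h j w \<le> h j z" for j
    by (intro continuous_attains_sup[OF compact]) (use apex in auto)
  then obtain z where z: "\<And>j. z j \<in> cone" "\<And>j w. w \<in> cone \<Longrightarrow> h j w \<le> h j (z j)" by metis
  define m where "m = Max (range (\<lambda>j. h j (z j)))"
  have m: "h j (z j) \<le> m" for j unfolding m_def by (rule Max_ge) auto
  have "m \<in> range (\<lambda>j. h j (z j))" unfolding m_def by (rule Max_in) auto
  then obtain i where i: "m = h i (z i)" by blast
  have bound: "\<bar>f l y s\<bar> \<le> m * exp (rate M * s)" if "(y, s) \<in> cone" for l y s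
  proof -
    have "\<bar>f l y s\<bar> * exp (- rate M * s) \<le> m"
      using order_trans[OF z(2)[OF that, of l] m[of l]] by (simp add: h_def)
    then show ?thesis by (simp add: exp_minus divide_simps)
  qed
  have half: "\<bar>f l y s\<bar> \<le> m / 2 * exp (rate M * s)" if ys: "(y, s) \<in> cone" for l y s
  proof (cases "s = 0")
    case True
    have "0 \<le> m" unfolding i h_def by simp
    then show ?thesis using init True by simp
  next
    case False
    then have s: "0 < s" "s \<le> t0" using ys by (auto simp: cone_iff)
    define g where "g \<sigma> = f l ((y - k l * s) + k l * \<sigma>) \<sigma>" for \<sigma>
    have "norm (g s - g 0) \<le> m / 2 * exp (rate M * s) - m / 2 * exp (rate M * 0)"
    proof (rule differentiable_bound_general[OF s(1)])
      show "continuous_on {0..s} g"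
        unfolding g_def using s t0 by (intro cont_comp[OF C1D(2)[OF C1]] continuous_intros) auto
      show "continuous_on {0..s} (\<lambda>\<sigma>. m / 2 * exp (rate M * \<sigma>))" by (intro continuous_intros)
    next
      fix \<sigma> assume \<sigma>: "0 < \<sigma>" "\<sigma> < s"
      let ?y = "y - k l * s + k l * \<sigma>"
      show "((\<lambda>\<sigma>. m / 2 * exp (rate M * \<sigma>)) has_vector_derivative m / 2 * (rate M * exp (rate M * \<sigma>))) (at \<sigma>)"
        by (auto intro!: derivative_eq_intros simp: has_real_derivative_iff_has_vector_derivative[symmetric])
      have \<sigma>T: "\<sigma> \<in> {0..T}" using s t0 \<sigma> by auto
      have "(g has_real_derivative dx (f l) ?y \<sigma> * k l + dt {0..T} (f l) ?y \<sigma>) (at \<sigma> within {0..T})"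
        unfolding g_def
        by (rule derivative_along_line)
           (use C1D[OF C1] \<sigma>T in \<open>auto simp: partials_def\<close>)
      moreover have "at \<sigma> within {0..T} = at \<sigma>" by (rule at_within_Icc_at) (use s t0 \<sigma> in auto)
      ultimately show "(g has_vector_derivative (\<Sum>i\<in>UNIV. M l i * f i ?y \<sigma>)) (at \<sigma>)"
        using eq[OF \<sigma>T, of l ?y] by (simp add: has_real_derivative_iff_has_vector_derivative algebra_simps)
      have "\<bar>?y - x0\<bar> \<le> \<bar>y - x0\<bar> + \<bar>k l\<bar> * (s - \<sigma>)"
      proof -
        have e: "?y - x0 = (y - x0) - k l * (s - \<sigma>)" by (simp add: algebra_simps)
        have "\<bar>k l * (s - \<sigma>)\<bar> = \<bar>k l\<bar> * (s - \<sigma>)" using \<sigma> by (simp add: abs_mult)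
        then show ?thesis unfolding e using abs_triangle_ineq4[of "y - x0" "k l * (s - \<sigma>)"] by linarith
      qed
      also have "\<dots> \<le> K * (t0 - s) + K * (s - \<sigma>)"
        using ys K[of l] \<sigma> by (intro add_mono mult_right_mono) (auto simp: cone_iff)
      finally have "(?y, \<sigma>) \<in> cone" using \<sigma> s by (simp add: cone_iff algebra_simps)
      from row_sum_bound[of "\<lambda>i. f i ?y \<sigma>", OF bound[OF this]]
      show "norm (\<Sum>i\<in>UNIV. M l i * f i ?y \<sigma>) \<le> m / 2 * (rate M * exp (rate M * \<sigma>))"
        by (simp add: mult_ac)
    qed
    moreover have "0 \<le> m" unfolding i h_def by simp
    ultimately show ?thesis using init by (simp add: g_def)
  qed
  have "m \<le> m / 2"
    using half[of "fst (z i)" "snd (z i)" i] z(1)[of i]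
    by (subst i) (simp add: h_def exp_minus divide_simps)
  then have "m \<le> 0" by simp
  then have "m * exp (rate M * t0) \<le> 0" by (simp add: mult_nonpos_nonneg)
  then show ?thesis using bound[OF apex, of j] by simp
qed

section \<open>Boundary layer functions\<close>

text \<open>The factor \<open>\<tau> ^ n\<close> is unavoidable: relaxation at rate \<open>\<mu>\<close> is driven by a force that
  itself decays at rate \<open>\<mu>\<close>, and this resonance raises the degree by one.\<close>

inductive layer :: "real \<Rightarrow> (real \<Rightarrow> real \<Rightarrow> real) \<Rightarrow> bool" for \<mu> where
  layer_monomial: "bounded_smooth p \<Longrightarrow> layer \<mu> (\<lambda>x \<tau>. p x * (\<tau> ^ n * exp (- \<mu> * \<tau>)))"
| layer_lin: "layer \<mu> f \<Longrightarrow> layer \<mu> g \<Longrightarrow> layer \<mu> (\<lambda>x \<tau>. c * f x \<tau> + d * g x \<tau>)"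

lemma layer_zero: "layer \<mu> (\<lambda>x \<tau>. 0)"
  using layer_monomial[OF bounded_smooth_zero] by simp

lemma layer_scale: "layer \<mu> f \<Longrightarrow> layer \<mu> (\<lambda>x \<tau>. c * f x \<tau>)"
  using layer_lin[of \<mu> f f c 0] by simp

lemma power_exp_deriv:
  "((\<lambda>\<tau>. \<tau> ^ n * exp (- \<mu> * \<tau>)) has_real_derivative
     real n * (\<tau> ^ (n - 1) * exp (- \<mu> * \<tau>)) - \<mu> * (\<tau> ^ n * exp (- \<mu> * \<tau>))) (at \<tau> within I)"
proof (rule DERIV_cong[OF DERIV_mult])
  show "((\<lambda>\<tau>. \<tau> ^ n) has_real_derivative real n * \<tau> ^ (n - 1)) (at \<tau> within I)"
    using DERIV_pow[of n] by simp
  have "((\<lambda>\<tau>. - \<mu> * \<tau>) has_real_derivative - \<mu>) (at \<tau> within I)"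
    by (auto intro!: derivative_eq_intros)
  from DERIV_chain'[OF this DERIV_exp[THEN DERIV_subset]]
  show "((\<lambda>\<tau>. exp (- \<mu> * \<tau>)) has_real_derivative exp (- \<mu> * \<tau>) * - \<mu>) (at \<tau> within I)" by simp
qed (simp add: algebra_simps)

lemma bounded_smooth_cont: "bounded_smooth p \<Longrightarrow> continuous_on UNIV p"
  by (erule bounded_smooth.cases) (blast intro: DERIV_isCont continuous_at_imp_continuous_on)

lemma layer_cont: "layer \<mu> f \<Longrightarrow> cont I f"
proof (induction rule: layer.induct)
  case (layer_monomial p n)
  then show ?case unfolding case_prod_beta
    by (intro continuous_intros continuous_on_compose2[OF bounded_smooth_cont[OF layer_monomial]]) auto
qed (rule cont_lin)

lemma layer_partials: "layer \<mu> f \<Longrightarrow> \<exists>fx ft. partials I f fx ft \<and> layer \<mu> fx \<and> layer \<mu> ft"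
proof (induction rule: layer.induct)
  case (layer_monomial p n)
  then obtain p' where p: "\<And>x. (p has_real_derivative p' x) (at x)" "bounded_smooth p'"
    by cases (rule that)
  have "layer \<mu> (\<lambda>x \<tau>. real n * (p x * (\<tau> ^ (n - 1) * exp (- \<mu> * \<tau>))) + (- \<mu>) * (p x * (\<tau> ^ n * exp (- \<mu> * \<tau>))))"
    by (intro layer.intros layer_monomial)
  moreover have "partials I (\<lambda>x \<tau>. p x * (\<tau> ^ n * exp (- \<mu> * \<tau>))) (\<lambda>x \<tau>. p' x * (\<tau> ^ n * exp (- \<mu> * \<tau>)))
     (\<lambda>x \<tau>. real n * (p x * (\<tau> ^ (n - 1) * exp (- \<mu> * \<tau>))) + (- \<mu>) * (p x * (\<tau> ^ n * exp (- \<mu> * \<tau>))))"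
    unfolding partials_def
  proof (intro allI ballI conjI)
    fix x \<tau>
    show "((\<lambda>x. p x * (\<tau> ^ n * exp (- \<mu> * \<tau>))) has_real_derivative p' x * (\<tau> ^ n * exp (- \<mu> * \<tau>))) (at x)"
      by (intro DERIV_cmult_right p)
    from DERIV_cmult[OF power_exp_deriv, of "p x" n \<mu> \<tau> I]
    show "((\<lambda>\<tau>. p x * (\<tau> ^ n * exp (- \<mu> * \<tau>))) has_real_derivative
        real n * (p x * (\<tau> ^ (n - 1) * exp (- \<mu> * \<tau>))) + (- \<mu>) * (p x * (\<tau> ^ n * exp (- \<mu> * \<tau>)))) (at \<tau> within I)"
      by (simp add: algebra_simps)
  qed
  ultimately show ?case using layer.layer_monomial[OF p(2)] by blast
next
  case (layer_lin f g c d)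
  then show ?case using partials_lin layer.layer_lin by meson
qed

lemma layerD:
  assumes "layer \<mu> f"
  shows "partials {0..} f (dx f) (dt {0..} f)" "C1 {0..} f"
    "\<exists>g. layer \<mu> g \<and> (\<forall>x. \<forall>\<tau>\<in>{0..}. dx f x \<tau> = g x \<tau>)"
proof -
  obtain fx ft where f: "partials {0..} f fx ft" "layer \<mu> fx" "layer \<mu> ft"
    using layer_partials[OF assms] by blast
  show C: "C1 {0..} f"
    by (rule C1I[OF perfect_Ici f(1)]) (use layer_cont assms f in auto)
  show "partials {0..} f (dx f) (dt {0..} f)" by (rule C1D(1)[OF C])
  show "\<exists>g. layer \<mu> g \<and> (\<forall>x. \<forall>\<tau>\<in>{0..}. dx f x \<tau> = g x \<tau>)"
    using f(2) partials_dx[OF f(1)] by blast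
qed

lemma dt_eqI:
  assumes "(f x has_real_derivative g) (at \<tau>)" "\<tau> \<in> {0..}"
  shows "dt {0..} f x \<tau> = g"
  unfolding dt_def
  by (rule vector_derivative_within[OF perfect_Ici[rule_format, OF assms(2)]
        has_vector_derivative_at_within[OF assms(1)[unfolded has_real_derivative_iff_has_vector_derivative]]])

text \<open>Integration by parts lowers the power of \<open>\<tau>\<close>; the antiderivative obtained is the one that
  vanishes at infinity.\<close>

lemma layer_antiderivative:
  assumes "\<mu> > 0"
  shows "layer \<mu> f \<Longrightarrow> \<exists>g. layer \<mu> g \<and> (\<forall>x \<tau>. (g x has_real_derivative f x \<tau>) (at \<tau>))"
proof (induction rule: layer.induct)
  case (layer_monomial p n)
  show ?case
  proof (induction n)
    case 0
    have "layer \<mu> (\<lambda>x \<tau>. (- 1 / \<mu>) * (p x * (\<tau> ^ 0 * exp (- \<mu> * \<tau>))))"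
      by (intro layer_scale layer.layer_monomial layer_monomial)
    moreover have "((\<lambda>\<tau>. (- 1 / \<mu>) * (p x * (\<tau> ^ 0 * exp (- \<mu> * \<tau>)))) has_real_derivative
        p x * (\<tau> ^ 0 * exp (- \<mu> * \<tau>))) (at \<tau>)" for x \<tau>
      using assms by (auto intro!: derivative_eq_intros)
    ultimately show ?case by blast
  next
    case (Suc n)
    then obtain g where g: "layer \<mu> g" "\<And>x \<tau>. (g x has_real_derivative p x * (\<tau> ^ n * exp (- \<mu> * \<tau>))) (at \<tau>)"
      by blast
    have "layer \<mu> (\<lambda>x \<tau>. (- 1 / \<mu>) * (p x * (\<tau> ^ Suc n * exp (- \<mu> * \<tau>))) + (real (Suc n) / \<mu>) * g x \<tau>)"
      by (intro layer_lin layer.layer_monomial layer_monomial g)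
    moreover have "((\<lambda>\<tau>. (- 1 / \<mu>) * (p x * (\<tau> ^ Suc n * exp (- \<mu> * \<tau>))) + (real (Suc n) / \<mu>) * g x \<tau>) has_real_derivative
        p x * (\<tau> ^ Suc n * exp (- \<mu> * \<tau>))) (at \<tau>)" for x \<tau>
      by (rule DERIV_cong[OF DERIV_add[OF DERIV_cmult[OF DERIV_cmult[OF power_exp_deriv]] DERIV_cmult[OF g(2)]]])
         (use assms in \<open>simp add: field_simps\<close>)
    ultimately show ?case by blast
  qed
next
  case (layer_lin f g c d)
  then obtain f' g' where "layer \<mu> f'" "layer \<mu> g'" "\<And>x \<tau>. (f' x has_real_derivative f x \<tau>) (at \<tau>)"
    "\<And>x \<tau>. (g' x has_real_derivative g x \<tau>) (at \<tau>)" by blast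
  then show ?case
    by (intro exI[of _ "\<lambda>x \<tau>. c * f' x \<tau> + d * g' x \<tau>"]) (auto intro!: layer.layer_lin derivative_eq_intros)
qed

lemma layer_relaxation:
  assumes "layer \<mu> f" "bounded_smooth p"
  shows "\<exists>g. layer \<mu> g \<and> (\<forall>x. g x 0 = p x) \<and>
     (\<forall>x \<tau>. (g x has_real_derivative - \<mu> * g x \<tau> + f x \<tau>) (at \<tau>))"
proof -
  have "\<exists>g. layer \<mu> g \<and> (\<forall>x. g x 0 = 0) \<and> (\<forall>x \<tau>. (g x has_real_derivative - \<mu> * g x \<tau> + f x \<tau>) (at \<tau>))"
    using assms(1)
  proof (induction rule: layer.induct)
    case (layer_monomial p n)
    have "layer \<mu> (\<lambda>x \<tau>. (1 / real (Suc n)) * (p x * (\<tau> ^ Suc n * exp (- \<mu> * \<tau>))))"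
      by (intro layer_scale layer.layer_monomial layer_monomial)
    moreover have "((\<lambda>\<tau>. (1 / real (Suc n)) * (p x * (\<tau> ^ Suc n * exp (- \<mu> * \<tau>)))) has_real_derivative
       - \<mu> * ((1 / real (Suc n)) * (p x * (\<tau> ^ Suc n * exp (- \<mu> * \<tau>)))) + p x * (\<tau> ^ n * exp (- \<mu> * \<tau>))) (at \<tau>)" for x \<tau>
      by (rule DERIV_cong[OF DERIV_cmult[OF DERIV_cmult[OF power_exp_deriv]]])
         (simp add: field_simps del: of_nat_Suc)
    ultimately show ?case
      by (intro exI[of _ "\<lambda>x \<tau>. (1 / real (Suc n)) * (p x * (\<tau> ^ Suc n * exp (- \<mu> * \<tau>)))"]) auto
  next
    case (layer_lin f g c d)
    then obtain f' g' where *: "layer \<mu> f'" "layer \<mu> g'" "\<forall>x. f' x 0 = 0" "\<forall>x. g' x 0 = 0"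
      "\<And>x \<tau>. (f' x has_real_derivative - \<mu> * f' x \<tau> + f x \<tau>) (at \<tau>)"
      "\<And>x \<tau>. (g' x has_real_derivative - \<mu> * g' x \<tau> + g x \<tau>) (at \<tau>)" by blast
    have "((\<lambda>\<tau>. c * f' x \<tau> + d * g' x \<tau>) has_real_derivative
       - \<mu> * (c * f' x \<tau> + d * g' x \<tau>) + (c * f x \<tau> + d * g x \<tau>)) (at \<tau>)" for x \<tau>
      by (rule DERIV_cong[OF DERIV_add[OF DERIV_cmult[OF *(5)] DERIV_cmult[OF *(6)]]]) (simp add: algebra_simps)
    then show ?case using *(1-4) layer.layer_lin[OF *(1,2), of c d]
      by (intro exI[of _ "\<lambda>x \<tau>. c * f' x \<tau> + d * g' x \<tau>"]) auto
  qed
  then obtain g where g: "layer \<mu> g" "\<And>x. g x 0 = 0"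
    "\<And>x \<tau>. (g x has_real_derivative - \<mu> * g x \<tau> + f x \<tau>) (at \<tau>)" by blast
  have "layer \<mu> (\<lambda>x \<tau>. 1 * g x \<tau> + 1 * (p x * (\<tau> ^ 0 * exp (- \<mu> * \<tau>))))"
    by (intro layer.intros g assms)
  moreover have "((\<lambda>\<tau>. 1 * g x \<tau> + 1 * (p x * (\<tau> ^ 0 * exp (- \<mu> * \<tau>)))) has_real_derivative
     - \<mu> * (1 * g x \<tau> + 1 * (p x * (\<tau> ^ 0 * exp (- \<mu> * \<tau>)))) + f x \<tau>) (at \<tau>)" for x \<tau>
    by (rule DERIV_cong[OF DERIV_add[OF DERIV_cmult[OF g(3)] DERIV_cmult[OF DERIV_cmult[OF power_exp_deriv]]]])
       (simp add: algebra_simps)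
  ultimately show ?thesis
    by (intro exI[of _ "\<lambda>x \<tau>. 1 * g x \<tau> + 1 * (p x * (\<tau> ^ 0 * exp (- \<mu> * \<tau>)))"]) (auto simp: g(2))
qed

text \<open>From \<open>y \<le> exp y\<close> for \<open>y = \<mu> \<tau> / (2 n)\<close>, raised to the power \<open>n\<close>.\<close>

lemma power_exp_bound:
  assumes "\<mu> > 0" "\<tau> \<ge> 0"
  shows "\<tau> ^ n * exp (- \<mu> * \<tau>) \<le> (2 * real n / \<mu>) ^ n * exp (- (\<mu> / 2) * \<tau>)"
proof (cases "n = 0")
  case True
  then show ?thesis using assms by (simp add: mult_right_mono)
next
  case False
  have "\<mu> * \<tau> / (2 * real n) \<le> exp (\<mu> * \<tau> / (2 * real n))"
    using exp_ge_add_one_self[of "\<mu> * \<tau> / (2 * real n)"] by linarith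
  then have "\<tau> \<le> (2 * real n / \<mu>) * exp (\<mu> * \<tau> / (2 * real n))"
    using assms False by (simp add: field_simps)
  then have "\<tau> ^ n \<le> ((2 * real n / \<mu>) * exp (\<mu> * \<tau> / (2 * real n))) ^ n"
    using assms by (intro power_mono) auto
  also have "\<dots> = (2 * real n / \<mu>) ^ n * exp (\<mu> / 2 * \<tau>)"
  proof -
    have "exp (\<mu> * \<tau> / (2 * real n)) ^ n = exp (\<mu> / 2 * \<tau>)"
      using False by (simp add: exp_of_nat_mult[symmetric])
    then show ?thesis by (simp only: power_mult_distrib)
  qed
  finally have "\<tau> ^ n * exp (- \<mu> * \<tau>) \<le> (2 * real n / \<mu>) ^ n * exp (\<mu> / 2 * \<tau>) * exp (- \<mu> * \<tau>)"
    by (intro mult_right_mono) auto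
  also have "\<dots> = (2 * real n / \<mu>) ^ n * exp (- (\<mu> / 2) * \<tau>)"
    by (simp add: mult.assoc exp_add[symmetric])
  finally show ?thesis .
qed

text \<open>Half of the decay rate absorbs the powers of \<open>\<tau>\<close>.\<close>

lemma layer_bound:
  assumes "\<mu> > 0"
  shows "layer \<mu> f \<Longrightarrow> \<exists>C. \<forall>x. \<forall>\<tau>\<in>{0..}. \<bar>f x \<tau>\<bar> \<le> C * exp (- (\<mu> / 2) * \<tau>)"
proof (induction rule: layer.induct)
  case (layer_monomial p n)
  then have "bounded (range p)" by cases
  then obtain B where B: "\<And>x. \<bar>p x\<bar> \<le> B" by (auto simp: bounded_iff)
  have "\<bar>p x * (\<tau> ^ n * exp (- \<mu> * \<tau>))\<bar> \<le> (B * (2 * real n / \<mu>) ^ n) * exp (- (\<mu> / 2) * \<tau>)" if "\<tau> \<in> {0..}" for x \<tau>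
  proof -
    have "\<bar>p x * (\<tau> ^ n * exp (- \<mu> * \<tau>))\<bar> = \<bar>p x\<bar> * (\<tau> ^ n * exp (- \<mu> * \<tau>))"
      using that by (simp add: abs_mult)
    also have "\<dots> \<le> B * ((2 * real n / \<mu>) ^ n * exp (- (\<mu> / 2) * \<tau>))"
      using that assms B[of x] by (intro mult_mono power_exp_bound) auto
    finally show ?thesis by (simp add: mult.assoc)
  qed
  then show ?case by blast
next
  case (layer_lin f g c d)
  then obtain B C where B: "\<And>x \<tau>. \<tau> \<in> {0..} \<Longrightarrow> \<bar>f x \<tau>\<bar> \<le> B * exp (- (\<mu> / 2) * \<tau>)"
    and C: "\<And>x \<tau>. \<tau> \<in> {0..} \<Longrightarrow> \<bar>g x \<tau>\<bar> \<le> C * exp (- (\<mu> / 2) * \<tau>)" by metis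
  have "\<bar>c * f x \<tau> + d * g x \<tau>\<bar> \<le> (\<bar>c\<bar> * B + \<bar>d\<bar> * C) * exp (- (\<mu> / 2) * \<tau>)" if "\<tau> \<in> {0..}" for x \<tau>
  proof -
    have "\<bar>c * f x \<tau> + d * g x \<tau>\<bar> \<le> \<bar>c\<bar> * \<bar>f x \<tau>\<bar> + \<bar>d\<bar> * \<bar>g x \<tau>\<bar>"
      by (rule order_trans[OF abs_triangle_ineq]) (simp add: abs_mult)
    also have "\<dots> \<le> \<bar>c\<bar> * (B * exp (- (\<mu> / 2) * \<tau>)) + \<bar>d\<bar> * (C * exp (- (\<mu> / 2) * \<tau>))"
      using B[OF that] C[OF that] by (intro add_mono mult_left_mono) auto
    finally show ?thesis by (simp add: algebra_simps)
  qed
  then show ?case by blast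
qed

lemma layer_tendsto:
  assumes "\<mu> > 0" "layer \<mu> f"
  shows "(f x \<longlongrightarrow> 0) at_top"
proof -
  obtain C where C: "\<And>x \<tau>. \<tau> \<in> {0..} \<Longrightarrow> \<bar>f x \<tau>\<bar> \<le> C * exp (- (\<mu> / 2) * \<tau>)"
    using layer_bound[OF assms] by blast
  have "filterlim (\<lambda>\<tau>. - (\<mu> / 2) * \<tau>) at_bot at_top"
    using assms(1) by (intro filterlim_tendsto_neg_mult_at_bot[OF tendsto_const _ filterlim_ident]) auto
  then have "((\<lambda>\<tau>. C * exp (- (\<mu> / 2) * \<tau>)) \<longlongrightarrow> C * 0) at_top"
    by (intro tendsto_mult tendsto_const filterlim_compose[OF exp_at_bot])
  then have lim: "((\<lambda>\<tau>. C * exp (- (\<mu> / 2) * \<tau>)) \<longlongrightarrow> 0) at_top" by simp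
  have ev: "\<forall>\<^sub>F \<tau> in at_top. norm (f x \<tau>) \<le> C * exp (- (\<mu> / 2) * \<tau>)"
    by (rule eventually_mono[OF eventually_ge_at_top[of 0]]) (simp add: C[simplified])
  show ?thesis by (rule Lim_null_comparison[OF ev lim])
qed

lemma layer_trace: "layer \<mu> f \<Longrightarrow> bounded_smooth (\<lambda>x. f x 0)"
proof (induction rule: layer.induct)
  case (layer_monomial p n)
  then show ?case using bounded_smooth_lin[of p p "0 ^ n" 0] by (simp add: mult.commute)
qed (rule bounded_smooth_lin)

section \<open>Construction of the expansion\<close>

lemma derivs_lin:
  assumes "perfect I" "partials I f fx ft" "partials I g gx gt" "t \<in> I"
  shows "dt I (\<lambda>x t. c * f x t + d * g x t) x t = c * ft x t + d * gt x t"
    and "dx (\<lambda>x t. c * f x t + d * g x t) x t = c * fx x t + d * gx x t"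
  using partials_dt[OF assms(1) partials_lin[OF assms(2,3)] assms(4)]
    partials_dx[OF partials_lin[OF assms(2,3)] assms(4)] by blast+

text \<open>Eliminating \<open>V = (a U + L) / b\<close> from the solvability condition of the level after the next leaves a
  system for \<open>U\<close> and \<open>W\<close>; \<open>L\<close> is the contribution of the level before the previous one.\<close>

lemma regular_step:
  fixes a b T :: real
  assumes ab: "0 < a" "0 < b" and T: "0 < T" and L: "strip_smooth T L" and \<phi>: "bounded_smooth \<phi>" and \<psi>: "bounded_smooth \<psi>"
  obtains U V W where "strip_smooth T U" "strip_smooth T V" "strip_smooth T W"
    "\<And>x t. t \<in> {0..T} \<Longrightarrow> - a * U x t + b * V x t = L x t"
    "\<And>x t. t \<in> {0..T} \<Longrightarrow> dt {0..T} W x t + k3 * dx W x t = a3 * U x t + b3 * V x t + c3 * W x t"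
    "\<And>x t. t \<in> {0..T} \<Longrightarrow> dt {0..T} U x t + k1 * dx U x t + (dt {0..T} V x t + k2 * dx V x t) = (c1 + c2) * W x t"
    "\<And>x. U x 0 + V x 0 = \<phi> x" "\<And>x. W x 0 = \<psi> x"
proof -
  \<comment> \<open>The component \<open>True\<close> is \<open>U\<close>, the component \<open>False\<close> is \<open>W\<close>.\<close>
  define k where "k j = (if j then (b * k1 + a * k2) / (a + b) else k3)" for j
  define M where "M j l = (if j then (if l then 0 else b * (c1 + c2) / (a + b))
     else (if l then a3 + b3 * a / b else c3))" for j l
  define F where "F j = (if j then (\<lambda>x t. (- 1 / (a + b)) * dt {0..T} L x t + (- k2 / (a + b)) * dx L x t)
     else (\<lambda>x t. (b3 / b) * L x t + 0 * L x t))" for j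
  define p where "p j = (if j then (\<lambda>x. (b / (a + b)) * \<phi> x + (- 1 / (a + b)) * L x 0) else \<psi>)" for j
  note LD = strip_smoothD[OF L T]
  have F: "\<forall>j. strip_smooth T (F j)"
  proof
    fix j show "strip_smooth T (F j)"
    proof (cases j)
      case True
      then show ?thesis
        using strip_smooth_lin[OF LD(3) LD(2), of "- 1 / (a + b)" "- k2 / (a + b)"] by (simp add: F_def)
    next
      case False
      then show ?thesis using strip_smooth_lin[OF L L, of "b3 / b" 0] by (simp add: F_def)
    qed
  qed
  have p: "\<forall>j. bounded_smooth (p j)"
    unfolding p_def using \<phi> \<psi> bounded_smooth_lin[OF \<phi> bounded_smooth_trace[OF L], of "b / (a + b)" "- 1 / (a + b)"] T
    by simp
  obtain X where X: "\<And>j. strip_smooth T (X j)" "\<And>j x. X j x 0 = p j x"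
    "\<And>j x t. t \<in> {0..T} \<Longrightarrow>
       dt {0..T} (X j) x t + k j * dx (X j) x t = (\<Sum>l\<in>UNIV. M j l * X l x t) + F j x t"
    using hyperbolic_existence[OF F p T, of k M] by blast
  define V where "V x t = (a / b) * X True x t + (1 / b) * L x t" for x t
  note dV = derivs_lin[OF perfect_Icc[OF T] strip_smoothD(1)[OF X(1)[of True] T] LD(1), of _ "a / b" "1 / b"]
  show ?thesis
  proof (rule that[of "X True" V "X False"])
    show "strip_smooth T (X True)" "strip_smooth T (X False)" by (rule X)+
    show "strip_smooth T V" unfolding V_def by (rule strip_smooth_lin[OF X(1) L])
    show "- a * X True x t + b * V x t = L x t" for x t unfolding V_def using ab by (simp add: field_simps)
    show "X True x 0 + V x 0 = \<phi> x" for x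
      unfolding V_def X(2) p_def using ab by (simp add: divide_simps) (simp add: algebra_simps)
    show "X False x 0 = \<psi> x" for x by (simp add: X(2) p_def)
    fix x t assume t: "t \<in> {0..T}"
    show "dt {0..T} (X False) x t + k3 * dx (X False) x t = a3 * X True x t + b3 * V x t + c3 * X False x t"
      using X(3)[OF t, of False x] ab
      by (simp add: k_def M_def F_def UNIV_bool V_def field_simps)
    have "dt {0..T} (X True) x t + (b * k1 + a * k2) / (a + b) * dx (X True) x t
       = b * (c1 + c2) / (a + b) * X False x t - (dt {0..T} L x t + k2 * dx L x t) / (a + b)"
      using X(3)[OF t, of True x]
      by (simp add: k_def M_def F_def UNIV_bool algebra_simps add_divide_distrib diff_divide_distrib)
    then have "(a + b) * dt {0..T} (X True) x t + (b * k1 + a * k2) * dx (X True) x t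
       = b * (c1 + c2) * X False x t - (dt {0..T} L x t + k2 * dx L x t)"
      using ab by (simp add: divide_simps) (simp add: algebra_simps)?
    moreover have "b * dt {0..T} V x t = a * dt {0..T} (X True) x t + dt {0..T} L x t"
      "b * dx V x t = a * dx (X True) x t + dx L x t"
      using dV[OF t, of x, folded V_def[abs_def]] ab by (simp_all add: distrib_left)
    moreover have "b * (dt {0..T} (X True) x t + k1 * dx (X True) x t + (dt {0..T} V x t + k2 * dx V x t))
       = b * dt {0..T} (X True) x t + b * k1 * dx (X True) x t + (b * dt {0..T} V x t + k2 * (b * dx V x t))"
      by (simp add: algebra_simps)
    ultimately have "b * (dt {0..T} (X True) x t + k1 * dx (X True) x t + (dt {0..T} V x t + k2 * dx V x t))
       = b * ((c1 + c2) * X False x t)"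
      by (simp add: algebra_simps)
    then show "dt {0..T} (X True) x t + k1 * dx (X True) x t + (dt {0..T} V x t + k2 * dx V x t)
       = (c1 + c2) * X False x t"
      using ab by simp
  qed
qed

text \<open>The six functions \<open>U, V, W, P, Q, S\<close> of one order of the expansion.\<close>

type_synonym level = "(real \<Rightarrow> real \<Rightarrow> real) \<times> (real \<Rightarrow> real \<Rightarrow> real) \<times> (real \<Rightarrow> real \<Rightarrow> real) \<times>
  (real \<Rightarrow> real \<Rightarrow> real) \<times> (real \<Rightarrow> real \<Rightarrow> real) \<times> (real \<Rightarrow> real \<Rightarrow> real)"

locale two_time_system =
  fixes a b a3 b3 c1 c2 c3 k1 k2 k3 T :: real
  assumes ab: "0 < a" "0 < b" and T: "0 < T"
begin

text \<open>The last condition makes the two fast equations, two levels later, compatible.\<close>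

fun admissible_level :: "level \<Rightarrow> bool" where
  "admissible_level (U, V, W, P, Q, S) \<longleftrightarrow>
     strip_smooth T U \<and> strip_smooth T V \<and> strip_smooth T W \<and> layer (a + b) P \<and> layer (a + b) Q \<and> layer (a + b) S \<and>
     (\<forall>x. \<forall>t\<in>{0..T}. dt {0..T} U x t + k1 * dx U x t + (dt {0..T} V x t + k2 * dx V x t) = (c1 + c2) * W x t)"

fun next_level :: "(real \<Rightarrow> real) \<times> (real \<Rightarrow> real) \<times> (real \<Rightarrow> real) \<Rightarrow> level \<Rightarrow> level \<Rightarrow> bool" where
  "next_level (d1, d2, d3) (U', V', W', P', Q', S') (U, V, W, P, Q, S) \<longleftrightarrow>
     (\<forall>x. \<forall>t\<in>{0..T}.
        dt {0..T} U' x t + k1 * dx U' x t = - a * U x t + b * V x t + c1 * W' x t \<and>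
        dt {0..T} V' x t + k2 * dx V' x t = a * U x t - b * V x t + c2 * W' x t \<and>
        dt {0..T} W x t + k3 * dx W x t = a3 * U x t + b3 * V x t + c3 * W x t) \<and>
     (\<forall>x. \<forall>\<tau>\<in>{0..}.
        dt {0..} P x \<tau> + k1 * dx P' x \<tau> = - a * P x \<tau> + b * Q x \<tau> + c1 * S' x \<tau> \<and>
        dt {0..} Q x \<tau> + k2 * dx Q' x \<tau> = a * P x \<tau> - b * Q x \<tau> + c2 * S' x \<tau> \<and>
        dt {0..} S x \<tau> + k3 * dx S' x \<tau> = a3 * P' x \<tau> + b3 * Q' x \<tau> + c3 * S' x \<tau>) \<and>
     (\<forall>x. U x 0 + P x 0 = d1 x \<and> V x 0 + Q x 0 = d2 x \<and> W x 0 + S x 0 = d3 x)"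

text \<open>The order of the construction matters: first \<open>A = P + Q\<close> and \<open>S\<close>, which need no initial values; then
  the regular terms, whose initial values involve \<open>A\<close> and \<open>S\<close>; last \<open>D = a P - b Q\<close>.\<close>

lemma next_level_exists:
  assumes "admissible_level e" and d: "bounded_smooth d1" "bounded_smooth d2" "bounded_smooth d3"
  shows "\<exists>e'. admissible_level e' \<and> next_level (d1, d2, d3) e e'"
proof -
  obtain U' V' W' P' Q' S' where e: "e = (U', V', W', P', Q', S')" by (cases e) auto
  note ok = assms(1)[unfolded e admissible_level.simps]
  define \<mu> where "\<mu> = a + b"
  have \<mu>: "\<mu> > 0" using ab by (simp add: \<mu>_def)
  have lay: "layer \<mu> P'" "layer \<mu> Q'" "layer \<mu> S'" using ok by (auto simp: \<mu>_def)
  obtain Px Qx Sx where x: "layer \<mu> Px" "layer \<mu> Qx" "layer \<mu> Sx"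
    "\<And>x \<tau>. \<tau> \<in> {0..} \<Longrightarrow> dx P' x \<tau> = Px x \<tau>" "\<And>x \<tau>. \<tau> \<in> {0..} \<Longrightarrow> dx Q' x \<tau> = Qx x \<tau>"
    "\<And>x \<tau>. \<tau> \<in> {0..} \<Longrightarrow> dx S' x \<tau> = Sx x \<tau>"
    using layerD(3)[OF lay(1)] layerD(3)[OF lay(2)] layerD(3)[OF lay(3)] by blast
  define f1 where "f1 x \<tau> = (- k1) * Px x \<tau> + c1 * S' x \<tau>" for x \<tau>
  define f2 where "f2 x \<tau> = (- k2) * Qx x \<tau> + c2 * S' x \<tau>" for x \<tau>
  define f3 where "f3 x \<tau> = 1 * (a3 * P' x \<tau> + b3 * Q' x \<tau>) + 1 * (c3 * S' x \<tau> + (- k3) * Sx x \<tau>)" for x \<tau>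
  have f: "layer \<mu> f1" "layer \<mu> f2" "layer \<mu> f3"
    unfolding f1_def f2_def f3_def by (intro layer_lin lay x)+
  obtain A where A: "layer \<mu> A" "\<And>x \<tau>. (A x has_real_derivative 1 * f1 x \<tau> + 1 * f2 x \<tau>) (at \<tau>)"
    using layer_antiderivative[OF \<mu> layer_lin[OF f(1,2), of 1 1]] by blast
  obtain S where S: "layer \<mu> S" "\<And>x \<tau>. (S x has_real_derivative f3 x \<tau>) (at \<tau>)"
    using layer_antiderivative[OF \<mu> f(3)] by blast
  \<comment> \<open>By admissibility, the contribution of the old level to the second equation is \<open>- L\<close>.\<close>
  define L where "L x t = 1 * (1 * dt {0..T} U' x t + k1 * dx U' x t) + (- c1) * W' x t" for x t
  have L: "strip_smooth T L" unfolding L_def using ok strip_smoothD[OF _ T] by (intro strip_smooth_lin) auto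
  have "bounded_smooth (\<lambda>x. 1 * (1 * d1 x + 1 * d2 x) + (- 1) * A x 0)" "bounded_smooth (\<lambda>x. 1 * d3 x + (- 1) * S x 0)"
    by (intro bounded_smooth_lin d layer_trace[OF A(1)] layer_trace[OF S(1)])+
  from regular_step[OF ab T L this, of k3 a3 b3 c3 k1 k2 c1 c2]
  obtain U V W where R: "strip_smooth T U" "strip_smooth T V" "strip_smooth T W"
    "\<And>x t. t \<in> {0..T} \<Longrightarrow> - a * U x t + b * V x t = L x t"
    "\<And>x t. t \<in> {0..T} \<Longrightarrow> dt {0..T} W x t + k3 * dx W x t = a3 * U x t + b3 * V x t + c3 * W x t"
    "\<And>x t. t \<in> {0..T} \<Longrightarrow> dt {0..T} U x t + k1 * dx U x t + (dt {0..T} V x t + k2 * dx V x t) = (c1 + c2) * W x t"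
    "\<And>x. U x 0 + V x 0 = 1 * (1 * d1 x + 1 * d2 x) + (- 1) * A x 0" "\<And>x. W x 0 = 1 * d3 x + (- 1) * S x 0"
    by blast
  \<comment> \<open>The initial value of \<open>a P - b Q\<close> that the initial conditions leave.\<close>
  define \<delta> where "\<delta> x = 1 * (a * d1 x + (- b) * d2 x) + 1 * ((- a) * U x 0 + b * V x 0)" for x
  have "bounded_smooth (\<lambda>x. U x 0)" "bounded_smooth (\<lambda>x. V x 0)" using T R(1,2) by (auto intro: bounded_smooth_trace)
  then have "bounded_smooth \<delta>" unfolding \<delta>_def by (intro bounded_smooth_lin d)
  from layer_relaxation[OF layer_lin[OF f(1,2), of a "- b"] this]
  obtain D where D: "layer \<mu> D" "\<And>x. D x 0 = \<delta> x"
    "\<And>x \<tau>. (D x has_real_derivative - \<mu> * D x \<tau> + (a * f1 x \<tau> + (- b) * f2 x \<tau>)) (at \<tau>)"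
    by blast
  define P where "P x \<tau> = (b / \<mu>) * A x \<tau> + (1 / \<mu>) * D x \<tau>" for x \<tau>
  define Q where "Q x \<tau> = (a / \<mu>) * A x \<tau> + (- 1 / \<mu>) * D x \<tau>" for x \<tau>
  have PQ: "layer \<mu> P" "layer \<mu> Q" unfolding P_def Q_def by (intro layer_lin A D)+
  have dS: "dt {0..} S x \<tau> = f3 x \<tau>" if "\<tau> \<in> {0..}" for x \<tau> by (rule dt_eqI[OF S(2) that])
  have one: "a / \<mu> + b / \<mu> = 1" using \<mu> by (simp add: \<mu>_def add_divide_distrib[symmetric])
  have PQ_sum: "P x \<tau> + Q x \<tau> = A x \<tau>" for x \<tau>
  proof -
    have "P x \<tau> + Q x \<tau> = (a / \<mu> + b / \<mu>) * A x \<tau>" by (simp add: P_def Q_def algebra_simps)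
    then show ?thesis by (simp add: one)
  qed
  have PQ_diff: "a * P x \<tau> - b * Q x \<tau> = D x \<tau>" for x \<tau>
  proof -
    have "a * P x \<tau> - b * Q x \<tau> = (a / \<mu> + b / \<mu>) * D x \<tau>" by (simp add: P_def Q_def algebra_simps)
    then show ?thesis by (simp add: one)
  qed
  have "((\<lambda>\<tau>. P x \<tau>) has_real_derivative f1 x \<tau> - D x \<tau>) (at \<tau>)" for x \<tau>
    unfolding P_def
    by (rule DERIV_cong[OF DERIV_add[OF DERIV_cmult[OF A(2)] DERIV_cmult[OF D(3)]]])
       (use \<mu> arg_cong[OF one, of "\<lambda>z. z * f1 x \<tau>"] in
         \<open>simp add: algebra_simps add_divide_distrib diff_divide_distrib\<close>)
  then have dP: "dt {0..} P x \<tau> = f1 x \<tau> - D x \<tau>" if "\<tau> \<in> {0..}" for x \<tau> by (rule dt_eqI[OF _ that])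
  have "((\<lambda>\<tau>. Q x \<tau>) has_real_derivative f2 x \<tau> + D x \<tau>) (at \<tau>)" for x \<tau>
    unfolding Q_def
    by (rule DERIV_cong[OF DERIV_add[OF DERIV_cmult[OF A(2)] DERIV_cmult[OF D(3)]]])
       (use \<mu> arg_cong[OF one, of "\<lambda>z. z * f2 x \<tau>"] in
         \<open>simp add: algebra_simps add_divide_distrib diff_divide_distrib\<close>)
  then have dQ: "dt {0..} Q x \<tau> = f2 x \<tau> + D x \<tau>" if "\<tau> \<in> {0..}" for x \<tau> by (rule dt_eqI[OF _ that])
  have init: "U x 0 + P x 0 = d1 x \<and> V x 0 + Q x 0 = d2 x" for x
  proof -
    let ?p = "U x 0 + P x 0 - d1 x" and ?q = "V x 0 + Q x 0 - d2 x"
    have 1: "?p + ?q = 0" using R(7)[of x] PQ_sum[of x 0] by simp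
    have 2: "a * ?p - b * ?q = 0" using D(2)[of x] PQ_diff[of x 0] by (simp add: \<delta>_def algebra_simps)
    have "(a + b) * ?p = (a * ?p - b * ?q) + b * (?p + ?q)" by (simp add: algebra_simps)
    then have "(a + b) * ?p = 0" unfolding 1 2 by simp
    then show ?thesis using ab 1 by simp
  qed
  have "admissible_level (U, V, W, P, Q, S)" using R PQ S by (simp add: \<mu>_def)
  moreover have "next_level (d1, d2, d3) e (U, V, W, P, Q, S)"
    unfolding e next_level.simps
  proof (intro conjI allI ballI)
    fix x t assume t: "t \<in> {0..T}"
    show "dt {0..T} U' x t + k1 * dx U' x t = - a * U x t + b * V x t + c1 * W' x t"
      using R(4)[OF t, of x] by (simp add: L_def)
    moreover have "dt {0..T} U' x t + k1 * dx U' x t + (dt {0..T} V' x t + k2 * dx V' x t) = (c1 + c2) * W' x t"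
      using ok t by blast
    ultimately show "dt {0..T} V' x t + k2 * dx V' x t = a * U x t - b * V x t + c2 * W' x t"
      by (simp add: algebra_simps)
    show "dt {0..T} W x t + k3 * dx W x t = a3 * U x t + b3 * V x t + c3 * W x t" by (rule R(5)[OF t])
  next
    fix x \<tau> :: real assume t: "\<tau> \<in> {0..}"
    show "dt {0..} P x \<tau> + k1 * dx P' x \<tau> = - a * P x \<tau> + b * Q x \<tau> + c1 * S' x \<tau>"
      using dP[OF t, of x] x(4)[OF t, of x] PQ_diff[of x \<tau>] by (simp add: f1_def)
    show "dt {0..} Q x \<tau> + k2 * dx Q' x \<tau> = a * P x \<tau> - b * Q x \<tau> + c2 * S' x \<tau>"
      using dQ[OF t, of x] x(5)[OF t, of x] PQ_diff[of x \<tau>] by (simp add: f2_def)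
    show "dt {0..} S x \<tau> + k3 * dx S' x \<tau> = a3 * P' x \<tau> + b3 * Q' x \<tau> + c3 * S' x \<tau>"
      using dS[OF t, of x] x(6)[OF t, of x] by (simp add: f3_def)
  qed (use init R(8) in auto)
  ultimately show ?thesis by blast
qed

abbreviation zero_level :: level where
  "zero_level \<equiv> (\<lambda>x t. 0, \<lambda>x t. 0, \<lambda>x t. 0, \<lambda>x t. 0, \<lambda>x t. 0, \<lambda>x t. 0)"

lemma zero_level: "admissible_level zero_level"
proof -
  have "partials {0..T} (\<lambda>x t. 0) (\<lambda>x t. 0) (\<lambda>x t. 0)" by (simp add: partials_def)
  then have "dx (\<lambda>x t. 0) x t = 0" "dt {0..T} (\<lambda>x t. 0) x t = 0" if "t \<in> {0..T}" for x t
    using partials_dx partials_dt[OF perfect_Icc[OF T]] that by blast+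
  then show ?thesis using strip_smooth_const[OF bounded_smooth_zero, of T] layer_zero by simp
qed

theorem expansion_exists:
  assumes "bounded_smooth u0" "bounded_smooth v0" "bounded_smooth w0"
  obtains U V W P Q S where
    "asymptotic_expansion a b a3 b3 c1 c2 c3 k1 k2 k3 T u0 v0 w0 U V W P Q S"
    "\<And>i. strip_smooth T (U i)" "\<And>i. strip_smooth T (V i)" "\<And>i. strip_smooth T (W i)"
    "\<And>i. layer (a + b) (P i)" "\<And>i. layer (a + b) (Q i)" "\<And>i. layer (a + b) (S i)"
proof -
  define z :: "real \<Rightarrow> real" where "z = (\<lambda>x. 0)"
  define data where "data i = (if i = 0 then (u0, v0, w0) else (z, z, z))" for i :: nat
  define prev :: "(nat \<Rightarrow> level) \<Rightarrow> nat \<Rightarrow> level" where "prev E i = (if i < 2 then zero_level else E (i - 2))" for E i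
  have "\<exists>E. \<forall>i. admissible_level (E i) \<and> next_level (data i) (prev E i) (E i)"
  \<comment> \<open>Level \<open>i\<close> is built on level \<open>i - 2\<close>, so the choice is along the well-founded order of the indices.\<close>
  proof (rule dependent_wf_choice[OF wf_less, where P = "\<lambda>E i e. admissible_level e \<and> next_level (data i) (prev E i) e"])
    fix E E' :: "nat \<Rightarrow> level" and i e
    assume "\<And>j. (j, i) \<in> {(x, y). x < y} \<Longrightarrow> E j = E' j"
    then show "(admissible_level e \<and> next_level (data i) (prev E i) e) =
               (admissible_level e \<and> next_level (data i) (prev E' i) e)"
      by (simp add: prev_def)
  next
    fix i :: nat and E
    assume "\<And>j. (j, i) \<in> {(x, y). x < y} \<Longrightarrow> admissible_level (E j) \<and> next_level (data j) (prev E j) (E j)"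
    then have "admissible_level (prev E i)" using zero_level by (simp add: prev_def)
    moreover obtain d1 d2 d3 where d: "data i = (d1, d2, d3)" "bounded_smooth d1" "bounded_smooth d2" "bounded_smooth d3"
      using assms bounded_smooth_zero by (cases "i = 0") (auto simp: data_def z_def)
    ultimately show "\<exists>e. admissible_level e \<and> next_level (data i) (prev E i) e"
      using next_level_exists[OF _ d(2-4), of "prev E i"] unfolding d(1) by blast
  qed
  then obtain E where E: "\<And>i. admissible_level (E i)" "\<And>i. next_level (data i) (prev E i) (E i)" by blast
  define U where "U i = fst (E i)" for i
  define V where "V i = fst (snd (E i))" for i
  define W where "W i = fst (snd (snd (E i)))" for i
  define P where "P i = fst (snd (snd (snd (E i))))" for i
  define Q where "Q i = fst (snd (snd (snd (snd (E i)))))" for i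
  define S where "S i = snd (snd (snd (snd (snd (E i)))))" for i
  have eq: "E i = (U i, V i, W i, P i, Q i, S i)" for i by (simp add: U_def V_def W_def P_def Q_def S_def)
  have prev: "prev E i = (back2 U i, back2 V i, back2 W i, back2 P i, back2 Q i, back2 S i)" for i
    by (simp add: prev_def back2_def eq)
  note ok = E(1)[unfolded eq admissible_level.simps]
  have nxt: "next_level (if i = 0 then u0 else z, if i = 0 then v0 else z, if i = 0 then w0 else z)
    (back2 U i, back2 V i, back2 W i, back2 P i, back2 Q i, back2 S i) (U i, V i, W i, P i, Q i, S i)" for i
    using E(2)[of i] unfolding eq prev data_def by (cases "i = 0") auto
  note nxt = nxt[unfolded next_level.simps]
  have \<mu>: "a + b > 0" using ab by simp
  have "regular_terms a b a3 b3 c1 c2 c3 k1 k2 k3 T U V W"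
    unfolding regular_terms_def using nxt ok strip_smoothD(4)[OF _ T] by blast
  moreover have "boundary_functions a b a3 b3 c1 c2 c3 k1 k2 k3 P Q S"
    unfolding boundary_functions_def using nxt ok layerD(2) layer_tendsto[OF \<mu>] by blast
  moreover have "\<forall>i x. U i x 0 + P i x 0 = (if i = 0 then u0 x else 0) \<and>
            V i x 0 + Q i x 0 = (if i = 0 then v0 x else 0) \<and>
            W i x 0 + S i x 0 = (if i = 0 then w0 x else 0)"
    using nxt by (simp add: z_def)
  ultimately have "asymptotic_expansion a b a3 b3 c1 c2 c3 k1 k2 k3 T u0 v0 w0 U V W P Q S"
    by (simp add: asymptotic_expansion_def)
  then show ?thesis using that ok by blast
qed

end

section \<open>Uniqueness of the expansion\<close>

lemma dx_cong: "(\<And>y. f y t = g y t) \<Longrightarrow> dx f x t = dx g x t"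
  by (simp add: dx_def)

lemma dt_cong:
  assumes "t \<in> I" "\<And>s. s \<in> I \<Longrightarrow> f x s = g x s"
  shows "dt I f x t = dt I g x t"
proof -
  have "(f x has_vector_derivative d) (at t within I) \<longleftrightarrow> (g x has_vector_derivative d) (at t within I)" for d
    using has_vector_derivative_transform[OF assms(1), of "f x" "g x"]
      has_vector_derivative_transform[OF assms(1), of "g x" "f x"] assms(2) by auto
  then show ?thesis by (simp add: dt_def vector_derivative_def)
qed

lemma zero_derivative_half_line:
  fixes g :: "real \<Rightarrow> real"
  assumes "\<And>\<tau>. \<tau> \<in> {0..} \<Longrightarrow> (g has_real_derivative 0) (at \<tau> within {0..})"
  shows "\<tau> \<in> {0..} \<Longrightarrow> g \<tau> = g 0" and "(g \<longlongrightarrow> 0) at_top \<Longrightarrow> \<tau> \<in> {0..} \<Longrightarrow> g \<tau> = 0"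
proof -
  obtain c where c: "\<And>x. x \<in> {0..} \<Longrightarrow> g x = c"
    using has_field_derivative_zero_constant[of "{0..}" g] assms by auto
  then show "g \<tau> = g 0" if "\<tau> \<in> {0..}" using that by simp
  assume lim: "(g \<longlongrightarrow> 0) at_top" and \<tau>: "\<tau> \<in> {0..}"
  have "(g \<longlongrightarrow> c) at_top"
    by (rule tendsto_eventually[OF eventually_mono[OF eventually_ge_at_top[of 0]]]) (simp add: c)
  then have "c = 0" using tendsto_unique[OF _ _ lim] by auto
  then show "g \<tau> = 0" using c \<tau> by simp
qed

abbreviation agree :: "real set \<Rightarrow> (real \<Rightarrow> real \<Rightarrow> real) \<Rightarrow> (real \<Rightarrow> real \<Rightarrow> real) \<Rightarrow> bool" where
  "agree I f g \<equiv> \<forall>x. \<forall>t\<in>I. f x t = g x t"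

lemma agree_derivs:
  assumes "agree I f g" "t \<in> I"
  shows "f x t = g x t" "dx f x t = dx g x t" "dt I f x t = dt I g x t"
  using assms by (auto intro: dx_cong dt_cong)

lemma agree_back2: "(\<And>j. j < i \<Longrightarrow> agree I (F j) (G j)) \<Longrightarrow> agree I (back2 F i) (back2 G i)"
  by (auto simp: back2_def)

text \<open>Decay at infinity forces the sums \<open>P + Q\<close> and \<open>P' + Q'\<close> to agree, while the difference \<open>P - P'\<close> solves a
  homogeneous relaxation equation and so is determined by its initial value.\<close>

lemma layer_unique:
  fixes a b :: real
  assumes ab: "0 < a" "0 < b"
    and C: "C1 {0..} P" "C1 {0..} Q" "C1 {0..} P'" "C1 {0..} Q'"
    and lim: "\<And>x. (P x \<longlongrightarrow> 0) at_top" "\<And>x. (Q x \<longlongrightarrow> 0) at_top"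
      "\<And>x. (P' x \<longlongrightarrow> 0) at_top" "\<And>x. (Q' x \<longlongrightarrow> 0) at_top"
    and eq: "\<And>x \<tau>. \<tau> \<in> {0..} \<Longrightarrow> dt {0..} P x \<tau> = - a * P x \<tau> + b * Q x \<tau> + f x \<tau>"
      "\<And>x \<tau>. \<tau> \<in> {0..} \<Longrightarrow> dt {0..} Q x \<tau> = a * P x \<tau> - b * Q x \<tau> + g x \<tau>"
      "\<And>x \<tau>. \<tau> \<in> {0..} \<Longrightarrow> dt {0..} P' x \<tau> = - a * P' x \<tau> + b * Q' x \<tau> + f x \<tau>"
      "\<And>x \<tau>. \<tau> \<in> {0..} \<Longrightarrow> dt {0..} Q' x \<tau> = a * P' x \<tau> - b * Q' x \<tau> + g x \<tau>"
  shows "P x 0 - P' x 0 = - (Q x 0 - Q' x 0)"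
    and "P x 0 = P' x 0 \<Longrightarrow> \<tau> \<in> {0..} \<Longrightarrow> P x \<tau> = P' x \<tau> \<and> Q x \<tau> = Q' x \<tau>"
proof -
  have d: "(F x has_real_derivative dt {0..} F x \<tau>) (at \<tau> within {0..})" if "C1 {0..} F" "\<tau> \<in> {0..}" for F \<tau>
    using C1D(1)[OF that(1)] that(2) by (auto simp: partials_def)
  let ?s = "\<lambda>\<tau>. (P x \<tau> - P' x \<tau>) + (Q x \<tau> - Q' x \<tau>)"
  have "(?s has_real_derivative 0) (at \<tau> within {0..})" if "\<tau> \<in> {0..}" for \<tau>
    by (rule DERIV_cong[OF DERIV_add[OF DERIV_diff[OF d d] DERIV_diff[OF d d]]]) (use C that eq in auto)
  moreover have "(?s \<longlongrightarrow> 0) at_top"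
    using tendsto_add[OF tendsto_diff[OF lim(1)[of x] lim(3)[of x]] tendsto_diff[OF lim(2)[of x] lim(4)[of x]]] by simp
  ultimately have s: "?s \<tau> = 0" if "\<tau> \<in> {0..}" for \<tau> using zero_derivative_half_line(2)[of ?s \<tau>] that by blast
  show "P x 0 - P' x 0 = - (Q x 0 - Q' x 0)" using s[of 0] by simp
  assume init: "P x 0 = P' x 0" and \<tau>: "\<tau> \<in> {0..}"
  \<comment> \<open>The integrating factor of the relaxation equation.\<close>
  let ?e = "\<lambda>\<tau>. (P x \<tau> - P' x \<tau>) * exp ((a + b) * \<tau>)"
  have "(?e has_real_derivative 0) (at \<tau> within {0..})" if t: "\<tau> \<in> {0..}" for \<tau>
  proof (rule DERIV_cong[OF DERIV_mult[OF DERIV_diff[OF d d]]])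
    show "((\<lambda>\<tau>. exp ((a + b) * \<tau>)) has_real_derivative exp ((a + b) * \<tau>) * (a + b)) (at \<tau> within {0..})"
      by (auto intro!: derivative_eq_intros)
    have Q: "Q x \<tau> = Q' x \<tau> - (P x \<tau> - P' x \<tau>)" using s[OF t] by simp
    show "(dt {0..} P x \<tau> - dt {0..} P' x \<tau>) * exp ((a + b) * \<tau>) +
      exp ((a + b) * \<tau>) * (a + b) * (P x \<tau> - P' x \<tau>) = 0"
      unfolding eq(1)[OF t] eq(3)[OF t] Q by (simp add: algebra_simps)
  qed (use C t in auto)
  from zero_derivative_half_line(1)[of ?e, OF this \<tau>] have "P x \<tau> = P' x \<tau>" using init by simp
  then show "P x \<tau> = P' x \<tau> \<and> Q x \<tau> = Q' x \<tau>" using s[OF \<tau>] by simp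
qed

context two_time_system
begin

lemma regular_unique:
  assumes C: "C1 {0..T} U" "C1 {0..T} V" "C1 {0..T} W" "C1 {0..T} U'" "C1 {0..T} V'" "C1 {0..T} W'"
    and v: "\<And>x t. t \<in> {0..T} \<Longrightarrow> - a * U x t + b * V x t = - a * U' x t + b * V' x t"
    and w: "\<And>x t. t \<in> {0..T} \<Longrightarrow> dt {0..T} W x t + k3 * dx W x t = a3 * U x t + b3 * V x t + c3 * W x t"
      "\<And>x t. t \<in> {0..T} \<Longrightarrow> dt {0..T} W' x t + k3 * dx W' x t = a3 * U' x t + b3 * V' x t + c3 * W' x t"
    and u: "\<And>x t. t \<in> {0..T} \<Longrightarrow>
        dt {0..T} U x t + k1 * dx U x t + (dt {0..T} V x t + k2 * dx V x t) = (c1 + c2) * W x t"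
      "\<And>x t. t \<in> {0..T} \<Longrightarrow>
        dt {0..T} U' x t + k1 * dx U' x t + (dt {0..T} V' x t + k2 * dx V' x t) = (c1 + c2) * W' x t"
    and init: "\<And>x. U x 0 + V x 0 = U' x 0 + V' x 0" "\<And>x. W x 0 = W' x 0"
    and t: "t \<in> {0..T}"
  shows "U x t = U' x t \<and> V x t = V' x t \<and> W x t = W' x t"
proof -
  have I: "perfect {0..T}" by (rule perfect_Icc[OF T])
  define diff :: "(real \<Rightarrow> real \<Rightarrow> real) \<Rightarrow> (real \<Rightarrow> real \<Rightarrow> real) \<Rightarrow> real \<Rightarrow> real \<Rightarrow> real"
    where "diff f g = (\<lambda>x t. 1 * f x t + (- 1) * g x t)" for f g
  have dC: "C1 {0..T} (diff f g)" if "C1 {0..T} f" "C1 {0..T} g" for f g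
    unfolding diff_def using that by (rule C1_lin[OF I])
  have dd: "dt {0..T} (diff f g) x t = dt {0..T} f x t - dt {0..T} g x t"
    "dx (diff f g) x t = dx f x t - dx g x t" if "C1 {0..T} f" "C1 {0..T} g" "t \<in> {0..T}" for f g x t
    unfolding diff_def using derivs_lin[OF I C1D(1)[OF that(1)] C1D(1)[OF that(2)] that(3), of 1 "- 1"] by simp_all
  let ?u = "diff U U'" and ?v = "diff V V'" and ?w = "diff W W'"
  have vu: "agree {0..T} ?v (\<lambda>x t. (a / b) * ?u x t + 0 * ?u x t)"
    using v ab by (auto simp: diff_def field_simps)
  define k where "k j = (if j then (b * k1 + a * k2) / (a + b) else k3)" for j
  define M where "M j l = (if j then (if l then 0 else b * (c1 + c2) / (a + b))
     else (if l then a3 + b3 * a / b else c3))" for j l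
  define f where "f j = (if j then ?u else ?w)" for j
  have "f j x t = 0" for j x
  proof (rule hyperbolic_uniqueness[where f = f and k = k and M = M, OF _ _ _ t])
    show "C1 {0..T} (f j)" for j using dC C by (simp add: f_def)
    show "f j x 0 = 0" for j x
    proof -
      have V: "V x 0 = U' x 0 + V' x 0 - U x 0" using init(1)[of x] by simp
      have "- a * U x 0 + b * V x 0 = - a * U' x 0 + b * V' x 0" by (rule v) (use T in simp)
      then have "(a + b) * ?u x 0 = 0" unfolding V diff_def by (simp add: algebra_simps)
      then show ?thesis using ab init(2) by (simp add: f_def diff_def)
    qed
    fix j x t assume t: "t \<in> {0..T}"
    have pu: "partials {0..T} ?u (dx ?u) (dt {0..T} ?u)" by (rule C1D(1)[OF dC]) (rule C)+
    show "dt {0..T} (f j) x t + k j * dx (f j) x t = (\<Sum>l\<in>UNIV. M j l * f l x t)"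
    proof (cases j)
      case True
      have "dt {0..T} ?v x t = (a / b) * dt {0..T} ?u x t" "dx ?v x t = (a / b) * dx ?u x t"
        using agree_derivs[OF vu t, of x] derivs_lin[OF I pu pu t, of "a / b" 0] by simp_all
      moreover have "dt {0..T} ?u x t + k1 * dx ?u x t + (dt {0..T} ?v x t + k2 * dx ?v x t) = (c1 + c2) * ?w x t"
        using u[OF t, of x] C t by (simp add: dd) (simp add: diff_def algebra_simps)
      ultimately have "dt {0..T} ?u x t + k1 * dx ?u x t + ((a / b) * dt {0..T} ?u x t + k2 * ((a / b) * dx ?u x t))
          = (c1 + c2) * ?w x t" by simp
      then have "dt {0..T} ?u x t + (b * k1 + a * k2) / (a + b) * dx ?u x t = b * (c1 + c2) / (a + b) * ?w x t"
        using ab by (simp add: field_simps)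
      then show ?thesis using True by (simp add: f_def k_def M_def UNIV_bool)
    next
      case False
      have "dt {0..T} ?w x t + k3 * dx ?w x t = a3 * ?u x t + b3 * ?v x t + c3 * ?w x t"
        using w[OF t, of x] C t by (simp add: dd) (simp add: diff_def algebra_simps)
      moreover have "?v x t = (a / b) * ?u x t" using vu t by simp
      ultimately show ?thesis using False by (simp add: f_def k_def M_def UNIV_bool algebra_simps)
    qed
  qed
  from this[of True x] this[of False x] have "U x t = U' x t" "W x t = W' x t"
    by (simp_all add: f_def diff_def)
  moreover have "V x t = V' x t" using v[OF t, of x] ab \<open>U x t = U' x t\<close> by simp
  ultimately show ?thesis by simp
qed

text \<open>At level \<open>i\<close> the difference of the layer terms has \<open>P + Q = 0\<close>, so the regular terms have \<open>U + V = 0\<close> initially.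
  Together with \<open>a U = b V\<close> this gives zero initial values, and the transport system for the
  differences, read off from level \<open>i + 2\<close>, has only the zero solution.\<close>

theorem expansion_unique:
  assumes e: "asymptotic_expansion a b a3 b3 c1 c2 c3 k1 k2 k3 T u0 v0 w0 U V W P Q S"
    and e': "asymptotic_expansion a b a3 b3 c1 c2 c3 k1 k2 k3 T u0 v0 w0 U' V' W' P' Q' S'"
  shows "agree {0..T} (U i) (U' i) \<and> agree {0..T} (V i) (V' i) \<and> agree {0..T} (W i) (W' i) \<and>
    agree {0..} (P i) (P' i) \<and> agree {0..} (Q i) (Q' i) \<and> agree {0..} (S i) (S' i)"
proof (induction i rule: less_induct)
  case (less i)
  note r = e[unfolded asymptotic_expansion_def, THEN conjunct1, unfolded regular_terms_def, rule_format]
    and r' = e'[unfolded asymptotic_expansion_def, THEN conjunct1, unfolded regular_terms_def, rule_format]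
    and l = e[unfolded asymptotic_expansion_def, THEN conjunct2, THEN conjunct1, unfolded boundary_functions_def, rule_format]
    and l' = e'[unfolded asymptotic_expansion_def, THEN conjunct2, THEN conjunct1, unfolded boundary_functions_def, rule_format]
    and init = e[unfolded asymptotic_expansion_def, THEN conjunct2, THEN conjunct2, rule_format, of i]
    and init' = e'[unfolded asymptotic_expansion_def, THEN conjunct2, THEN conjunct2, rule_format, of i]
  have bU: "agree {0..T} (back2 U i) (back2 U' i)" and bW: "agree {0..T} (back2 W i) (back2 W' i)"
    and bP: "agree {0..} (back2 P i) (back2 P' i)" and bQ: "agree {0..} (back2 Q i) (back2 Q' i)"
    and bS: "agree {0..} (back2 S i) (back2 S' i)"
    by (rule agree_back2; use less in blast)+
  have step: "back2 F (i + 2) = F i" for F by (simp add: back2_def)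
  have S: "agree {0..} (S i) (S' i)"
  proof (intro allI ballI)
    fix x \<tau> :: real assume \<tau>: "\<tau> \<in> {0..}"
    have "((\<lambda>\<tau>. S i x \<tau> - S' i x \<tau>) has_real_derivative 0) (at \<tau> within {0..})" if t: "\<tau> \<in> {0..}" for \<tau>
    proof -
      have "(S i x has_real_derivative dt {0..} (S i) x \<tau>) (at \<tau> within {0..})"
        "(S' i x has_real_derivative dt {0..} (S' i) x \<tau>) (at \<tau> within {0..})"
        using C1D(1) l[of i] l'[of i] t unfolding partials_def by blast+
      moreover have "dt {0..} (S i) x \<tau> = dt {0..} (S' i) x \<tau>"
        using l[of i] l'[of i] t agree_derivs[OF bP t, of x] agree_derivs[OF bQ t, of x] agree_derivs[OF bS t, of x]
        by (metis add_right_cancel)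
      ultimately show ?thesis using DERIV_diff by fastforce
    qed
    moreover have "((\<lambda>\<tau>. S i x \<tau> - S' i x \<tau>) \<longlongrightarrow> 0) at_top"
      using tendsto_diff[of "S i x" 0 at_top "S' i x" 0] l[of i] l'[of i] by simp
    ultimately show "S i x \<tau> = S' i x \<tau>"
      using zero_derivative_half_line(2)[of "\<lambda>\<tau>. S i x \<tau> - S' i x \<tau>" \<tau>] \<tau> by simp
  qed
  define f where "f x \<tau> = - k1 * dx (back2 P i) x \<tau> + c1 * back2 S i x \<tau>" for x \<tau>
  define g where "g x \<tau> = - k2 * dx (back2 Q i) x \<tau> + c2 * back2 S i x \<tau>" for x \<tau>
  have pq: "dt {0..} (P i) x \<tau> = - a * P i x \<tau> + b * Q i x \<tau> + f x \<tau>"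
     "dt {0..} (Q i) x \<tau> = a * P i x \<tau> - b * Q i x \<tau> + g x \<tau>"
     "dt {0..} (P' i) x \<tau> = - a * P' i x \<tau> + b * Q' i x \<tau> + f x \<tau>"
     "dt {0..} (Q' i) x \<tau> = a * P' i x \<tau> - b * Q' i x \<tau> + g x \<tau>" if t: "\<tau> \<in> {0..}" for x \<tau>
  proof -
    note E = l[of i, THEN conjunct2, THEN conjunct2, THEN conjunct2, THEN conjunct1, rule_format, OF t, of x]
    note E' = l'[of i, THEN conjunct2, THEN conjunct2, THEN conjunct2, THEN conjunct1, rule_format, OF t, of x]
    note B = agree_derivs[OF bP t, of x] agree_derivs[OF bQ t, of x] agree_derivs[OF bS t, of x]
    show "dt {0..} (P i) x \<tau> = - a * P i x \<tau> + b * Q i x \<tau> + f x \<tau>"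
     "dt {0..} (Q i) x \<tau> = a * P i x \<tau> - b * Q i x \<tau> + g x \<tau>"
      using E by (simp_all add: f_def g_def)
    show "dt {0..} (P' i) x \<tau> = - a * P' i x \<tau> + b * Q' i x \<tau> + f x \<tau>"
     "dt {0..} (Q' i) x \<tau> = a * P' i x \<tau> - b * Q' i x \<tau> + g x \<tau>"
      using E' B by (simp_all add: f_def g_def)
  qed
  have CP: "C1 {0..} (P i)" "C1 {0..} (Q i)" "C1 {0..} (P' i)" "C1 {0..} (Q' i)" using l[of i] l'[of i] by blast+
  have lim: "(P i x \<longlongrightarrow> 0) at_top" "(Q i x \<longlongrightarrow> 0) at_top" "(P' i x \<longlongrightarrow> 0) at_top" "(Q' i x \<longlongrightarrow> 0) at_top" for x
    using l[of i] l'[of i] by blast+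
  note PQ = layer_unique[OF ab CP lim pq]
  have R: "U i x t = U' i x t \<and> V i x t = V' i x t \<and> W i x t = W' i x t" if t: "t \<in> {0..T}" for x t
  proof (rule regular_unique[where U = "U i" and V = "V i" and W = "W i"
        and U' = "U' i" and V' = "V' i" and W' = "W' i", OF _ _ _ _ _ _ _ _ _ _ _ _ _ t])
    show "C1 {0..T} (U i)" "C1 {0..T} (V i)" "C1 {0..T} (W i)"
      "C1 {0..T} (U' i)" "C1 {0..T} (V' i)" "C1 {0..T} (W' i)" using r[of i] r'[of i] by blast+
    show "U i x 0 + V i x 0 = U' i x 0 + V' i x 0" for x using init[of x] init'[of x] PQ(1)[of x] by simp
    show "W i x 0 = W' i x 0" for x
    proof -
      have "S i x 0 = S' i x 0" using S by simp
      then show ?thesis using init[of x] init'[of x] by simp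
    qed
    fix x t assume t: "t \<in> {0..T}"
    note E = r[of i, THEN conjunct2, THEN conjunct2, THEN conjunct2, rule_format, OF t, of x]
      r'[of i, THEN conjunct2, THEN conjunct2, THEN conjunct2, rule_format, OF t, of x]
    note E2 = r[of "i + 2", THEN conjunct2, THEN conjunct2, THEN conjunct2, rule_format, OF t, of x, unfolded step]
      r'[of "i + 2", THEN conjunct2, THEN conjunct2, THEN conjunct2, rule_format, OF t, of x, unfolded step]
    show "- a * U i x t + b * V i x t = - a * U' i x t + b * V' i x t"
      using E agree_derivs[OF bU t, of x] agree_derivs[OF bW t, of x] by simp
    show "dt {0..T} (W i) x t + k3 * dx (W i) x t = a3 * U i x t + b3 * V i x t + c3 * W i x t"
     "dt {0..T} (W' i) x t + k3 * dx (W' i) x t = a3 * U' i x t + b3 * V' i x t + c3 * W' i x t"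
      using E by blast+
    show "dt {0..T} (U i) x t + k1 * dx (U i) x t + (dt {0..T} (V i) x t + k2 * dx (V i) x t) = (c1 + c2) * W i x t"
     "dt {0..T} (U' i) x t + k1 * dx (U' i) x t + (dt {0..T} (V' i) x t + k2 * dx (V' i) x t) = (c1 + c2) * W' i x t"
      using E2 by (simp_all add: algebra_simps)
  qed
  have "P i x 0 = P' i x 0" for x
  proof -
    have "U i x 0 = U' i x 0" using R[of 0 x] T by simp
    then show ?thesis using init[of x] init'[of x] by simp
  qed
  then have "agree {0..} (P i) (P' i)" "agree {0..} (Q i) (Q' i)" using PQ(2) by blast+
  then show ?case using R S by blast
qed

end

section \<open>The residual\<close>

text \<open>An arbitrary expansion agrees with the constructed one only for \<open>\<tau> \<ge> 0\<close>.\<close>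

definition layer_like :: "real \<Rightarrow> (real \<Rightarrow> real \<Rightarrow> real) \<Rightarrow> bool" where
  "layer_like \<mu> f \<longleftrightarrow> (\<exists>g. layer \<mu> g \<and> agree {0..} f g)"

lemma layer_like_lin:
  assumes "layer_like \<mu> f" "layer_like \<mu> g"
  shows "layer_like \<mu> (\<lambda>x t. c * f x t + d * g x t)"
proof -
  obtain f' g' where "layer \<mu> f'" "agree {0..} f f'" "layer \<mu> g'" "agree {0..} g g'"
    using assms unfolding layer_like_def by blast
  then show ?thesis unfolding layer_like_def
    by (intro exI[of _ "\<lambda>x t. c * f' x t + d * g' x t"]) (auto intro: layer_lin)
qed

lemma layer_like_dx:
  assumes "layer_like \<mu> f"
  shows "layer_like \<mu> (dx f)"
proof -
  obtain g where g: "layer \<mu> g" "agree {0..} f g" using assms unfolding layer_like_def by blast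
  obtain h where h: "layer \<mu> h" "\<forall>x. \<forall>\<tau>\<in>{0..}. dx g x \<tau> = h x \<tau>" using layerD(3)[OF g(1)] by blast
  have "agree {0..} (dx f) h" using h(2) agree_derivs(2)[OF g(2)] by simp
  then show ?thesis using h(1) unfolding layer_like_def by blast
qed

lemma layer_like_bound:
  assumes "0 < \<mu>" "layer_like \<mu> f"
  shows "\<exists>C. \<forall>x. \<forall>\<tau>\<in>{0..}. \<bar>f x \<tau>\<bar> \<le> C * exp (- (\<mu> / 2) * \<tau>)"
  using assms layer_bound[OF assms(1)] unfolding layer_like_def by metis

lemma layer_like_back2: "(\<And>i. layer_like \<mu> (F i)) \<Longrightarrow> layer_like \<mu> (back2 F i)"
  using layer_zero[of \<mu>] unfolding back2_def layer_like_def by (cases "i < 2") auto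

lemma strip_smooth_back2: "(\<And>i. strip_smooth T (F i)) \<Longrightarrow> strip_smooth T (back2 F i)"
  unfolding back2_def using strip_smooth_const[OF bounded_smooth_zero] by auto

lemma strip_smooth_bound: "strip_smooth T f \<Longrightarrow> \<exists>C. \<forall>x. \<forall>t\<in>{0..T}. \<bar>f x t\<bar> \<le> C"
  by (erule strip_smooth.cases) blast

lemma zero_derivs: "perfect I \<Longrightarrow> t \<in> I \<Longrightarrow> dx (\<lambda>x t. 0) x t = 0 \<and> dt I (\<lambda>x t. 0) x t = 0"
proof -
  assume "perfect I" "t \<in> I"
  moreover have "partials I (\<lambda>x t. 0) (\<lambda>x t. 0) (\<lambda>x t. 0)" by (simp add: partials_def)
  ultimately show ?thesis using partials_dx partials_dt by blast
qed

text \<open>With \<open>back2 F i\<close> the term \<open>F (i - 2)\<close>, all but the last two terms cancel.\<close>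

lemma telescope:
  fixes e :: real
  shows "(\<Sum>i=0..N. e ^ i * (e\<^sup>2 * F i x t - back2 F i x t))
     = e ^ (N + 1) * (back2 F (N + 1) x t + e * back2 F (N + 2) x t)"
proof (induction N)
  case 0
  then show ?case by (simp add: back2_def power2_eq_square)
next
  case (Suc N)
  have "back2 F (N + 2) = F N" "back2 F (Suc N + 1) = F N" "back2 F (Suc N + 2) = F (Suc N)"
    by (simp_all add: back2_def numeral_2_eq_2)
  then show ?case using Suc by (simp add: algebra_simps power2_eq_square back2_def)
qed

lemma sum_combination:
  fixes e :: real
  shows "c1 * ((\<Sum>i=0..N. e ^ i * A i) + c2 * (\<Sum>i=0..N. e ^ i * B i)) + c3 * (\<Sum>i=0..N. e ^ i * C i)
      + c4 * (\<Sum>i=0..N. e ^ i * D i) + c5 * (\<Sum>i=0..N. e ^ i * E i)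
    = (\<Sum>i=0..N. e ^ i * (c1 * (A i + c2 * B i) + c3 * C i + c4 * D i + c5 * E i))"
  by (induction N) (auto simp: algebra_simps)

lemma C1_rescale:
  assumes "C1 {0..} f" "c > 0" "0 < T"
  shows "partials {0..T} (\<lambda>x t. f x (t / c)) (\<lambda>x t. dx f x (t / c)) (\<lambda>x t. dt {0..} f x (t / c) / c)"
    and "cont {0..T} (\<lambda>x t. f x (t / c))" "cont {0..T} (\<lambda>x t. dx f x (t / c))"
      "cont {0..T} (\<lambda>x t. dt {0..} f x (t / c) / c)"
proof -
  note C = C1D[OF assms(1)]
  show "partials {0..T} (\<lambda>x t. f x (t / c)) (\<lambda>x t. dx f x (t / c)) (\<lambda>x t. dt {0..} f x (t / c) / c)"
    unfolding partials_def
  proof (intro allI ballI conjI)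
    fix x t assume t: "t \<in> {0..T}"
    then have tc: "t / c \<in> {0..}" using assms by simp
    show "((\<lambda>y. f y (t / c)) has_real_derivative dx f x (t / c)) (at x)"
      using C(1) tc unfolding partials_def by blast
    have "(f x has_real_derivative dt {0..} f x (t / c)) (at (t / c) within {0..})"
      using C(1) tc unfolding partials_def by blast
    then have 1: "(f x has_real_derivative dt {0..} f x (t / c)) (at (t / c) within (\<lambda>t. t / c) ` {0..T})"
      by (rule DERIV_subset) (use assms in auto)
    have 2: "((\<lambda>t. t / c) has_real_derivative 1 / c) (at t within {0..T})"
      using assms by (auto intro!: derivative_eq_intros)
    show "((\<lambda>t. f x (t / c)) has_real_derivative dt {0..} f x (t / c) / c) (at t within {0..T})"
      using DERIV_image_chain[OF 1 2] by (simp add: o_def)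
  qed
  have *: "cont {0..T} (\<lambda>x t. g x (t / c))" if "cont {0..} g" for g
    unfolding case_prod_beta by (rule cont_comp[OF that]) (use assms in \<open>auto intro!: continuous_intros\<close>)
  show "cont {0..T} (\<lambda>x t. f x (t / c))" "cont {0..T} (\<lambda>x t. dx f x (t / c))" by (rule *, rule C)+
  show "cont {0..T} (\<lambda>x t. dt {0..} f x (t / c) / c)"
    using *[OF C(4)] assms unfolding case_prod_beta by (intro continuous_intros) auto
qed

lemma partial_sum_C1:
  fixes N :: nat
  assumes U: "\<And>i. C1 {0..T} (U i)" and P: "\<And>i. C1 {0..} (P i)" and "e > 0" "0 < T"
  defines "X \<equiv> \<lambda>x t. \<Sum>i=0..N. e ^ i * (U i x t + P i x (t / e\<^sup>2))"
  shows "C1 {0..T} X"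
    "t \<in> {0..T} \<Longrightarrow> dx X x t = (\<Sum>i=0..N. e ^ i * (dx (U i) x t + dx (P i) x (t / e\<^sup>2)))"
    "t \<in> {0..T} \<Longrightarrow> dt {0..T} X x t = (\<Sum>i=0..N. e ^ i * (dt {0..T} (U i) x t + dt {0..} (P i) x (t / e\<^sup>2) / e\<^sup>2))"
proof -
  have e2: "e\<^sup>2 > 0" using assms by simp
  note I = perfect_Icc[OF \<open>0 < T\<close>]
  note CP = C1_rescale[OF P e2 \<open>0 < T\<close>] and CU = C1D[OF U]
  have p: "partials {0..T} X (\<lambda>x t. \<Sum>i=0..N. e ^ i * (dx (U i) x t + dx (P i) x (t / e\<^sup>2)))
     (\<lambda>x t. \<Sum>i=0..N. e ^ i * (dt {0..T} (U i) x t + dt {0..} (P i) x (t / e\<^sup>2) / e\<^sup>2))"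
    unfolding partials_def X_def
    by (intro allI ballI conjI DERIV_sum DERIV_cmult DERIV_add)
       (use CP(1) CU(1) in \<open>auto simp: partials_def\<close>)
  show "t \<in> {0..T} \<Longrightarrow> dx X x t = (\<Sum>i=0..N. e ^ i * (dx (U i) x t + dx (P i) x (t / e\<^sup>2)))"
    by (rule partials_dx[OF p])
  show "t \<in> {0..T} \<Longrightarrow> dt {0..T} X x t = (\<Sum>i=0..N. e ^ i * (dt {0..T} (U i) x t + dt {0..} (P i) x (t / e\<^sup>2) / e\<^sup>2))"
    by (rule partials_dt[OF I p])
  show "C1 {0..T} X"
  proof (rule C1I[OF I p])
    show "cont {0..T} X" using CP(2) CU(2) unfolding X_def case_prod_beta
      by (intro continuous_on_sum continuous_on_mult continuous_on_add continuous_on_const) auto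
    show "cont {0..T} (\<lambda>x t. \<Sum>i=0..N. e ^ i * (dx (U i) x t + dx (P i) x (t / e\<^sup>2)))"
      using CP(3) CU(3) unfolding case_prod_beta
      by (intro continuous_on_sum continuous_on_mult continuous_on_add continuous_on_const) auto
    show "cont {0..T} (\<lambda>x t. \<Sum>i=0..N. e ^ i * (dt {0..T} (U i) x t + dt {0..} (P i) x (t / e\<^sup>2) / e\<^sup>2))"
      using CP(4) CU(4) unfolding case_prod_beta
      by (intro continuous_on_sum continuous_on_mult continuous_on_add continuous_on_const) auto
  qed
qed

lemma uniform_OI:
  assumes "\<And>x t e. 0 < e \<Longrightarrow> e < 1 \<Longrightarrow> t \<in> {0..T} \<Longrightarrow> \<bar>r x t e\<bar> \<le> C"
  shows "uniform_O T m (\<lambda>x t e. e ^ m * r x t e)"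
  unfolding uniform_O_def
proof (intro exI)
  have "\<forall>\<^sub>F e in at_right (0::real). e \<in> {0<..<1}" by (rule eventually_at_right_real) simp
  then show "\<forall>\<^sub>F e in at_right 0. \<forall>x. \<forall>t\<in>{0..T}. \<bar>e ^ m * r x t e\<bar> \<le> C * e ^ m"
  proof eventually_elim
    case (elim e)
    then show ?case using assms[of e] by (auto simp: abs_mult mult.commute intro!: mult_right_mono)
  qed
qed

lemma abs_add_scaled_le:
  fixes p q e :: real
  assumes "\<bar>p\<bar> \<le> A" "\<bar>q\<bar> \<le> B" "0 < e" "e < 1"
  shows "\<bar>p + e * q\<bar> \<le> A + B"
proof -
  have "\<bar>e * q\<bar> \<le> \<bar>q\<bar>" using assms(3,4) by (simp add: abs_mult mult_left_le_one_le)
  then show ?thesis using assms by linarith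
qed

context two_time_system
begin

lemma expansion_smooth:
  assumes e: "asymptotic_expansion a b a3 b3 c1 c2 c3 k1 k2 k3 T u0 v0 w0 U V W P Q S"
    and d: "bounded_smooth u0" "bounded_smooth v0" "bounded_smooth w0"
  shows "strip_smooth T (U i)" "strip_smooth T (V i)" "strip_smooth T (W i)"
    "layer_like (a + b) (P i)" "layer_like (a + b) (Q i)" "layer_like (a + b) (S i)"
proof -
  obtain U' V' W' P' Q' S' where e': "asymptotic_expansion a b a3 b3 c1 c2 c3 k1 k2 k3 T u0 v0 w0 U' V' W' P' Q' S'"
    and s: "\<And>i. strip_smooth T (U' i)" "\<And>i. strip_smooth T (V' i)" "\<And>i. strip_smooth T (W' i)"
    "\<And>i. layer (a + b) (P' i)" "\<And>i. layer (a + b) (Q' i)" "\<And>i. layer (a + b) (S' i)"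
    using expansion_exists[OF d] by metis
  note eq = expansion_unique[OF e e', of i]
  show "strip_smooth T (U i)" by (rule strip_smooth_cong[OF s(1)[of i]]) (use eq in blast)
  show "strip_smooth T (V i)" by (rule strip_smooth_cong[OF s(2)[of i]]) (use eq in blast)
  show "strip_smooth T (W i)" by (rule strip_smooth_cong[OF s(3)[of i]]) (use eq in blast)
  show "layer_like (a + b) (P i)" "layer_like (a + b) (Q i)" "layer_like (a + b) (S i)"
    unfolding layer_like_def using eq s by blast+
qed

lemma uniform_O_tail:
  assumes E: "\<And>i. strip_smooth T (E i)" and L: "\<And>i. layer_like (a + b) (L i)"
  shows "uniform_O T m (\<lambda>x t e. e ^ m * - ((back2 E i x t + e * back2 E j x t)
     + (back2 L i x (t / e\<^sup>2) + e * back2 L j x (t / e\<^sup>2))))"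
proof -
  have \<mu>: "a + b > 0" using ab by simp
  obtain A B where A: "\<And>x t. t \<in> {0..T} \<Longrightarrow> \<bar>back2 E i x t\<bar> \<le> A" and B: "\<And>x t. t \<in> {0..T} \<Longrightarrow> \<bar>back2 E j x t\<bar> \<le> B"
    using strip_smooth_bound[OF strip_smooth_back2[where F = E, OF E]] by metis
  have "\<exists>C. \<forall>x. \<forall>\<tau>\<in>{0..}. \<bar>back2 L i x \<tau>\<bar> \<le> C" for i
  proof -
    obtain C where C: "\<And>x \<tau>. \<tau> \<in> {0..} \<Longrightarrow> \<bar>back2 L i x \<tau>\<bar> \<le> C * exp (- ((a + b) / 2) * \<tau>)"
      using layer_like_bound[OF \<mu> layer_like_back2[where F = L, OF L]] by metis
    have "\<bar>back2 L i x \<tau>\<bar> \<le> \<bar>C\<bar>" if t: "\<tau> \<in> {0..}" for x \<tau>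
    proof -
      have "C * exp (- ((a + b) / 2) * \<tau>) \<le> \<bar>C\<bar> * 1"
        using t \<mu> by (intro mult_mono) (auto simp: mult_nonneg_nonneg)
      then show ?thesis using C[OF t, of x] by simp
    qed
    then show ?thesis by blast
  qed
  then obtain C D where C: "\<And>x t. t \<in> {0..} \<Longrightarrow> \<bar>back2 L i x t\<bar> \<le> C" and D: "\<And>x t. t \<in> {0..} \<Longrightarrow> \<bar>back2 L j x t\<bar> \<le> D"
    by metis
  show ?thesis
  proof (rule uniform_OI)
    fix x t e :: real assume e: "0 < e" "e < 1" and t: "t \<in> {0..T}"
    have t2: "t / e\<^sup>2 \<in> {0..}" using t by simp
    show "\<bar>- ((back2 E i x t + e * back2 E j x t) + (back2 L i x (t / e\<^sup>2) + e * back2 L j x (t / e\<^sup>2)))\<bar> \<le> (A + B) + (C + D)"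
      using abs_add_scaled_le[OF A[OF t, of x] B[OF t, of x] e] abs_add_scaled_le[OF C[OF t2, of x] D[OF t2, of x] e] by linarith
  qed
qed

text \<open>The exponential factor is the one that the residual problem splits off, so what remains is bounded.\<close>

lemma uniform_O_layer_tail:
  assumes L: "\<And>i. layer_like (a + b) (L i)"
  shows "uniform_O T m (\<lambda>x t e. e ^ m * (exp ((a + b) / 2 * (t / e\<^sup>2)) *
     (back2 L i x (t / e\<^sup>2) + e * back2 L j x (t / e\<^sup>2))))"
proof -
  have \<mu>: "a + b > 0" using ab by simp
  obtain C D where C: "\<And>x \<tau>. \<tau> \<in> {0..} \<Longrightarrow> \<bar>back2 L i x \<tau>\<bar> \<le> C * exp (- ((a + b) / 2) * \<tau>)"
     and D: "\<And>x \<tau>. \<tau> \<in> {0..} \<Longrightarrow> \<bar>back2 L j x \<tau>\<bar> \<le> D * exp (- ((a + b) / 2) * \<tau>)"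
    using layer_like_bound[OF \<mu> layer_like_back2[where F = L, OF L]] by metis
  show ?thesis
  proof (rule uniform_OI)
    fix x t e :: real assume e: "0 < e" "e < 1" and t: "t \<in> {0..T}"
    define \<tau> where "\<tau> = t / e\<^sup>2"
    have t2: "\<tau> \<in> {0..}" using t by (simp add: \<tau>_def)
    have "exp ((a + b) / 2 * \<tau>) * \<bar>back2 L i x \<tau> + e * back2 L j x \<tau>\<bar>
       \<le> exp ((a + b) / 2 * \<tau>) * (C * exp (- ((a + b) / 2) * \<tau>) + D * exp (- ((a + b) / 2) * \<tau>))"
      by (intro mult_left_mono abs_add_scaled_le C D t2 e) simp
    also have "\<dots> = C + D" by (simp add: exp_minus field_simps)
    finally show "\<bar>exp ((a + b) / 2 * (t / e\<^sup>2)) * (back2 L i x (t / e\<^sup>2) + e * back2 L j x (t / e\<^sup>2))\<bar> \<le> C + D"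
      by (simp add: \<tau>_def abs_mult)
  qed
qed

end

definition partial_sum where
  "partial_sum N F G e = (\<lambda>x t. \<Sum>i=0..N. e ^ i * (F i x t + G i x (t / e\<^sup>2)))"

context two_time_system
begin

text \<open>\<open>E1\<close>, \<open>E2\<close>, \<open>L1\<close>, \<open>L2\<close> are the terms of the fast equations that carry a factor \<open>\<epsilon>\<^sup>2\<close>, for the
  regular and the layer functions. The equations of level \<open>i + 2\<close> express \<open>E1 i\<close> and \<open>E2 i\<close> by the
  relaxation terms of that level, and \<open>L1 i\<close> and \<open>L2 i\<close> by these and the \<open>\<tau>\<close>-derivatives. \<open>G\<close> plays this role for the layer functions in the slow equation.\<close>

lemma residual_cauchy:
  fixes N :: nat
  assumes ex: "asymptotic_expansion a b a3 b3 c1 c2 c3 k1 k2 k3 T u0 v0 w0 U V W P Q S"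
    and sol: "cauchy_solution a b a3 b3 c1 c2 c3 k1 k2 k3 T e (\<lambda>x t. 0) (\<lambda>x t. 0) (\<lambda>x t. 0) u0 v0 w0 u v w"
    and e: "e > 0"
  defines "E1 \<equiv> \<lambda>i x t. dt {0..T} (U i) x t + k1 * dx (U i) x t - c1 * W i x t"
    and "E2 \<equiv> \<lambda>i x t. dt {0..T} (V i) x t + k2 * dx (V i) x t - c2 * W i x t"
    and "L1 \<equiv> \<lambda>i x t. k1 * dx (P i) x t - c1 * S i x t"
    and "L2 \<equiv> \<lambda>i x t. k2 * dx (Q i) x t - c2 * S i x t"
    and "G \<equiv> \<lambda>i x t. a3 * P i x t + b3 * Q i x t + c3 * S i x t - k3 * dx (S i) x t"
  shows "cauchy_solution a b a3 b3 c1 c2 c3 k1 k2 k3 T e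
     (\<lambda>x t. e ^ (N + 1) * - ((back2 E1 (N + 1) x t + e * back2 E1 (N + 2) x t)
        + (back2 L1 (N + 1) x (t / e\<^sup>2) + e * back2 L1 (N + 2) x (t / e\<^sup>2))))
     (\<lambda>x t. e ^ (N + 1) * - ((back2 E2 (N + 1) x t + e * back2 E2 (N + 2) x t)
        + (back2 L2 (N + 1) x (t / e\<^sup>2) + e * back2 L2 (N + 2) x (t / e\<^sup>2))))
     (\<lambda>x t. e ^ (N + 1) * (back2 G (N + 1) x (t / e\<^sup>2) + e * back2 G (N + 2) x (t / e\<^sup>2)) / e\<^sup>2)
     (\<lambda>x. 0) (\<lambda>x. 0) (\<lambda>x. 0)
     (\<lambda>x t. u x t - partial_sum N U P e x t) (\<lambda>x t. v x t - partial_sum N V Q e x t)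
     (\<lambda>x t. w x t - partial_sum N W S e x t)"
proof -
  note I = perfect_Icc[OF T]
  note r = ex[unfolded asymptotic_expansion_def, THEN conjunct1, unfolded regular_terms_def, rule_format]
    and l = ex[unfolded asymptotic_expansion_def, THEN conjunct2, THEN conjunct1, unfolded boundary_functions_def, rule_format]
    and init = ex[unfolded asymptotic_expansion_def, THEN conjunct2, THEN conjunct2, rule_format]
  have CU: "C1 {0..T} (U i)" "C1 {0..T} (V i)" "C1 {0..T} (W i)" for i using r[of i] by blast+
  have CP: "C1 {0..} (P i)" "C1 {0..} (Q i)" "C1 {0..} (S i)" for i using l[of i] by blast+
  have regular: "back2 E1 i x t = - a * U i x t + b * V i x t" "back2 E2 i x t = a * U i x t - b * V i x t"
     "dt {0..T} (W i) x t + k3 * dx (W i) x t = a3 * U i x t + b3 * V i x t + c3 * W i x t"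
    if t: "t \<in> {0..T}" for i x t
  proof -
    note R = r[of i, THEN conjunct2, THEN conjunct2, THEN conjunct2, rule_format, OF t, of x]
    show "dt {0..T} (W i) x t + k3 * dx (W i) x t = a3 * U i x t + b3 * V i x t + c3 * W i x t"
      using R by blast
    show "back2 E1 i x t = - a * U i x t + b * V i x t" "back2 E2 i x t = a * U i x t - b * V i x t"
      using conjunct1[OF R] R[THEN conjunct2, THEN conjunct1] zero_derivs[OF I t, of x]
      by (cases "i < 2"; simp add: back2_def E1_def E2_def)+
  qed
  have boundary: "dt {0..} (P i) x t = - a * P i x t + b * Q i x t - back2 L1 i x t"
     "dt {0..} (Q i) x t = a * P i x t - b * Q i x t - back2 L2 i x t"
     "dt {0..} (S i) x t = back2 G i x t"
    if t: "t \<in> {0..}" for i x t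
  proof -
    note R = l[of i, THEN conjunct2, THEN conjunct2, THEN conjunct2, THEN conjunct1, rule_format, OF t, of x]
    show "dt {0..} (P i) x t = - a * P i x t + b * Q i x t - back2 L1 i x t"
      "dt {0..} (Q i) x t = a * P i x t - b * Q i x t - back2 L2 i x t"
      "dt {0..} (S i) x t = back2 G i x t"
      using conjunct1[OF R] R[THEN conjunct2, THEN conjunct1] R[THEN conjunct2, THEN conjunct2]
        zero_derivs[OF perfect_Ici t, of x]
      by (cases "i < 2"; simp add: back2_def L1_def L2_def G_def)+
  qed
  let ?X = "partial_sum N U P e" and ?Y = "partial_sum N V Q e" and ?Z = "partial_sum N W S e"
  note X = partial_sum_C1[where N = N and U = U and P = P, OF CU(1) CP(1) e T, folded partial_sum_def]
    and Y = partial_sum_C1[where N = N and U = V and P = Q, OF CU(2) CP(2) e T, folded partial_sum_def]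
    and Z = partial_sum_C1[where N = N and U = W and P = S, OF CU(3) CP(3) e T, folded partial_sum_def]
  note sol = sol[unfolded cauchy_solution_def]
  have Cu: "C1 {0..T} u" "C1 {0..T} v" "C1 {0..T} w" using sol by blast+
  have minus: "C1 {0..T} (\<lambda>x t. f x t - g x t)"
     "t \<in> {0..T} \<Longrightarrow> dt {0..T} (\<lambda>x t. f x t - g x t) x t = dt {0..T} f x t - dt {0..T} g x t"
     "t \<in> {0..T} \<Longrightarrow> dx (\<lambda>x t. f x t - g x t) x t = dx f x t - dx g x t"
    if "C1 {0..T} f" "C1 {0..T} g" for f g x t
    using C1_lin[OF I that, of 1 "- 1"] derivs_lin[OF I C1D(1)[OF that(1)] C1D(1)[OF that(2)], of t 1 "- 1" x]
    by simp_all
  have e2: "e\<^sup>2 \<noteq> 0" using e by simp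
  have sums: "e\<^sup>2 * (dt {0..T} ?X x t + k1 * dx ?X x t) + a * ?X x t + (- b) * ?Y x t + (- (e\<^sup>2 * c1)) * ?Z x t
       = e ^ (N + 1) * ((back2 E1 (N + 1) x t + e * back2 E1 (N + 2) x t)
        + (back2 L1 (N + 1) x (t / e\<^sup>2) + e * back2 L1 (N + 2) x (t / e\<^sup>2)))"
     "e\<^sup>2 * (dt {0..T} ?Y x t + k2 * dx ?Y x t) + (- a) * ?X x t + b * ?Y x t + (- (e\<^sup>2 * c2)) * ?Z x t
       = e ^ (N + 1) * ((back2 E2 (N + 1) x t + e * back2 E2 (N + 2) x t)
        + (back2 L2 (N + 1) x (t / e\<^sup>2) + e * back2 L2 (N + 2) x (t / e\<^sup>2)))"
     "1 * (dt {0..T} ?Z x t + k3 * dx ?Z x t) + (- a3) * ?X x t + (- b3) * ?Y x t + (- c3) * ?Z x t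
       = - (e ^ (N + 1) * (back2 G (N + 1) x (t / e\<^sup>2) + e * back2 G (N + 2) x (t / e\<^sup>2)) / e\<^sup>2)"
    if t: "t \<in> {0..T}" for x t
  proof -
    define \<tau> where "\<tau> = t / e\<^sup>2"
    have \<tau>: "\<tau> \<in> {0..}" using t by (simp add: \<tau>_def)
    have c: "e\<^sup>2 * ((p + q / e\<^sup>2) + r) = e\<^sup>2 * (p + r) + q" for p q r :: real
      using e2 by (simp add: distrib_left)
    have E: "E1 i x t = dt {0..T} (U i) x t + k1 * dx (U i) x t - c1 * W i x t"
      "E2 i x t = dt {0..T} (V i) x t + k2 * dx (V i) x t - c2 * W i x t"
      "L1 i x \<tau> = k1 * dx (P i) x \<tau> - c1 * S i x \<tau>" "L2 i x \<tau> = k2 * dx (Q i) x \<tau> - c2 * S i x \<tau>" for i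
      by (simp_all add: E1_def E2_def L1_def L2_def)
    have 1: "e\<^sup>2 * ((dt {0..T} (U i) x t + dt {0..} (P i) x \<tau> / e\<^sup>2) + k1 * (dx (U i) x t + dx (P i) x \<tau>))
        + a * (U i x t + P i x \<tau>) + (- b) * (V i x t + Q i x \<tau>) + (- (e\<^sup>2 * c1)) * (W i x t + S i x \<tau>)
       = (e\<^sup>2 * E1 i x t - back2 E1 i x t) + (e\<^sup>2 * L1 i x \<tau> - back2 L1 i x \<tau>)" for i
      unfolding c regular(1)[OF t] boundary(1)[OF \<tau>] E by (simp add: algebra_simps)
    have 2: "e\<^sup>2 * ((dt {0..T} (V i) x t + dt {0..} (Q i) x \<tau> / e\<^sup>2) + k2 * (dx (V i) x t + dx (Q i) x \<tau>))
        + (- a) * (U i x t + P i x \<tau>) + b * (V i x t + Q i x \<tau>) + (- (e\<^sup>2 * c2)) * (W i x t + S i x \<tau>)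
       = (e\<^sup>2 * E2 i x t - back2 E2 i x t) + (e\<^sup>2 * L2 i x \<tau> - back2 L2 i x \<tau>)" for i
      unfolding c regular(2)[OF t] boundary(2)[OF \<tau>] E by (simp add: algebra_simps)
    have 3: "1 * ((dt {0..T} (W i) x t + dt {0..} (S i) x \<tau> / e\<^sup>2) + k3 * (dx (W i) x t + dx (S i) x \<tau>))
        + (- a3) * (U i x t + P i x \<tau>) + (- b3) * (V i x t + Q i x \<tau>) + (- c3) * (W i x t + S i x \<tau>)
       = (- 1 / e\<^sup>2) * (e\<^sup>2 * G i x \<tau> - back2 G i x \<tau>)" for i
    proof -
      have "(- 1 / e\<^sup>2) * (e\<^sup>2 * G i x \<tau> - back2 G i x \<tau>) = back2 G i x \<tau> / e\<^sup>2 - G i x \<tau>"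
        using e2 by (simp add: field_simps)
      then show ?thesis
        using regular(3)[OF t, of i x] boundary(3)[OF \<tau>, of i x] by (simp add: G_def algebra_simps)
    qed
    show "e\<^sup>2 * (dt {0..T} ?X x t + k1 * dx ?X x t) + a * ?X x t + (- b) * ?Y x t + (- (e\<^sup>2 * c1)) * ?Z x t
       = e ^ (N + 1) * ((back2 E1 (N + 1) x t + e * back2 E1 (N + 2) x t)
        + (back2 L1 (N + 1) x (t / e\<^sup>2) + e * back2 L1 (N + 2) x (t / e\<^sup>2)))"
      unfolding X(2,3)[OF t] unfolding partial_sum_def sum_combination \<tau>_def[symmetric] 1
      by (simp only: distrib_left sum.distrib telescope)
    show "e\<^sup>2 * (dt {0..T} ?Y x t + k2 * dx ?Y x t) + (- a) * ?X x t + b * ?Y x t + (- (e\<^sup>2 * c2)) * ?Z x t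
       = e ^ (N + 1) * ((back2 E2 (N + 1) x t + e * back2 E2 (N + 2) x t)
        + (back2 L2 (N + 1) x (t / e\<^sup>2) + e * back2 L2 (N + 2) x (t / e\<^sup>2)))"
      unfolding Y(2,3)[OF t] unfolding partial_sum_def sum_combination \<tau>_def[symmetric] 2
      by (simp only: distrib_left sum.distrib telescope)
    have "(\<Sum>i=0..N. e ^ i * ((- 1 / e\<^sup>2) * (e\<^sup>2 * G i x \<tau> - back2 G i x \<tau>)))
       = (- 1 / e\<^sup>2) * (\<Sum>i=0..N. e ^ i * (e\<^sup>2 * G i x \<tau> - back2 G i x \<tau>))"
      by (simp only: sum_distrib_left mult.left_commute)
    then show "1 * (dt {0..T} ?Z x t + k3 * dx ?Z x t) + (- a3) * ?X x t + (- b3) * ?Y x t + (- c3) * ?Z x t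
       = - (e ^ (N + 1) * (back2 G (N + 1) x (t / e\<^sup>2) + e * back2 G (N + 2) x (t / e\<^sup>2)) / e\<^sup>2)"
      unfolding Z(2,3)[OF t] unfolding partial_sum_def sum_combination \<tau>_def[symmetric] 3 telescope by simp
  qed
  have init_sum: "partial_sum N F H e x 0 = d"
    if "\<And>i. F i x 0 + H i x 0 = (if i = 0 then d else 0)" for F H :: "nat \<Rightarrow> real \<Rightarrow> real \<Rightarrow> real" and x d
  proof -
    have "partial_sum N F H e x 0 = (\<Sum>i=0..N. if i = 0 then d else 0)"
      unfolding partial_sum_def by (rule sum.cong) (simp_all add: that)
    then show ?thesis by simp
  qed
  show ?thesis
    unfolding cauchy_solution_def
  proof (intro conjI allI ballI)
    fix x t assume t: "t \<in> {0..T}"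
    note sol_eq = sol[THEN conjunct2, THEN conjunct2, THEN conjunct2, THEN conjunct1, rule_format, OF t, of x]
    note D = minus(2,3)[OF Cu(1) X(1) t, of x] minus(2,3)[OF Cu(2) Y(1) t, of x] minus(2,3)[OF Cu(3) Z(1) t, of x]
    show "e\<^sup>2 * (dt {0..T} (\<lambda>x t. u x t - ?X x t) x t + k1 * dx (\<lambda>x t. u x t - ?X x t) x t) =
      - a * (u x t - ?X x t) + b * (v x t - ?Y x t) + e\<^sup>2 * c1 * (w x t - ?Z x t)
      + e ^ (N + 1) * - ((back2 E1 (N + 1) x t + e * back2 E1 (N + 2) x t)
        + (back2 L1 (N + 1) x (t / e\<^sup>2) + e * back2 L1 (N + 2) x (t / e\<^sup>2)))"
      unfolding D mult_minus_right sums(1)[OF t, of x, symmetric] using sol_eq by (simp add: algebra_simps)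
    show "e\<^sup>2 * (dt {0..T} (\<lambda>x t. v x t - ?Y x t) x t + k2 * dx (\<lambda>x t. v x t - ?Y x t) x t) =
      a * (u x t - ?X x t) - b * (v x t - ?Y x t) + e\<^sup>2 * c2 * (w x t - ?Z x t)
      + e ^ (N + 1) * - ((back2 E2 (N + 1) x t + e * back2 E2 (N + 2) x t)
        + (back2 L2 (N + 1) x (t / e\<^sup>2) + e * back2 L2 (N + 2) x (t / e\<^sup>2)))"
      unfolding D mult_minus_right sums(2)[OF t, of x, symmetric] using sol_eq by (simp add: algebra_simps)
    show "dt {0..T} (\<lambda>x t. w x t - ?Z x t) x t + k3 * dx (\<lambda>x t. w x t - ?Z x t) x t =
      a3 * (u x t - ?X x t) + b3 * (v x t - ?Y x t) + c3 * (w x t - ?Z x t)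
      + e ^ (N + 1) * (back2 G (N + 1) x (t / e\<^sup>2) + e * back2 G (N + 2) x (t / e\<^sup>2)) / e\<^sup>2"
      unfolding D using sums(3)[OF t, of x] sol_eq by (simp add: algebra_simps)
  next
    fix x
    have 0: "u x 0 = u0 x" "v x 0 = v0 x" "w x 0 = w0 x" using sol by blast+
    show "u x 0 - ?X x 0 = 0" "v x 0 - ?Y x 0 = 0" "w x 0 - ?Z x 0 = 0"
      using init_sum[where F = U and H = P and x = x and d = "u0 x"] init_sum[where F = V and H = Q and x = x and d = "v0 x"]
        init_sum[where F = W and H = S and x = x and d = "w0 x"] init 0 by simp_all
  qed (rule minus Cu X Y Z)+
qed

lemma residual_problem_partial_sums:
  fixes N :: nat
  assumes ex: "asymptotic_expansion a b a3 b3 c1 c2 c3 k1 k2 k3 T u0 v0 w0 U V W P Q S"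
    and d: "bounded_smooth u0" "bounded_smooth v0" "bounded_smooth w0"
    and sol: "\<forall>\<^sub>F e in at_right 0. cauchy_solution a b a3 b3 c1 c2 c3 k1 k2 k3 T e
      (\<lambda>x t. 0) (\<lambda>x t. 0) (\<lambda>x t. 0) u0 v0 w0 (\<lambda>x t. u x t e) (\<lambda>x t. v x t e) (\<lambda>x t. w x t e)"
  shows "residual_problem a b a3 b3 c1 c2 c3 k1 k2 k3 T N (\<lambda>x t e. u x t e - partial_sum N U P e x t)
    (\<lambda>x t e. v x t e - partial_sum N V Q e x t) (\<lambda>x t e. w x t e - partial_sum N W S e x t)"
proof -
  note smooth = expansion_smooth[OF ex d]
  define E1 where "E1 = (\<lambda>i x t. dt {0..T} (U i) x t + k1 * dx (U i) x t - c1 * W i x t)"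
  define E2 where "E2 = (\<lambda>i x t. dt {0..T} (V i) x t + k2 * dx (V i) x t - c2 * W i x t)"
  define L1 where "L1 = (\<lambda>i x t. k1 * dx (P i) x t - c1 * S i x t)"
  define L2 where "L2 = (\<lambda>i x t. k2 * dx (Q i) x t - c2 * S i x t)"
  define G where "G = (\<lambda>i x t. a3 * P i x t + b3 * Q i x t + c3 * S i x t - k3 * dx (S i) x t)"
  have E: "strip_smooth T (E1 i)" "strip_smooth T (E2 i)" for i
  proof -
    have "strip_smooth T (\<lambda>x t. 1 * (1 * dt {0..T} (U i) x t + k1 * dx (U i) x t) + (- c1) * W i x t)"
      "strip_smooth T (\<lambda>x t. 1 * (1 * dt {0..T} (V i) x t + k2 * dx (V i) x t) + (- c2) * W i x t)"
      using strip_smooth_lin[OF strip_smooth_lin[OF strip_smoothD(3)[OF smooth(1) T] strip_smoothD(2)[OF smooth(1) T]] smooth(3)]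
        strip_smooth_lin[OF strip_smooth_lin[OF strip_smoothD(3)[OF smooth(2) T] strip_smoothD(2)[OF smooth(2) T]] smooth(3)]
      by blast+
    then show "strip_smooth T (E1 i)" "strip_smooth T (E2 i)" by (simp_all add: E1_def E2_def)
  qed
  have L: "layer_like (a + b) (L1 i)" "layer_like (a + b) (L2 i)" "layer_like (a + b) (G i)" for i
  proof -
    have "layer_like (a + b) (\<lambda>x t. k1 * dx (P i) x t + (- c1) * S i x t)"
      "layer_like (a + b) (\<lambda>x t. k2 * dx (Q i) x t + (- c2) * S i x t)"
      "layer_like (a + b) (\<lambda>x t. 1 * (a3 * P i x t + b3 * Q i x t) + 1 * (c3 * S i x t + (- k3) * dx (S i) x t))"
      by (rule layer_like_lin layer_like_dx[OF smooth(4)] layer_like_dx[OF smooth(5)]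
          layer_like_dx[OF smooth(6)] smooth(4) smooth(5) smooth(6))+
    then show "layer_like (a + b) (L1 i)" "layer_like (a + b) (L2 i)" "layer_like (a + b) (G i)"
      by (simp_all add: L1_def L2_def G_def algebra_simps)
  qed
  show ?thesis
    unfolding residual_problem_def
  proof (intro exI conjI)
    show "0 < (a + b) / 2" using ab by simp
    show "uniform_O T (N + 1) (\<lambda>x t e. e ^ (N + 1) * - ((back2 E1 (N + 1) x t + e * back2 E1 (N + 2) x t)
        + (back2 L1 (N + 1) x (t / e\<^sup>2) + e * back2 L1 (N + 2) x (t / e\<^sup>2))))"
      by (rule uniform_O_tail[OF E(1) L(1)])
    show "uniform_O T (N + 1) (\<lambda>x t e. e ^ (N + 1) * - ((back2 E2 (N + 1) x t + e * back2 E2 (N + 2) x t)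
        + (back2 L2 (N + 1) x (t / e\<^sup>2) + e * back2 L2 (N + 2) x (t / e\<^sup>2))))"
      by (rule uniform_O_tail[OF E(2) L(2)])
    show "uniform_O T (N + 1) (\<lambda>x t e. 0)" by (auto simp: uniform_O_def intro!: exI[of _ 0])
    show "uniform_O T (N + 1) (\<lambda>x t e. e ^ (N + 1) * (exp ((a + b) / 2 * (t / e\<^sup>2)) *
       (back2 G (N + 1) x (t / e\<^sup>2) + e * back2 G (N + 2) x (t / e\<^sup>2))))"
      by (rule uniform_O_layer_tail[OF L(3)])
    have *: "0 + exp (- ((a + b) / 2) * (t / e\<^sup>2)) / e\<^sup>2 * (e ^ (N + 1) * (exp ((a + b) / 2 * (t / e\<^sup>2)) * y))
       = e ^ (N + 1) * y / e\<^sup>2" for t e y :: real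
    proof -
      have "exp (- ((a + b) / 2) * (t / e\<^sup>2)) * exp ((a + b) / 2 * (t / e\<^sup>2)) = 1"
        by (simp add: exp_add[symmetric])
      then have "(exp (- ((a + b) / 2) * (t / e\<^sup>2)) * exp ((a + b) / 2 * (t / e\<^sup>2))) * (e ^ (N + 1) * y / e\<^sup>2)
        = e ^ (N + 1) * y / e\<^sup>2" by simp
      then show ?thesis by (simp only: add_0 times_divide_eq_left times_divide_eq_right mult_ac)
    qed
    show "\<forall>\<^sub>F e in at_right 0. cauchy_solution a b a3 b3 c1 c2 c3 k1 k2 k3 T e
     (\<lambda>x t. e ^ (N + 1) * - ((back2 E1 (N + 1) x t + e * back2 E1 (N + 2) x t)
        + (back2 L1 (N + 1) x (t / e\<^sup>2) + e * back2 L1 (N + 2) x (t / e\<^sup>2))))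
     (\<lambda>x t. e ^ (N + 1) * - ((back2 E2 (N + 1) x t + e * back2 E2 (N + 2) x t)
        + (back2 L2 (N + 1) x (t / e\<^sup>2) + e * back2 L2 (N + 2) x (t / e\<^sup>2))))
     (\<lambda>x t. 0 + exp (- ((a + b) / 2) * (t / e\<^sup>2)) / e\<^sup>2 * (e ^ (N + 1) * (exp ((a + b) / 2 * (t / e\<^sup>2)) *
       (back2 G (N + 1) x (t / e\<^sup>2) + e * back2 G (N + 2) x (t / e\<^sup>2)))))
     (\<lambda>x. 0) (\<lambda>x. 0) (\<lambda>x. 0)
     (\<lambda>x t. u x t e - partial_sum N U P e x t) (\<lambda>x t. v x t e - partial_sum N V Q e x t)
     (\<lambda>x t. w x t e - partial_sum N W S e x t)"
      using sol eventually_at_right_less[of 0]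
    proof eventually_elim
      case (elim e)
      show ?case unfolding * E1_def E2_def L1_def L2_def G_def by (rule residual_cauchy[OF ex elim])
    qed
  qed
qed

end

theorem mainTheorem1:
  fixes a b a3 b3 c1 c2 c3 k1 k2 k3 T :: real
    and u0 v0 w0 :: "real \<Rightarrow> real"
    and u v w :: "real \<Rightarrow> real \<Rightarrow> real \<Rightarrow> real"
    and N :: nat
  assumes "a > 0" and "b > 0" and "T > 0"
    and "admissible_datum u0" and "admissible_datum v0" and "admissible_datum w0"
    and "\<forall>\<^sub>F \<epsilon> in at_right 0.
           cauchy_solution a b a3 b3 c1 c2 c3 k1 k2 k3 T \<epsilon>
             (\<lambda>x t. 0) (\<lambda>x t. 0) (\<lambda>x t. 0) u0 v0 w0
             (\<lambda>x t. u x t \<epsilon>) (\<lambda>x t. v x t \<epsilon>) (\<lambda>x t. w x t \<epsilon>)"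
  shows "(\<exists>U V W P Q S.
            asymptotic_expansion a b a3 b3 c1 c2 c3 k1 k2 k3 T u0 v0 w0 U V W P Q S) \<and>
         (\<forall>U V W P Q S.
            asymptotic_expansion a b a3 b3 c1 c2 c3 k1 k2 k3 T u0 v0 w0 U V W P Q S \<longrightarrow>
            (\<exists>Ru Rv Rw.
               (\<forall>\<^sub>F \<epsilon> in at_right 0. \<forall>x. \<forall>t\<in>{0..T}.
                  u x t \<epsilon> = (\<Sum>i=0..N. \<epsilon> ^ i * (U i x t + P i x (t / \<epsilon>\<^sup>2))) + Ru x t \<epsilon> \<and>
                  v x t \<epsilon> = (\<Sum>i=0..N. \<epsilon> ^ i * (V i x t + Q i x (t / \<epsilon>\<^sup>2))) + Rv x t \<epsilon> \<and>
                  w x t \<epsilon> = (\<Sum>i=0..N. \<epsilon> ^ i * (W i x t + S i x (t / \<epsilon>\<^sup>2))) + Rw x t \<epsilon>) \<and>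
               residual_problem a b a3 b3 c1 c2 c3 k1 k2 k3 T N Ru Rv Rw))"
proof -
  interpret two_time_system a b a3 b3 c1 c2 c3 k1 k2 k3 T
    by unfold_locales fact+
  have d: "bounded_smooth u0" "bounded_smooth v0" "bounded_smooth w0" using assms(4-6) by (auto intro: admissible_bounded_smooth)
  show ?thesis
  proof (intro conjI allI impI)
    show "\<exists>U V W P Q S. asymptotic_expansion a b a3 b3 c1 c2 c3 k1 k2 k3 T u0 v0 w0 U V W P Q S"
      using expansion_exists[OF d] by metis
  next
    fix U V W P Q S
    assume ex: "asymptotic_expansion a b a3 b3 c1 c2 c3 k1 k2 k3 T u0 v0 w0 U V W P Q S"
    show "\<exists>Ru Rv Rw.
               (\<forall>\<^sub>F \<epsilon> in at_right 0. \<forall>x. \<forall>t\<in>{0..T}.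
                  u x t \<epsilon> = (\<Sum>i=0..N. \<epsilon> ^ i * (U i x t + P i x (t / \<epsilon>\<^sup>2))) + Ru x t \<epsilon> \<and>
                  v x t \<epsilon> = (\<Sum>i=0..N. \<epsilon> ^ i * (V i x t + Q i x (t / \<epsilon>\<^sup>2))) + Rv x t \<epsilon> \<and>
                  w x t \<epsilon> = (\<Sum>i=0..N. \<epsilon> ^ i * (W i x t + S i x (t / \<epsilon>\<^sup>2))) + Rw x t \<epsilon>) \<and>
               residual_problem a b a3 b3 c1 c2 c3 k1 k2 k3 T N Ru Rv Rw"
      using residual_problem_partial_sums[OF ex d assms(7), of N]
      by (intro exI conjI[rotated]) (auto simp: partial_sum_def)
  qed
qed

end
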